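(* Let $(M,g)$ be a smooth, non-compact, complete, boundaryless, connected Riemannian manifold. A function $f:M\to\mathbb{R}$ is a viscosity solution of the Hamilton–Jacobi equation $|\nabla u|_g=1$ on $M$ if and only if, up to an additive constant, $f$ is a $dl$-function (i.e. there exists $c\in\mathbb{R}$ such that $f+c$ is a $dl$-function). Consequently, $$M(\natural)=\{\text{viscosity solutions of } |\nabla u|_g=1\}/\{\text{constant functions}\}.$$
   Context: $d$ is the Riemannian distance on $M$, $\nabla$ the Riemannian gradient, $|\cdot|_g$ the norm induced by $g$. Viscosity solution: a continuous function $u:M\to\mathbb{R}$ is a viscosity solution of $|\nabla u|_g=1$ on $M$ if for every $x\in M$ and every $C^1$ function $\varphi$ defined near $x$: if $u-\varphi$ has a local maximum at $x$ then $|\nabla\varphi(x)|_g\le 1$, and if $u-\varphi$ has a local minimum at $x$ then $|\nabla\varphi(x)|_g\ge 1$. $dl$-function: a function $h:M\to\mathbb{R}$ for which there exist a point $y\in M$ and a sequence of non-empty closed subsets $K_n\subseteq M$ with $d(y,K_n)\to\infty$ such that $h(x)=\lim_{n\to\infty}[d(x,K_n)-d(y,K_n)]$, the limit being in the compact-open topology (uniform convergence on compact sets). Here $d(x,K)=\inf_{z\in K}d(x,z)$. $M(\natural):=\{dl\text{-functions}\}/\{\text{constant functions}\}$, i.e. the set of classes of $dl$-functions, where two functions are identified if they differ by a constant (viewed as a set of classes of continuous functions modulo constants). *)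

theory Defs
  imports "HOL-Analysis.Analysis"
begin

text \<open>\<open>C_k_on k f U\<close> is meant for open \<open>U\<close>.  In finite dimension, \<open>f\<close> is of class \<open>C\<^sup>k\<^sup>+\<^sup>1\<close> iff it is
  differentiable and each of its directional derivatives is of class \<open>C\<^sup>k\<close>.\<close>

fun C_k_on :: "nat \<Rightarrow> ('e::euclidean_space \<Rightarrow> 'f::real_normed_vector) \<Rightarrow> 'e set \<Rightarrow> bool" where
  "C_k_on 0 f U \<longleftrightarrow> continuous_on U f"
| "C_k_on (Suc k) f U \<longleftrightarrow>
     f differentiable_on U \<and> (\<forall>v. C_k_on k (\<lambda>x. frechet_derivative f (at x) v) U)"

definition C_inf_on :: "('e::euclidean_space \<Rightarrow> 'f::real_normed_vector) \<Rightarrow> 'e set \<Rightarrow> bool" where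
  "C_inf_on f U \<longleftrightarrow> (\<forall>k. C_k_on k f U)"

text \<open>The points of the manifold are all the elements of a type \<open>'a\<close>, whose class provides a Hausdorff
  second countable topology; \<open>'e\<close> is the Euclidean model space, so the dimension is \<open>DIM('e)\<close>, and charts
  onto open subsets of \<open>'e\<close> mean that there is no boundary.
  Dimension 0 is not covered; a connected 0-dimensional manifold is a point.\<close>

type_synonym ('a, 'e) chart = "'a set \<times> ('a \<Rightarrow> 'e)"

abbreviation dom_chart :: "('a, 'e) chart \<Rightarrow> 'a set" where
  "dom_chart \<equiv> fst"

abbreviation app_chart :: "('a, 'e) chart \<Rightarrow> 'a \<Rightarrow> 'e" where
  "app_chart \<equiv> snd"

definition inv_chart :: "('a, 'e) chart \<Rightarrow> 'e \<Rightarrow> 'a" where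
  "inv_chart c = inv_into (dom_chart c) (app_chart c)"

definition is_chart :: "('a::topological_space, 'e::euclidean_space) chart \<Rightarrow> bool" where
  "is_chart c \<longleftrightarrow> open (dom_chart c) \<and> open (app_chart c ` dom_chart c) \<and>
     homeomorphism (dom_chart c) (app_chart c ` dom_chart c) (app_chart c) (inv_chart c)"

definition transition :: "('a, 'e) chart \<Rightarrow> ('a, 'e) chart \<Rightarrow> 'e \<Rightarrow> 'e" where
  "transition c c' = app_chart c' \<circ> inv_chart c"

definition smooth_atlas ::
    "('a::{t2_space, second_countable_topology}, 'e::euclidean_space) chart set \<Rightarrow> bool" where
  "smooth_atlas A \<longleftrightarrow>
     (\<forall>c\<in>A. is_chart c) \<and>
     (\<Union>c\<in>A. dom_chart c) = UNIV \<and>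
     (\<forall>c\<in>A. \<forall>c'\<in>A.
        C_inf_on (transition c c') (app_chart c ` (dom_chart c \<inter> dom_chart c')))"

definition C1_fun_on ::
    "('a::topological_space, 'e::euclidean_space) chart set \<Rightarrow> 'a set \<Rightarrow> ('a \<Rightarrow> real) \<Rightarrow> bool" where
  "C1_fun_on A U \<phi> \<longleftrightarrow>
     (\<forall>c\<in>A. C_k_on 1 (\<phi> \<circ> inv_chart c) (app_chart c ` (U \<inter> dom_chart c)))"

text \<open>A tangent vector at \<open>p\<close> is the family of its coordinate representations in the charts around \<open>p\<close>;
  these are related by the differentials of the transition maps.  The family is set to 0
  at the other charts, so that equality of tangent vectors is equality of functions.\<close>

type_synonym ('a, 'e) tvec = "('a, 'e) chart \<Rightarrow> 'e"

definition charts_at :: "('a, 'e) chart set \<Rightarrow> 'a \<Rightarrow> ('a, 'e) chart set" where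
  "charts_at A p = {c \<in> A. p \<in> dom_chart c}"

definition tangent_space ::
    "('a, 'e::euclidean_space) chart set \<Rightarrow> 'a \<Rightarrow> ('a, 'e) tvec set" where
  "tangent_space A p = {v.
     (\<forall>c\<in>charts_at A p. \<forall>c'\<in>charts_at A p.
        v c' = frechet_derivative (transition c c') (at (app_chart c p)) (v c)) \<and>
     (\<forall>c. c \<notin> charts_at A p \<longrightarrow> v c = 0)}"

text \<open>The tangent vector at \<open>p\<close> whose representation in the chart \<open>c\<close> is \<open>e\<close>.\<close>

definition coord_tvec ::
    "('a, 'e::euclidean_space) chart set \<Rightarrow> ('a, 'e) chart \<Rightarrow> 'a \<Rightarrow> 'e \<Rightarrow> ('a, 'e) tvec" where
  "coord_tvec A c p e = (\<lambda>c'. if c' \<in> charts_at A p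
     then frechet_derivative (transition c c') (at (app_chart c p)) e else 0)"

text \<open>By the chain rule, the choice of the chart is irrelevant for \<open>v\<close> in the tangent space at \<open>p\<close> and
  \<open>\<phi>\<close> differentiable near \<open>p\<close>.\<close>

definition differential ::
    "('a, 'e::euclidean_space) chart set \<Rightarrow> ('a \<Rightarrow> real) \<Rightarrow> 'a \<Rightarrow> ('a, 'e) tvec \<Rightarrow> real" where
  "differential A \<phi> p v =
     (let c = (SOME c. c \<in> charts_at A p)
      in frechet_derivative (\<phi> \<circ> inv_chart c) (at (app_chart c p)) (v c))"

definition inner_product_on_tangent_space ::
    "('a, 'e::euclidean_space) chart set \<Rightarrow> 'a \<Rightarrow>
     (('a, 'e) tvec \<Rightarrow> ('a, 'e) tvec \<Rightarrow> real) \<Rightarrow> bool" where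
  "inner_product_on_tangent_space A p b \<longleftrightarrow>
     (\<forall>u\<in>tangent_space A p. \<forall>v\<in>tangent_space A p. b u v = b v u) \<and>
     (\<forall>u\<in>tangent_space A p. \<forall>v\<in>tangent_space A p. \<forall>w\<in>tangent_space A p. \<forall>r.
        b (\<lambda>c. r *\<^sub>R u c + v c) w = r * b u w + b v w) \<and>
     (\<forall>v\<in>tangent_space A p. v \<noteq> (\<lambda>_. 0) \<longrightarrow> b v v > 0)"

definition riemannian_metric ::
    "('a, 'e::euclidean_space) chart set \<Rightarrow>
     ('a \<Rightarrow> ('a, 'e) tvec \<Rightarrow> ('a, 'e) tvec \<Rightarrow> real) \<Rightarrow> bool" where
  "riemannian_metric A g \<longleftrightarrow>
     (\<forall>p. inner_product_on_tangent_space A p (g p)) \<and>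
     (\<forall>c\<in>A. \<forall>e e'.
        C_inf_on (\<lambda>x. g (inv_chart c x)
                        (coord_tvec A c (inv_chart c x) e) (coord_tvec A c (inv_chart c x) e'))
          (app_chart c ` dom_chart c))"

definition tnorm ::
    "('a \<Rightarrow> ('a, 'e) tvec \<Rightarrow> ('a, 'e) tvec \<Rightarrow> real) \<Rightarrow> 'a \<Rightarrow> ('a, 'e) tvec \<Rightarrow> real" where
  "tnorm g p v = sqrt (g p v v)"

definition gradient ::
    "('a, 'e::euclidean_space) chart set \<Rightarrow> ('a \<Rightarrow> ('a, 'e) tvec \<Rightarrow> ('a, 'e) tvec \<Rightarrow> real) \<Rightarrow>
     ('a \<Rightarrow> real) \<Rightarrow> 'a \<Rightarrow> ('a, 'e) tvec" where
  "gradient A g \<phi> p =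
     (THE w. w \<in> tangent_space A p \<and> (\<forall>v\<in>tangent_space A p. g p w v = differential A \<phi> p v))"

text \<open>At the end points of the interval, \<open>at t within {a..b}\<close> gives one-sided derivatives, so the curve is
  \<open>C\<^sup>1\<close> up to and including the end points.\<close>

definition C1_curve_on ::
    "('a::topological_space, 'e::euclidean_space) chart set \<Rightarrow> real \<Rightarrow> real \<Rightarrow> (real \<Rightarrow> 'a) \<Rightarrow> bool"
  where
  "C1_curve_on A a b \<gamma> \<longleftrightarrow>
     continuous_on {a..b} \<gamma> \<and>
     (\<forall>c\<in>A. \<exists>D. continuous_on {t\<in>{a..b}. \<gamma> t \<in> dom_chart c} D \<and>
        (\<forall>t\<in>{a..b}. \<gamma> t \<in> dom_chart c \<longrightarrow>
           ((app_chart c \<circ> \<gamma>) has_vector_derivative D t) (at t within {a..b})))"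

definition piecewise_C1_curve ::
    "('a::topological_space, 'e::euclidean_space) chart set \<Rightarrow> (real \<Rightarrow> 'a) \<Rightarrow> bool" where
  "piecewise_C1_curve A \<gamma> \<longleftrightarrow>
     (\<exists>n (s::nat \<Rightarrow> real). s 0 = 0 \<and> s n = 1 \<and>
        (\<forall>i<n. s i < s (Suc i) \<and> C1_curve_on A (s i) (s (Suc i)) \<gamma>))"

definition velocity :: "('a, 'e::euclidean_space) chart set \<Rightarrow> (real \<Rightarrow> 'a) \<Rightarrow> real \<Rightarrow> ('a, 'e) tvec"
  where
  "velocity A \<gamma> t = (\<lambda>c. if c \<in> charts_at A (\<gamma> t)
     then vector_derivative (app_chart c \<circ> \<gamma>) (at t) else 0)"

text \<open>The velocity is meaningless at the finitely many break points of a piecewise \<open>C\<^sup>1\<close> curve and at 0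
  and 1; this does not affect the integral.\<close>

definition curve_length ::
    "('a, 'e::euclidean_space) chart set \<Rightarrow> ('a \<Rightarrow> ('a, 'e) tvec \<Rightarrow> ('a, 'e) tvec \<Rightarrow> real) \<Rightarrow>
     (real \<Rightarrow> 'a) \<Rightarrow> real" where
  "curve_length A g \<gamma> = integral {0..1} (\<lambda>t. tnorm g (\<gamma> t) (velocity A \<gamma> t))"

definition rdist ::
    "('a::topological_space, 'e::euclidean_space) chart set \<Rightarrow>
     ('a \<Rightarrow> ('a, 'e) tvec \<Rightarrow> ('a, 'e) tvec \<Rightarrow> real) \<Rightarrow> 'a \<Rightarrow> 'a \<Rightarrow> real" where
  "rdist A g p q =
     Inf {curve_length A g \<gamma> |\<gamma>. piecewise_C1_curve A \<gamma> \<and> \<gamma> 0 = p \<and> \<gamma> 1 = q}"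

definition rdist_set ::
    "('a::topological_space, 'e::euclidean_space) chart set \<Rightarrow>
     ('a \<Rightarrow> ('a, 'e) tvec \<Rightarrow> ('a, 'e) tvec \<Rightarrow> real) \<Rightarrow> 'a \<Rightarrow> 'a set \<Rightarrow> real" where
  "rdist_set A g x K = (INF z\<in>K. rdist A g x z)"

definition complete_riemannian ::
    "('a::topological_space, 'e::euclidean_space) chart set \<Rightarrow>
     ('a \<Rightarrow> ('a, 'e) tvec \<Rightarrow> ('a, 'e) tvec \<Rightarrow> real) \<Rightarrow> bool" where
  "complete_riemannian A g \<longleftrightarrow> Metric_space.mcomplete UNIV (rdist A g)"

definition local_max_at :: "('a::topological_space \<Rightarrow> real) \<Rightarrow> 'a \<Rightarrow> bool" where
  "local_max_at f x \<longleftrightarrow> (\<forall>\<^sub>F y in nhds x. f y \<le> f x)"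

definition local_min_at :: "('a::topological_space \<Rightarrow> real) \<Rightarrow> 'a \<Rightarrow> bool" where
  "local_min_at f x \<longleftrightarrow> (\<forall>\<^sub>F y in nhds x. f x \<le> f y)"

definition viscosity_solution ::
    "('a::topological_space, 'e::euclidean_space) chart set \<Rightarrow>
     ('a \<Rightarrow> ('a, 'e) tvec \<Rightarrow> ('a, 'e) tvec \<Rightarrow> real) \<Rightarrow> ('a \<Rightarrow> real) \<Rightarrow> bool" where
  "viscosity_solution A g u \<longleftrightarrow>
     continuous_on UNIV u \<and>
     (\<forall>x U \<phi>. open U \<and> x \<in> U \<and> C1_fun_on A U \<phi> \<longrightarrow>
        (local_max_at (\<lambda>y. u y - \<phi> y) x \<longrightarrow> tnorm g x (gradient A g \<phi> x) \<le> 1) \<and>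
        (local_min_at (\<lambda>y. u y - \<phi> y) x \<longrightarrow> tnorm g x (gradient A g \<phi> x) \<ge> 1))"

definition dl_function ::
    "('a::topological_space, 'e::euclidean_space) chart set \<Rightarrow>
     ('a \<Rightarrow> ('a, 'e) tvec \<Rightarrow> ('a, 'e) tvec \<Rightarrow> real) \<Rightarrow> ('a \<Rightarrow> real) \<Rightarrow> bool" where
  "dl_function A g h \<longleftrightarrow>
     (\<exists>y (K :: nat \<Rightarrow> 'a set).
        (\<forall>n. closed (K n) \<and> K n \<noteq> {}) \<and>
        filterlim (\<lambda>n. rdist_set A g y (K n)) at_top sequentially \<and>
        (\<forall>C. compact C \<longrightarrow>
           uniform_limit C (\<lambda>n x. rdist_set A g x (K n) - rdist_set A g y (K n)) h sequentially))"

text \<open>Equality up to a constant on the space of continuous functions.  For a set \<open>F\<close> of continuous functions,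
  \<open>F // eq_mod_const\<close> is the image of \<open>F\<close> in the quotient of that space by the constants:
  \<open>F\<close> itself need not be closed under adding constants.\<close>

definition eq_mod_const :: "(('a::topological_space \<Rightarrow> real) \<times> ('a \<Rightarrow> real)) set" where
  "eq_mod_const = {(f, h). continuous_on UNIV f \<and> continuous_on UNIV h \<and>
     (\<exists>c. \<forall>x. h x = f x + c)}"

definition dl_boundary ::
    "('a::topological_space, 'e::euclidean_space) chart set \<Rightarrow>
     ('a \<Rightarrow> ('a, 'e) tvec \<Rightarrow> ('a, 'e) tvec \<Rightarrow> real) \<Rightarrow> ('a \<Rightarrow> real) set set" where
  "dl_boundary A g = {h. dl_function A g h} // eq_mod_const"

end

theory Submission
  imports Defs
begin

text \<open>The equation \<open>|\<nabla>u| = 1\<close> has a purely metric meaning: \<open>f\<close> is a viscosity solution if and only if it is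
  1-Lipschitz for the Riemannian distance \<open>d\<close> and descends at unit rate, in the sense that for every
  \<open>\<kappa> < 1\<close> each point \<open>x\<close> is a limit of points \<open>q\<close> with \<open>f q < f x - \<kappa> * d x q\<close>
  (\<open>viscosity_iff_metric\<close>). What remains is metric geometry.

  Let \<open>f\<close> have these two properties and let \<open>K\<^sub>n = {f \<le> -n}\<close>. Then \<open>d(x, K\<^sub>n) = f x + n\<close> as soon as
  \<open>f x \<ge> -n\<close> (\<open>distance_to_sublevel_set\<close>). The Lipschitz property gives one inequality. For the other one
  has to walk from \<open>x\<close> down to the level \<open>-n\<close> along a path that is hardly longer than \<open>f x + n\<close>. Ekeland's
  variational principle on the complete space \<open>M\<close>, applied to \<open>max f (-n)\<close> with slope \<open>\<kappa> < 1\<close>, leads to a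
  point from which no further descent at rate \<open>\<kappa>\<close> is possible; since \<open>f\<close> descends at unit rate, such a
  point lies in \<open>K\<^sub>n\<close>. Hence the normalized distances to \<open>K\<^sub>n\<close> agree with \<open>f - f y\<close> on a given compact
  set for all large \<open>n\<close>, so that \<open>f - f y\<close> is a dl-function (\<open>viscosity_imp_dl\<close>).

  Conversely, the normalized distances are 1-Lipschitz, and an almost shortest curve from \<open>x\<close> to a
  remote set \<open>K\<close> meets the sphere of radius \<open>r\<close> around \<open>x\<close> at a point whose distance to \<open>K\<close> is almost
  \<open>d(x, K) - r\<close>. For small \<open>r\<close> this sphere is compact, so that both properties survive the locally uniform
  limit (\<open>dl_Lipschitz\<close>, \<open>dl_descends\<close>).

  The link between the equation and the metric is local. In a chart at \<open>p\<close> the metric tensor is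
  nearly constant, so that \<open>d p q\<close> is the norm \<open>N q\<close> of the coordinate difference up to a factor that tends
  to 1 as \<open>q\<close> tends to \<open>p\<close> (\<open>d_le_nearby\<close>, \<open>le_d_nearby\<close>). A \<open>C\<^sup>1\<close> function with \<open>|\<nabla>\<phi>| < 1\<close> at \<open>p\<close>
  cannot touch \<open>f\<close> from below if \<open>f\<close> descends at unit rate, and one with \<open>|\<nabla>\<phi>| > 1\<close> cannot touch a
  1-Lipschitz function from above. For a viscosity solution \<open>f\<close>, the test functions \<open>L * N + C * N\<^sup>2\<close> with
  \<open>L > 1\<close> show that \<open>f\<close> has slope at most 1 at \<open>p\<close>, and integration along curves turns these
  infinitesimal bounds into the Lipschitz property; the rounded cones \<open>- k * sqrt (s\<^sup>2 + N\<^sup>2)\<close> with \<open>k < 1\<close>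
  show that \<open>f\<close> does not stay above a cone of slope less than 1 with apex \<open>(p, f p)\<close>.\<close>

section \<open>Positive definite bilinear forms\<close>

definition form_norm :: "('e \<Rightarrow> 'e \<Rightarrow> real) \<Rightarrow> 'e \<Rightarrow> real" where
  "form_norm B x = sqrt (B x x)"

locale inner_form =
  fixes B :: "'e::euclidean_space \<Rightarrow> 'e \<Rightarrow> real"
  assumes bil: "bounded_bilinear B"
    and sym: "B x y = B y x"
    and pos: "x \<noteq> 0 \<Longrightarrow> B x x > 0"
begin

interpretation bounded_bilinear B by (rule bil)

abbreviation fnorm :: "'e \<Rightarrow> real" where
  "fnorm \<equiv> form_norm B"

lemmas fnorm_def = form_norm_def[of B]

lemma nonneg: "B x x \<ge> 0"
  using pos[of x] by (cases "x = 0") (auto simp: zero_left)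

lemma fnorm_nonneg [simp]: "fnorm x \<ge> 0"
  by (simp add: fnorm_def nonneg)

lemma fnorm_sq: "(fnorm x)\<^sup>2 = B x x"
  by (simp add: fnorm_def nonneg)

lemma fnorm_zero [simp]: "fnorm 0 = 0"
  by (simp add: fnorm_def zero_left)

lemma fnorm_pos: "x \<noteq> 0 \<Longrightarrow> fnorm x > 0"
  by (simp add: fnorm_def pos)

lemma fnorm_scale: "fnorm (r *\<^sub>R x) = \<bar>r\<bar> * fnorm x"
  by (simp add: fnorm_def scaleR_left scaleR_right real_sqrt_mult flip: mult.assoc)

lemma fnorm_minus: "fnorm (- x) = fnorm x"
  by (simp add: fnorm_def minus_left minus_right)

lemma cauchy_schwarz: "\<bar>B x y\<bar> \<le> fnorm x * fnorm y"
proof (cases "y = 0")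
  case True
  then show ?thesis by (simp add: zero_right)
next
  case False
  define r where "r = B x y / B y y"
  have p: "B y y > 0" using False pos by auto
  have "0 \<le> B (x - r *\<^sub>R y) (x - r *\<^sub>R y)" by (rule nonneg)
  also have "\<dots> = B x x - 2 * r * B x y + r * r * B y y"
    by (simp add: diff_left diff_right scaleR_left scaleR_right sym[of y x] algebra_simps)
  also have "\<dots> = B x x - (B x y)\<^sup>2 / B y y"
    using p by (simp add: r_def power2_eq_square field_simps)
  finally have "(B x y)\<^sup>2 \<le> B x x * B y y"
    using p by (simp add: field_simps)
  then have "sqrt ((B x y)\<^sup>2) \<le> sqrt (B x x * B y y)" by (rule real_sqrt_le_mono)
  then show ?thesis by (simp add: fnorm_def real_sqrt_mult)
qed

lemma fnorm_triangle: "fnorm (x + y) \<le> fnorm x + fnorm y"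
proof (rule power2_le_imp_le)
  have "(fnorm (x + y))\<^sup>2 = B x x + 2 * B x y + B y y"
    by (simp add: fnorm_sq add_left add_right sym[of y x])
  also have "\<dots> \<le> B x x + 2 * (fnorm x * fnorm y) + B y y"
    using cauchy_schwarz[of x y] by linarith
  also have "\<dots> = (fnorm x + fnorm y)\<^sup>2"
    by (simp add: power2_sum fnorm_sq)
  finally show "(fnorm (x + y))\<^sup>2 \<le> (fnorm x + fnorm y)\<^sup>2" .
qed simp

lemma fnorm_diff_le: "\<bar>fnorm x - fnorm y\<bar> \<le> fnorm (x - y)"
  using fnorm_triangle[of "x - y" y] fnorm_triangle[of "y - x" x] fnorm_minus[of "x - y"]
  by auto

lemma continuous_on_form [continuous_intros]:
  "continuous_on S f \<Longrightarrow> continuous_on S h \<Longrightarrow> continuous_on S (\<lambda>x. B (f x) (h x))"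
  by (rule continuous_on)

lemma continuous_on_fnorm [continuous_intros]:
  "continuous_on S f \<Longrightarrow> continuous_on S (\<lambda>x. fnorm (f x))"
  unfolding fnorm_def by (intro continuous_intros)

lemma has_derivative_quadratic:
  "((\<lambda>y. B (y - a) (y - a)) has_derivative (\<lambda>e. 2 * B (y - a) e)) (at y within S)"
proof -
  have "((\<lambda>y. B (y - a) (y - a)) has_derivative (\<lambda>e. B (y - a) e + B e (y - a))) (at y within S)"
    by (rule FDERIV) (auto intro!: derivative_eq_intros)
  then show ?thesis by (simp add: sym[of _ "y - a"])
qed

text \<open>Compactness of the Euclidean unit sphere compares the two norms.\<close>

lemma norm_le_fnorm:
  obtains m where "m > 0" "\<And>x. m * norm x \<le> fnorm x"
proof -
  have "compact (sphere 0 1 :: 'e set)" by simp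
  moreover have "(sphere 0 1 :: 'e set) \<noteq> {}" by simp
  moreover have "continuous_on (sphere 0 1) fnorm" by (intro continuous_intros)
  ultimately obtain x0 where x0: "x0 \<in> sphere 0 1" "\<And>x. x \<in> sphere 0 1 \<Longrightarrow> fnorm x0 \<le> fnorm x"
    using continuous_attains_inf by (metis (no_types, lifting))
  have "x0 \<noteq> 0" using x0 by auto
  have "fnorm x0 * norm x \<le> fnorm x" for x
  proof (cases "x = 0")
    case False
    have "fnorm x0 \<le> fnorm ((1 / norm x) *\<^sub>R x)" using False by (intro x0) simp
    then show ?thesis using False by (simp add: fnorm_scale field_simps)
  qed simp
  with fnorm_pos[OF \<open>x0 \<noteq> 0\<close>] show ?thesis using that by blast
qed

lemma fnorm_le_norm:
  obtains M where "M > 0" "\<And>x. fnorm x \<le> M * norm x"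
proof -
  obtain K where K: "K > 0" "\<And>x y. norm (B x y) \<le> norm x * norm y * K"
    using pos_bounded by blast
  have "fnorm x \<le> sqrt K * norm x" for x
  proof -
    have "B x x \<le> (norm x)\<^sup>2 * K" using K(2)[of x x] by (simp add: power2_eq_square)
    then have "sqrt (B x x) \<le> sqrt ((norm x)\<^sup>2 * K)" by (rule real_sqrt_le_mono)
    then show ?thesis by (simp add: fnorm_def real_sqrt_mult mult.commute)
  qed
  then show ?thesis using K that[of "sqrt K"] by simp
qed

lemma fnorm_increment_le:
  assumes f: "(f has_vector_derivative V) (at t within S)" and e: "e > 0"
  shows "\<forall>\<^sub>F s in at t within S. fnorm (f s - f t) \<le> (fnorm V + e) * \<bar>s - t\<bar>"
proof -
  obtain M where M: "M > 0" "\<And>x. fnorm x \<le> M * norm x" using fnorm_le_norm by blast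
  have "e / M > 0" using e M by simp
  then obtain d where d: "d > 0" "\<And>s. s \<in> S \<Longrightarrow> norm (s - t) < d \<Longrightarrow>
      norm (f s - f t - (s - t) *\<^sub>R V) \<le> e / M * norm (s - t)"
    using f unfolding has_vector_derivative_def has_derivative_within_alt by blast
  have "fnorm (f s - f t) \<le> (fnorm V + e) * \<bar>s - t\<bar>" if "s \<in> S" "norm (s - t) < d" for s
  proof -
    have "fnorm (f s - f t) \<le> fnorm (f s - f t - (s - t) *\<^sub>R V) + fnorm ((s - t) *\<^sub>R V)"
      using fnorm_triangle[of "f s - f t - (s - t) *\<^sub>R V" "(s - t) *\<^sub>R V"] by simp
    moreover have "fnorm (f s - f t - (s - t) *\<^sub>R V) \<le> M * (e / M * norm (s - t))"
      using M(2) mult_left_mono[OF d(2)[OF that], of M] M(1) order_trans by fastforce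
    moreover have "M * (e / M * norm (s - t)) = e * \<bar>s - t\<bar>" using M(1) by simp
    moreover have "fnorm ((s - t) *\<^sub>R V) = \<bar>s - t\<bar> * fnorm V" by (rule fnorm_scale)
    ultimately have "fnorm (f s - f t) \<le> e * \<bar>s - t\<bar> + \<bar>s - t\<bar> * fnorm V" by linarith
    then show ?thesis by (simp add: algebra_simps)
  qed
  then show ?thesis
    unfolding eventually_at using d(1) by (auto simp: dist_norm)
qed

text \<open>Riesz representation: the map \<open>w \<mapsto> B w\<close> into the dual space is linear and injective,
  hence surjective for reasons of dimension.\<close>

lemma riesz:
  assumes l: "linear l"
  shows "\<exists>w. \<forall>v. B w v = l v"
proof -
  define \<Phi> where "\<Phi> w = (\<Sum>b\<in>Basis. B w b *\<^sub>R b)" for w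
  have inner: "\<Phi> w \<bullet> v = B w v" for w v
  proof -
    have "\<Phi> w \<bullet> v = (\<Sum>b\<in>Basis. B w b * (v \<bullet> b))"
      by (simp add: \<Phi>_def inner_sum_left) (simp add: inner_commute)
    also have "\<dots> = B w (\<Sum>b\<in>Basis. (v \<bullet> b) *\<^sub>R b)"
      by (simp add: sum_right scaleR_right mult.commute)
    finally show ?thesis by (simp add: euclidean_representation)
  qed
  have lin: "linear \<Phi>"
    by (rule linearI)
       (simp_all add: \<Phi>_def add_left scaleR_left scaleR_add_left sum.distrib scaleR_sum_right)
  have "inj \<Phi>"
  proof (rule linear_injective_0[OF lin, THEN iffD2], intro allI impI)
    fix w assume "\<Phi> w = 0"
    then have "B w w = 0" using inner[of w w] by simp
    then show "w = 0" using pos[of w] by force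
  qed
  then have "surj \<Phi>" using lin linear_injective_imp_surjective by blast
  then obtain w where w: "\<Phi> w = (\<Sum>b\<in>Basis. l b *\<^sub>R b)" by (metis surjD)
  have "B w v = l v" for v
  proof -
    have "B w v = (\<Sum>b\<in>Basis. l b * (v \<bullet> b))"
      by (simp add: inner[symmetric] w inner_sum_left) (simp add: inner_commute)
    also have "\<dots> = l (\<Sum>b\<in>Basis. (v \<bullet> b) *\<^sub>R b)"
      by (simp add: linear_sum[OF l] linear_scale[OF l] mult.commute)
    finally show ?thesis by (simp add: euclidean_representation)
  qed
  then show ?thesis by blast
qed

end

lemma isCont_tendsto_nhds: "isCont f x \<Longrightarrow> (f \<longlongrightarrow> f x) (nhds x)"
  by (simp add: isCont_def tendsto_at_iff_tendsto_nhds)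

section \<open>Maps of class C1 in coordinates\<close>

lemma C1_onI:
  assumes "\<And>x. x \<in> U \<Longrightarrow> (f has_derivative f' x) (at x)"
    and "\<And>v. continuous_on U (\<lambda>x. f' x v)"
  shows "C_k_on 1 f U"
proof -
  have eq: "frechet_derivative f (at x) = f' x" if "x \<in> U" for x
    using assms(1)[OF that] by (metis frechet_derivative_at)
  have "f differentiable_on U"
    unfolding differentiable_on_def
    using assms(1) has_derivative_at_withinI differentiable_def by blast
  moreover have "continuous_on U (\<lambda>x. frechet_derivative f (at x) v)" for v
    using assms(2)[of v] by (simp add: eq cong: continuous_on_cong)
  ultimately show ?thesis by simp
qed

lemma C1_on_has_derivative:
  assumes "C_k_on 1 f U" "open U" "x \<in> U"
  shows "(f has_derivative frechet_derivative f (at x)) (at x)"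
  using assms by (metis C_k_on.simps(2) One_nat_def at_within_open differentiable_on_def
      frechet_derivative_works)

text \<open>A linear map is determined by its values on the finite basis, so continuity for each fixed argument
  already gives continuity when the argument varies as well.\<close>

lemma continuous_on_linear_family:
  fixes l :: "'b::topological_space \<Rightarrow> 'e::euclidean_space \<Rightarrow> 'f::real_normed_vector"
  assumes lin: "\<And>x. x \<in> S \<Longrightarrow> linear (l x)"
    and l: "\<And>v. continuous_on S (\<lambda>x. l x v)" and h: "continuous_on S h"
  shows "continuous_on S (\<lambda>x. l x (h x))"
proof -
  have "l x (h x) = (\<Sum>b\<in>Basis. (h x \<bullet> b) *\<^sub>R l x b)" if "x \<in> S" for x
  proof -
    have "l x (h x) = l x (\<Sum>b\<in>Basis. (h x \<bullet> b) *\<^sub>R b)" by (simp add: euclidean_representation)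
    then show ?thesis
      by (simp add: linear_sum[OF lin[OF that]] linear_scale[OF lin[OF that]])
  qed
  moreover have "continuous_on S (\<lambda>x. \<Sum>b\<in>Basis. (h x \<bullet> b) *\<^sub>R l x b)"
    by (intro continuous_intros l h)
  ultimately show ?thesis by (simp cong: continuous_on_cong)
qed

section \<open>A one-sided mean value inequality and Ekeland's principle\<close>

text \<open>At the last point where \<open>H t - \<epsilon> * t\<close> is at most its initial value, the local bound would
  produce a later such point, unless that point is \<open>b\<close>.\<close>

lemma right_Dini_bound:
  fixes H :: "real \<Rightarrow> real"
  assumes ab: "a \<le> b" and H: "continuous_on {a..b} H"
    and loc: "\<And>t. a \<le> t \<Longrightarrow> t < b \<Longrightarrow>
      \<forall>\<^sub>F s in at t within {a..b}. t < s \<longrightarrow> H s - H t \<le> \<epsilon> * (s - t)"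
  shows "H b - H a \<le> \<epsilon> * (b - a)"
proof (rule ccontr)
  assume not: "\<not> ?thesis"
  define G where "G s = H s - \<epsilon> * s" for s
  have G: "continuous_on {a..b} G" unfolding G_def by (intro continuous_intros H)
  have "G b > G a" using not by (simp add: G_def algebra_simps)
  let ?S = "{t\<in>{a..b}. G t \<le> G a}"
  have "closed ?S" by (intro continuous_on_closed_Collect_le G continuous_intros closed_atLeastAtMost)
  then have "compact ?S" using compact_Int_closed[of "{a..b}" ?S] by (simp add: Int_def conj_ac)
  moreover have "?S \<noteq> {}" using ab by auto
  ultimately obtain c where c: "c \<in> ?S" "\<And>t. t \<in> ?S \<Longrightarrow> t \<le> c"
    using compact_attains_sup[of ?S] by blast
  have "c < b" using c \<open>G b > G a\<close> by (cases "c = b") auto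
  then obtain d where d: "d > 0"
    "\<And>s. s \<in> {a..b} \<Longrightarrow> s \<noteq> c \<Longrightarrow> dist s c < d \<Longrightarrow> c < s \<Longrightarrow> H s - H c \<le> \<epsilon> * (s - c)"
    using loc[of c] c unfolding eventually_at by auto
  define s where "s = min b (c + d / 2)"
  have s: "c < s" "s \<in> {a..b}" "dist s c < d"
    using \<open>c < b\<close> d(1) c by (auto simp: s_def dist_real_def min_def)
  then have "G s \<le> G c" using d(2)[of s] by (simp add: G_def algebra_simps)
  then show False using c s by fastforce
qed

context Metric_space
begin

text \<open>Let \<open>S x\<close> be the set of points that can be reached from \<open>x\<close> by descending at rate at least \<open>\<kappa>\<close>. Moving from
  \<open>X n\<close> to a point of \<open>S (X n)\<close> that realizes at least half of the possible decrease halves the gap between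
  \<open>h (X n)\<close> and its infimum over \<open>S (X n)\<close> at each step. The gap bounds the distance from
  \<open>X n\<close> within \<open>S (X n)\<close>, so these nested sets shrink to the limit of the sequence.\<close>

lemma Ekeland_variational_principle:
  fixes h :: "'a \<Rightarrow> real"
  assumes complete: "mcomplete" and x0: "x0 \<in> M" and \<kappa>: "\<kappa> > 0"
    and bounded: "\<And>x. x \<in> M \<Longrightarrow> b \<le> h x"
    and lsc: "\<And>\<sigma> z r. limitin mtopology \<sigma> z sequentially \<Longrightarrow> (\<And>n. h (\<sigma> n) \<le> r) \<Longrightarrow> h z \<le> r"
  obtains z where "z \<in> M" "h z + \<kappa> * d x0 z \<le> h x0"
    "\<And>y. y \<in> M \<Longrightarrow> y \<noteq> z \<Longrightarrow> h z < h y + \<kappa> * d z y"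
proof -
  define S where "S x = {y \<in> M. h y + \<kappa> * d x y \<le> h x}" for x
  define i where "i x = Inf (h ` S x)" for x
  have S_self: "x \<in> S x" if "x \<in> M" for x using that by (simp add: S_def)
  have S_M: "y \<in> M" if "y \<in> S x" for x y using that by (simp add: S_def)
  have S_trans: "z \<in> S x" if "x \<in> M" "y \<in> S x" "z \<in> S y" for x y z
  proof -
    have "\<kappa> * d x z \<le> \<kappa> * (d x y + d y z)"
      using that \<kappa> by (intro mult_left_mono triangle) (auto simp: S_def)
    then show ?thesis using that by (simp add: S_def algebra_simps)
  qed
  have bdd: "bdd_below (h ` S x)" for x using bounded by (intro bdd_belowI[of _ b]) (auto simp: S_def)
  have i_le: "i x \<le> h y" if "y \<in> S x" for x y unfolding i_def using bdd that by (intro cInf_lower) auto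
  have "\<exists>y \<in> S x. h y \<le> (h x + i x) / 2" if x: "x \<in> M" for x
  proof (cases "i x = h x")
    case True
    then show ?thesis using S_self[OF x] by auto
  next
    case False
    then have "i x < h x" using i_le[OF S_self[OF x]] by simp
    then have "Inf (h ` S x) < (h x + i x) / 2" by (simp add: i_def)
    moreover have "h ` S x \<noteq> {}" using S_self[OF x] by blast
    ultimately have "\<exists>w\<in>h ` S x. w < (h x + i x) / 2" by (intro cInf_lessD)
    then obtain y where "y \<in> S x" "h y < (h x + i x) / 2" by blast
    then show ?thesis by (intro bexI[of _ y]) auto
  qed
  then obtain nxt where nxt: "\<And>x. x \<in> M \<Longrightarrow> nxt x \<in> S x" "\<And>x. x \<in> M \<Longrightarrow> h (nxt x) \<le> (h x + i x) / 2"
    by metis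
  define X where "X n = (nxt ^^ n) x0" for n
  have X0: "X 0 = x0" and XS: "X (Suc n) = nxt (X n)" for n by (simp_all add: X_def)
  have XM: "X n \<in> M" for n
  proof (induction n)
    case (Suc n)
    then show ?case using S_M[OF nxt(1)] XS by simp
  qed (simp add: X0 x0)
  have X_in: "X m \<in> S (X n)" if "n \<le> m" for m n
    using that
  proof (induction rule: dec_induct)
    case base
    show ?case by (rule S_self[OF XM])
  next
    case (step m)
    then show ?case using S_trans[OF XM] nxt(1)[OF XM] XS by metis
  qed
  define D where "D = h (X 0) - i (X 0)"
  have gap: "h (X n) - i (X n) \<le> D * (1 / 2) ^ n" for n
  proof (induction n)
    case (Suc n)
    have "S (X (Suc n)) \<subseteq> S (X n)" using S_trans[OF XM X_in[of n "Suc n"]] by auto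
    then have "i (X n) \<le> i (X (Suc n))"
      unfolding i_def using S_self[OF XM] bdd by (intro cInf_superset_mono) auto
    moreover have "h (X (Suc n)) \<le> (h (X n) + i (X n)) / 2" using nxt(2)[OF XM] XS by simp
    ultimately show ?case using Suc by simp
  qed (simp add: D_def)
  have near: "d (X n) y \<le> D / \<kappa> * (1 / 2) ^ n" if "y \<in> S (X n)" for n y
  proof -
    have "\<kappa> * d (X n) y \<le> h (X n) - h y" using that by (simp add: S_def)
    also have "\<dots> \<le> D * (1 / 2) ^ n" using i_le[OF that] gap[of n] by linarith
    finally show ?thesis using \<kappa> by (simp add: field_simps)
  qed
  have lim0: "(\<lambda>n. D / \<kappa> * (1 / 2) ^ n) \<longlonglongrightarrow> 0"
    by (intro tendsto_mult_right_zero LIMSEQ_power_zero) simp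
  have "MCauchy X"
    unfolding MCauchy_def
  proof (intro conjI allI impI)
    fix e :: real assume "e > 0"
    then obtain N where N: "\<And>n. n \<ge> N \<Longrightarrow> D / \<kappa> * (1 / 2) ^ n < e"
      using order_tendstoD(2)[OF lim0, of e] by (auto simp: eventually_sequentially)
    have "d (X n) (X n') < e" if "N \<le> n" "N \<le> n'" for n n'
    proof (cases "n \<le> n'")
      case True
      then show ?thesis using near[OF X_in[OF True]] N[OF that(1)] by simp
    next
      case False
      then have "n' \<le> n" by simp
      then show ?thesis using near[OF X_in[of n' n]] N[OF that(2)] commute[of "X n" "X n'"] by simp
    qed
    then show "\<exists>N. \<forall>n n'. N \<le> n \<longrightarrow> N \<le> n' \<longrightarrow> d (X n) (X n') < e" by blast
  qed (use XM in auto)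
  then obtain z where z: "limitin mtopology X z sequentially"
    using complete mcomplete_def by blast
  have zM: "z \<in> M" using z by (simp add: limitin_metric)
  have z_in: "z \<in> S (X n)" for n
  proof -
    have "h z \<le> h (X n) - \<kappa> * d (X n) z + e" if "e > 0" for e
    proof -
      have "e / \<kappa> > 0" using that \<kappa> by simp
      then obtain N where N: "\<And>m. m \<ge> N \<Longrightarrow> d (X m) z < e / \<kappa>"
        using z unfolding limit_metric_sequentially by blast
      let ?\<sigma> = "\<lambda>m. X (m + max n N)"
      have "limitin mtopology ?\<sigma> z sequentially"
        using z by (rule limitin_sequentially_offset)
      moreover have "h (?\<sigma> m) \<le> h (X n) - \<kappa> * d (X n) z + e" for m
      proof -
        have "d (X n) z \<le> d (X n) (?\<sigma> m) + d (?\<sigma> m) z" by (intro triangle XM zM)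
        also have "d (?\<sigma> m) z < e / \<kappa>" by (rule N) (simp add: trans_le_add2)
        finally have "d (X n) z \<le> d (X n) (?\<sigma> m) + e / \<kappa>" by simp
        then have "\<kappa> * d (X n) z \<le> \<kappa> * (d (X n) (?\<sigma> m) + e / \<kappa>)" using \<kappa> by simp
        then have "\<kappa> * d (X n) z \<le> \<kappa> * d (X n) (?\<sigma> m) + e" using \<kappa> by (simp add: distrib_left)
        moreover have "h (?\<sigma> m) + \<kappa> * d (X n) (?\<sigma> m) \<le> h (X n)"
          using X_in[of n "m + max n N"] by (simp add: S_def)
        ultimately show ?thesis by linarith
      qed
      ultimately show ?thesis by (rule lsc)
    qed
    then have "h z \<le> h (X n) - \<kappa> * d (X n) z" by (rule field_le_epsilon)
    then show ?thesis using zM by (simp add: S_def)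
  qed
  show ?thesis
  proof (rule that[OF zM])
    show "h z + \<kappa> * d x0 z \<le> h x0" using z_in[of 0] by (simp add: S_def X0)
    fix y assume y: "y \<in> M" "y \<noteq> z"
    show "h z < h y + \<kappa> * d z y"
    proof (rule ccontr)
      assume "\<not> ?thesis"
      then have "y \<in> S z" using y by (simp add: S_def)
      then have y_in: "y \<in> S (X n)" for n using S_trans[OF XM z_in] by blast
      have "d z y \<le> 2 * (D / \<kappa> * (1 / 2) ^ n)" for n
        using triangle[OF zM XM[of n] y(1)] commute[of z "X n"] near[OF z_in[of n]] near[OF y_in[of n]]
        by linarith
      then have "d z y \<le> 0"
        using tendsto_mult_right_zero[OF lim0, of 2] by (intro LIMSEQ_le_const[of _ 0]) auto
      moreover have "0 < d z y" using y(2) by (intro mdist_pos_less zM y(1)) auto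
      ultimately show False by simp
    qed
  qed
qed

end

section \<open>Riemannian manifolds in charts\<close>

locale riemannian_manifold =
  fixes A :: "('a::{t2_space, second_countable_topology}, 'e::euclidean_space) chart set"
    and g :: "'a \<Rightarrow> ('a, 'e) tvec \<Rightarrow> ('a, 'e) tvec \<Rightarrow> real"
  assumes atlas: "smooth_atlas A" and metric: "riemannian_metric A g"
begin

lemma chart_at_exists: "\<exists>c. c \<in> charts_at A p"
  using atlas unfolding smooth_atlas_def charts_at_def by blast

lemma charts_atD: "c \<in> charts_at A p \<Longrightarrow> c \<in> A" "c \<in> charts_at A p \<Longrightarrow> p \<in> dom_chart c"
  by (auto simp: charts_at_def)

lemma
  assumes "c \<in> A"
  shows open_dom: "open (dom_chart c)"
    and open_image: "open (app_chart c ` dom_chart c)"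
    and chart_homeo: "homeomorphism (dom_chart c) (app_chart c ` dom_chart c) (app_chart c) (inv_chart c)"
  using assms atlas by (auto simp: smooth_atlas_def is_chart_def)

lemma inv_app [simp]: "c \<in> A \<Longrightarrow> q \<in> dom_chart c \<Longrightarrow> inv_chart c (app_chart c q) = q"
  using chart_homeo by (metis homeomorphism_apply1)

lemma app_inv [simp]:
  "c \<in> A \<Longrightarrow> x \<in> app_chart c ` dom_chart c \<Longrightarrow> app_chart c (inv_chart c x) = x"
  using chart_homeo by (metis homeomorphism_apply2)

lemma inv_in_dom [simp]: "c \<in> A \<Longrightarrow> x \<in> app_chart c ` dom_chart c \<Longrightarrow> inv_chart c x \<in> dom_chart c"
  using chart_homeo[of c] by (auto simp: homeomorphism_def)

lemma continuous_app: "c \<in> A \<Longrightarrow> continuous_on (dom_chart c) (app_chart c)"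
  using chart_homeo homeomorphism_cont1 by blast

lemma continuous_inv: "c \<in> A \<Longrightarrow> continuous_on (app_chart c ` dom_chart c) (inv_chart c)"
  using chart_homeo homeomorphism_cont2 by blast

lemma isCont_app: "c \<in> charts_at A p \<Longrightarrow> isCont (app_chart c) p"
  using continuous_app[of c] open_dom[of c] by (simp add: charts_at_def continuous_on_eq_continuous_at)

lemma open_app_image:
  assumes "c \<in> A" "open U" "U \<subseteq> dom_chart c"
  shows "open (app_chart c ` U)"
proof -
  have "openin (top_of_set (dom_chart c)) U"
    using assms by (simp add: open_dom openin_open_eq)
  then have "openin (top_of_set (app_chart c ` dom_chart c)) (app_chart c ` U)"
    using chart_homeo[OF assms(1)] homeomorphism_imp_open_map by blast
  then show ?thesis using assms open_image openin_open_eq by blast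
qed
definition dtrans :: "('a, 'e) chart \<Rightarrow> ('a, 'e) chart \<Rightarrow> 'a \<Rightarrow> 'e \<Rightarrow> 'e" where
  "dtrans c c' p = frechet_derivative (transition c c') (at (app_chart c p))"

lemma transition_C1:
  assumes "c \<in> A" "c' \<in> A"
  shows "C_k_on 1 (transition c c') (app_chart c ` (dom_chart c \<inter> dom_chart c'))"
  using assms atlas unfolding smooth_atlas_def C_inf_on_def by blast

lemma open_overlap:
  assumes "c \<in> A" "c' \<in> A"
  shows "open (app_chart c ` (dom_chart c \<inter> dom_chart c'))"
  using assms by (intro open_app_image) (auto simp: open_dom)

lemma transition_has_derivative:
  assumes "c \<in> charts_at A p" "c' \<in> charts_at A p"
  shows "(transition c c' has_derivative dtrans c c' p) (at (app_chart c p))"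
  unfolding dtrans_def
  using assms by (intro C1_on_has_derivative[OF transition_C1] open_overlap) (auto simp: charts_at_def)

lemma linear_dtrans:
  assumes "c \<in> charts_at A p" "c' \<in> charts_at A p"
  shows "linear (dtrans c c' p)"
  using transition_has_derivative[OF assms] has_derivative_linear by blast

lemma transition_app [simp]:
  "c \<in> charts_at A p \<Longrightarrow> transition c c' (app_chart c p) = app_chart c' p"
  by (simp add: transition_def charts_at_def)

lemma dtrans_self:
  assumes "c \<in> charts_at A p"
  shows "dtrans c c p e = e"
proof -
  have c: "c \<in> A" "p \<in> dom_chart c" using assms by (auto dest: charts_atD)
  have "((\<lambda>x. x) has_derivative (\<lambda>x. x)) (at (app_chart c p))" by (rule has_derivative_ident)
  then have "(transition c c has_derivative (\<lambda>x. x)) (at (app_chart c p))"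
    by (rule has_derivative_transform_within_open[OF _ open_image[OF c(1)]])
       (use c in \<open>auto simp: transition_def\<close>)
  then show ?thesis
    using transition_has_derivative[OF assms assms] has_derivative_unique by metis
qed

lemma dtrans_chain:
  assumes "c \<in> charts_at A p" "c' \<in> charts_at A p" "c'' \<in> charts_at A p"
  shows "dtrans c' c'' p (dtrans c c' p e) = dtrans c c'' p e"
proof -
  have c: "c \<in> A" "p \<in> dom_chart c" "c' \<in> A" "p \<in> dom_chart c'" using assms by (auto dest: charts_atD)
  have "(transition c' c'' has_derivative dtrans c' c'' p) (at (transition c c' (app_chart c p)))"
    using transition_has_derivative[OF assms(2,3)] assms by simp
  from diff_chain_at[OF transition_has_derivative[OF assms(1,2)] this]
  have "(transition c' c'' \<circ> transition c c' has_derivative dtrans c' c'' p \<circ> dtrans c c' p)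
      (at (app_chart c p))" .
  then have "(transition c c'' has_derivative dtrans c' c'' p \<circ> dtrans c c' p) (at (app_chart c p))"
    by (rule has_derivative_transform_within_open[OF _ open_overlap[OF c(1,3)]])
       (use c in \<open>auto simp: transition_def\<close>)
  then show ?thesis
    using transition_has_derivative[OF assms(1,3)] has_derivative_unique by (metis comp_apply)
qed

lemma coord_tvec_apply:
  "c' \<in> charts_at A p \<Longrightarrow> coord_tvec A c p e c' = dtrans c c' p e"
  by (simp add: coord_tvec_def dtrans_def)

lemma coord_tvec_self: "c \<in> charts_at A p \<Longrightarrow> coord_tvec A c p e c = e"
  by (simp add: coord_tvec_apply dtrans_self)

lemma coord_tvec_mem: "c \<in> charts_at A p \<Longrightarrow> coord_tvec A c p e \<in> tangent_space A p"
  unfolding tangent_space_def dtrans_def[symmetric]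
  by (simp only: mem_Collect_eq coord_tvec_apply dtrans_chain cong: ball_cong)
     (simp add: coord_tvec_def)

text \<open>A tangent vector is determined by its representation in a single chart. This identifies the tangent
  space at \<open>p\<close> with the model space, and all that follows is computed in one chart at a time.\<close>

lemma tangent_eq_coord:
  assumes "v \<in> tangent_space A p" "c \<in> charts_at A p"
  shows "v = coord_tvec A c p (v c)"
proof
  fix c'
  have "v c' = frechet_derivative (transition c c') (at (app_chart c p)) (v c)" if "c' \<in> charts_at A p"
    using assms that unfolding tangent_space_def by blast
  moreover have "v c' = 0" if "c' \<notin> charts_at A p"
    using assms that unfolding tangent_space_def by blast
  ultimately show "v c' = coord_tvec A c p (v c) c'"
    unfolding coord_tvec_def by (cases "c' \<in> charts_at A p") simp_all
qed

definition cinner :: "('a, 'e) chart \<Rightarrow> 'a \<Rightarrow> 'e \<Rightarrow> 'e \<Rightarrow> real" where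
  "cinner c p e e' = g p (coord_tvec A c p e) (coord_tvec A c p e')"

abbreviation cnorm :: "('a, 'e) chart \<Rightarrow> 'a \<Rightarrow> 'e \<Rightarrow> real" where
  "cnorm c p \<equiv> form_norm (cinner c p)"

lemma tnorm_coord: "tnorm g p (coord_tvec A c p e) = cnorm c p e"
  by (simp add: tnorm_def cinner_def form_norm_def)

lemma coord_tvec_linear:
  assumes "c \<in> charts_at A p"
  shows "coord_tvec A c p (r *\<^sub>R e + e') = (\<lambda>c'. r *\<^sub>R coord_tvec A c p e c' + coord_tvec A c p e' c')"
proof
  fix c'
  show "coord_tvec A c p (r *\<^sub>R e + e') c' = r *\<^sub>R coord_tvec A c p e c' + coord_tvec A c p e' c'"
    using linear_dtrans[OF assms, of c']
    by (cases "c' \<in> charts_at A p")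
       (simp_all add: coord_tvec_apply linear_add linear_scale, simp add: coord_tvec_def)
qed

lemma inner_form_cinner:
  assumes c: "c \<in> charts_at A p"
  shows "inner_form (cinner c p)"
proof (rule inner_form.intro)
  have ip: "inner_product_on_tangent_space A p (g p)"
    using metric by (simp add: riemannian_metric_def)
  have sym: "cinner c p x y = cinner c p y x" for x y
    using ip coord_tvec_mem[OF c] by (simp add: inner_product_on_tangent_space_def cinner_def)
  then show "cinner c p x y = cinner c p y x" for x y .
  have lin: "cinner c p (r *\<^sub>R x + y) z = r * cinner c p x z + cinner c p y z" for r x y z
    using ip coord_tvec_mem[OF c]
    by (simp add: inner_product_on_tangent_space_def cinner_def coord_tvec_linear[OF c])
  have 0: "cinner c p 0 z = 0" for z using lin[of 1 0 0 z] by simp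
  have "linear (\<lambda>x. cinner c p x z)" for z
  proof (rule linearI)
    show "cinner c p (x + y) z = cinner c p x z + cinner c p y z" for x y
      using lin[of 1 x y z] by simp
    show "cinner c p (r *\<^sub>R x) z = r *\<^sub>R cinner c p x z" for r x
      using lin[of r x 0 z] by (simp add: 0)
  qed
  moreover have "cinner c p z = (\<lambda>x. cinner c p x z)" for z by (rule ext) (rule sym)
  ultimately show "bounded_bilinear (cinner c p)"
    unfolding bilinear_conv_bounded_bilinear[symmetric] bilinear_def by metis
  show "cinner c p x x > 0" if "x \<noteq> 0" for x
  proof -
    have "coord_tvec A c p x \<noteq> (\<lambda>_. 0)" using that coord_tvec_self[OF c] by metis
    then show ?thesis
      using ip coord_tvec_mem[OF c] by (simp add: inner_product_on_tangent_space_def cinner_def)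
  qed
qed

lemma linear_cinner:
  assumes "c \<in> charts_at A p"
  shows "linear (cinner c p x)" "linear (\<lambda>x. cinner c p x y)"
  using inner_form.bil[OF inner_form_cinner[OF assms]]
  by (simp_all add: bilinear_def flip: bilinear_conv_bounded_bilinear)

lemma continuous_cinner:
  assumes "c \<in> A"
  shows "continuous_on (dom_chart c) (\<lambda>p. cinner c p e e')"
proof -
  have "C_inf_on (\<lambda>x. cinner c (inv_chart c x) e e') (app_chart c ` dom_chart c)"
    using metric assms by (simp add: riemannian_metric_def cinner_def)
  then have "continuous_on (app_chart c ` dom_chart c) (\<lambda>x. cinner c (inv_chart c x) e e')"
    unfolding C_inf_on_def using C_k_on.simps(1) by blast
  then have "continuous_on (dom_chart c) (\<lambda>p. cinner c (inv_chart c (app_chart c p)) e e')"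
    by (rule continuous_on_compose2[OF _ continuous_app[OF assms]]) auto
  then show ?thesis using assms by (simp cong: continuous_on_cong)
qed

lemma continuous_on_cnorm:
  assumes c: "c \<in> A" and h: "continuous_on S h" "h ` S \<subseteq> dom_chart c" and k: "continuous_on S k"
  shows "continuous_on S (\<lambda>x. cnorm c (h x) (k x))"
proof -
  have at: "c \<in> charts_at A (h x)" if "x \<in> S" for x using that h c by (auto simp: charts_at_def)
  have 0: "continuous_on S (\<lambda>x. cinner c (h x) e e')" for e e'
    by (rule continuous_on_compose2[OF continuous_cinner[OF c] h])
  have 1: "continuous_on S (\<lambda>x. cinner c (h x) e (k x))" for e
    by (rule continuous_on_linear_family[where l = "\<lambda>x. cinner c (h x) e"])
       (use 0 k at linear_cinner in auto)
  have "continuous_on S (\<lambda>x. cinner c (h x) (k x) (k x))"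
    by (rule continuous_on_linear_family[where l = "\<lambda>x e. cinner c (h x) e (k x)"])
       (use 1 k at linear_cinner in auto)
  then show ?thesis unfolding form_norm_def by (intro continuous_intros)
qed

text \<open>The entries of the Gram matrix are continuous, so the quadratic forms at \<open>q\<close> and \<open>p\<close> differ by at most a
  small multiple of the squared Euclidean norm, which is a small multiple of the form at \<open>p\<close>. This
  reduces all local estimates to a constant norm on the model space.\<close>

lemma cnorm_nearby:
  assumes c: "c \<in> charts_at A p" and \<eta>: "\<eta> > 0"
  shows "\<forall>\<^sub>F q in nhds p. q \<in> dom_chart c \<and>
    (\<forall>e. cnorm c q e \<le> (1 + \<eta>) * cnorm c p e \<and> cnorm c p e \<le> (1 + \<eta>) * cnorm c q e)"
proof -
  interpret P: inner_form "cinner c p" by (rule inner_form_cinner[OF c])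
  obtain m where m: "m > 0" "\<And>x. m * norm x \<le> cnorm c p x" using P.norm_le_fnorm by blast
  \<comment> \<open>A relative error \<open>d\<close> of the quadratic forms costs a factor \<open>1 / (1 - d) = 1 + \<eta>\<close> in one direction.\<close>
  define d where "d = \<eta> / (1 + \<eta>)"
  have d: "0 < d" "d \<le> \<eta>" "d < 1" "(1 - d) * (1 + \<eta>) = 1"
    using \<eta> by (auto simp: d_def field_simps)
  define S where "S q = (\<Sum>b\<in>Basis. \<Sum>b'\<in>Basis. \<bar>cinner c q b b' - cinner c p b b'\<bar>)" for q
  have "continuous_on (dom_chart c) S"
    unfolding S_def using charts_atD[OF c] by (intro continuous_intros continuous_cinner)
  then have "isCont S p"
    using charts_atD[OF c] open_dom by (simp add: continuous_on_eq_continuous_at)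
  then have "(S \<longlongrightarrow> S p) (nhds p)" by (simp add: isCont_def tendsto_at_iff_tendsto_nhds)
  moreover have "S p < d * m\<^sup>2" using d m by (simp add: S_def)
  ultimately have "\<forall>\<^sub>F q in nhds p. S q < d * m\<^sup>2" by (rule order_tendstoD(2))
  moreover have "\<forall>\<^sub>F q in nhds p. q \<in> dom_chart c"
    using charts_atD[OF c] open_dom eventually_nhds_in_open by blast
  ultimately show ?thesis
  proof eventually_elim
    case (elim q)
    have cq: "c \<in> charts_at A q" using elim charts_atD[OF c] by (simp add: charts_at_def)
    interpret Q: inner_form "cinner c q" by (rule inner_form_cinner[OF cq])
    have expand: "cinner c r e e = (\<Sum>b\<in>Basis. \<Sum>b'\<in>Basis. (e \<bullet> b) * (e \<bullet> b') * cinner c r b b')"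
      if "c \<in> charts_at A r" for r e
    proof -
      interpret R: inner_form "cinner c r" by (rule inner_form_cinner[OF that])
      interpret RB: bounded_bilinear "cinner c r" by (rule R.bil)
      have "cinner c r e e = cinner c r (\<Sum>b\<in>Basis. (e \<bullet> b) *\<^sub>R b) (\<Sum>b\<in>Basis. (e \<bullet> b) *\<^sub>R b)"
        by (simp add: euclidean_representation)
      also have "\<dots> = (\<Sum>b\<in>Basis. \<Sum>b'\<in>Basis. (e \<bullet> b) * (e \<bullet> b') * cinner c r b b')"
        by (subst sum.swap) (simp add: RB.sum_left RB.sum_right RB.scaleR_left RB.scaleR_right
            sum_distrib_left ac_simps)
      finally show ?thesis .
    qed
    have diff: "\<bar>cinner c q e e - cinner c p e e\<bar> \<le> d * cinner c p e e" for e
    proof -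
      have "\<bar>cinner c q e e - cinner c p e e\<bar>
          = \<bar>\<Sum>b\<in>Basis. \<Sum>b'\<in>Basis. (e \<bullet> b) * (e \<bullet> b') * (cinner c q b b' - cinner c p b b')\<bar>"
        by (simp add: expand[OF c] expand[OF cq] sum_subtractf algebra_simps)
      also have "\<dots> \<le> (\<Sum>b\<in>Basis. \<Sum>b'\<in>Basis. \<bar>(e \<bullet> b) * (e \<bullet> b') * (cinner c q b b' - cinner c p b b')\<bar>)"
        by (rule order.trans[OF sum_abs], rule sum_mono, rule sum_abs)
      also have "\<dots> \<le> (\<Sum>b\<in>Basis. \<Sum>b'\<in>Basis. norm e * norm e * \<bar>cinner c q b b' - cinner c p b b'\<bar>)"
        by (intro sum_mono) (simp add: abs_mult mult_mono Basis_le_norm)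
      also have "\<dots> = norm e * norm e * S q" by (simp add: S_def sum_distrib_left)
      also have "\<dots> \<le> norm e * norm e * (d * m\<^sup>2)" using elim by (intro mult_left_mono) auto
      also have "\<dots> = d * (m * norm e)\<^sup>2" by (simp add: power2_eq_square)
      also have "\<dots> \<le> d * (cnorm c p e)\<^sup>2" using m d by (intro mult_left_mono power_mono) auto
      also have "\<dots> = d * cinner c p e e" by (simp add: P.fnorm_sq)
      finally show ?thesis .
    qed
    have "cnorm c q e \<le> (1 + \<eta>) * cnorm c p e" for e
    proof (rule power2_le_imp_le)
      have "cinner c q e e \<le> (1 + d) * cinner c p e e" using diff[of e] by (simp add: algebra_simps)
      also have "\<dots> \<le> (1 + \<eta>)\<^sup>2 * cinner c p e e"
      proof (rule mult_right_mono)
        have "1 + d \<le> 1 + \<eta>" using d by simp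
        also have "\<dots> \<le> (1 + \<eta>)\<^sup>2" using \<eta> by (simp add: power2_eq_square)
        finally show "1 + d \<le> (1 + \<eta>)\<^sup>2" .
      qed (rule P.nonneg)
      finally show "(cnorm c q e)\<^sup>2 \<le> ((1 + \<eta>) * cnorm c p e)\<^sup>2"
        by (simp add: power_mult_distrib P.fnorm_sq Q.fnorm_sq)
    qed (use \<eta> in simp)
    moreover have "cnorm c p e \<le> (1 + \<eta>) * cnorm c q e" for e
    proof (rule power2_le_imp_le)
      have "(1 - d) * cinner c p e e \<le> cinner c q e e" using diff[of e] by (simp add: algebra_simps)
      then have "(1 + \<eta>) * ((1 - d) * cinner c p e e) \<le> (1 + \<eta>) * cinner c q e e"
        using \<eta> by (intro mult_left_mono) auto
      then have "cinner c p e e \<le> (1 + \<eta>) * cinner c q e e"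
        using d(4) by (metis mult.assoc mult.commute mult_1)
      also have "\<dots> \<le> (1 + \<eta>)\<^sup>2 * cinner c q e e"
        using \<eta> by (intro mult_right_mono Q.nonneg) (simp add: power2_eq_square)
      finally show "(cnorm c p e)\<^sup>2 \<le> ((1 + \<eta>) * cnorm c q e)\<^sup>2"
        by (simp add: power_mult_distrib P.fnorm_sq Q.fnorm_sq)
    qed (use \<eta> in simp)
    ultimately show ?case using elim by blast
  qed
qed

section \<open>Differentials and gradients in a chart\<close>

lemma differential_chart:
  assumes c: "c \<in> charts_at A p" and v: "v \<in> tangent_space A p"
    and l: "((\<phi> \<circ> inv_chart c) has_derivative l) (at (app_chart c p))"
  shows "differential A \<phi> p v = l (v c)"
proof -
  define c0 where "c0 = (SOME c. c \<in> charts_at A p)"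
  have c0: "c0 \<in> charts_at A p" unfolding c0_def using chart_at_exists by (rule someI_ex)
  have cA: "c \<in> A" "p \<in> dom_chart c" "c0 \<in> A" "p \<in> dom_chart c0"
    using c c0 by (auto dest: charts_atD)
  have "((\<phi> \<circ> inv_chart c) \<circ> transition c0 c has_derivative l \<circ> dtrans c0 c p) (at (app_chart c0 p))"
    using transition_has_derivative[OF c0 c] l c0 by (intro diff_chain_at) simp_all
  then have "(\<phi> \<circ> inv_chart c0 has_derivative l \<circ> dtrans c0 c p) (at (app_chart c0 p))"
    by (rule has_derivative_transform_within_open[OF _ open_overlap[OF cA(3,1)]])
       (use cA in \<open>auto simp: transition_def\<close>)
  then have "frechet_derivative (\<phi> \<circ> inv_chart c0) (at (app_chart c0 p)) = l \<circ> dtrans c0 c p"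
    using frechet_derivative_at by metis
  moreover have "dtrans c0 c p (v c0) = v c"
    using tangent_eq_coord[OF v c0] coord_tvec_apply[OF c] by metis
  ultimately show ?thesis by (simp add: differential_def flip: c0_def)
qed

text \<open>By Riesz representation and the Cauchy-Schwarz inequality, the norm of the gradient is the dual norm of
  the differential. Bounds on the gradient are only ever used in this form.\<close>

lemma tnorm_gradient_le_iff:
  assumes c: "c \<in> charts_at A p"
    and l: "((\<phi> \<circ> inv_chart c) has_derivative l) (at (app_chart c p))" and k: "k \<ge> 0"
  shows "tnorm g p (gradient A g \<phi> p) \<le> k \<longleftrightarrow> (\<forall>e. \<bar>l e\<bar> \<le> k * cnorm c p e)"
proof -
  interpret F: inner_form "cinner c p" by (rule inner_form_cinner[OF c])
  interpret FB: bounded_bilinear "cinner c p" by (rule F.bil)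
  obtain w where w: "\<And>v. cinner c p w v = l v"
    using F.riesz[OF has_derivative_linear[OF l]] by blast
  have "gradient A g \<phi> p = coord_tvec A c p w"
    unfolding gradient_def
  proof (rule the_equality, intro conjI ballI)
    show "coord_tvec A c p w \<in> tangent_space A p" by (rule coord_tvec_mem[OF c])
    fix v assume v: "v \<in> tangent_space A p"
    have "g p (coord_tvec A c p w) v = cinner c p w (v c)"
      unfolding cinner_def using tangent_eq_coord[OF v c] by simp
    then show "g p (coord_tvec A c p w) v = differential A \<phi> p v"
      by (simp add: w differential_chart[OF c v l])
  next
    fix u assume u: "u \<in> tangent_space A p \<and> (\<forall>v\<in>tangent_space A p. g p u v = differential A \<phi> p v)"
    have "cinner c p (u c) e = cinner c p w e" for e
    proof -
      have "cinner c p (u c) e = g p u (coord_tvec A c p e)"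
        unfolding cinner_def using tangent_eq_coord[of u p c] u c by simp
      also have "\<dots> = l e"
        using u coord_tvec_mem[OF c] by (simp add: differential_chart[OF c _ l] coord_tvec_self[OF c])
      finally show ?thesis by (simp add: w)
    qed
    then have "cinner c p (u c - w) (u c - w) = 0" by (simp add: FB.diff_left)
    then have "u c = w" using F.pos[of "u c - w"] by force
    then show "u = coord_tvec A c p w" using tangent_eq_coord[of u p c] u c by simp
  qed
  then have norm: "tnorm g p (gradient A g \<phi> p) = cnorm c p w" by (simp add: tnorm_coord)
  show ?thesis
  proof
    assume le: "tnorm g p (gradient A g \<phi> p) \<le> k"
    show "\<forall>e. \<bar>l e\<bar> \<le> k * cnorm c p e"
    proof
      fix e
      have "\<bar>l e\<bar> \<le> cnorm c p w * cnorm c p e" using F.cauchy_schwarz[of w e] by (simp add: w)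
      also have "\<dots> \<le> k * cnorm c p e" using le norm by (intro mult_right_mono) auto
      finally show "\<bar>l e\<bar> \<le> k * cnorm c p e" .
    qed
  next
    assume "\<forall>e. \<bar>l e\<bar> \<le> k * cnorm c p e"
    then have "l w \<le> k * cnorm c p w" using abs_ge_self order_trans by blast
    moreover have "l w = cnorm c p w * cnorm c p w"
      using F.fnorm_sq[of w] by (simp add: w power2_eq_square)
    ultimately have "cnorm c p w \<le> k"
      by (cases "w = 0") (use k F.fnorm_pos[of w] in auto)
    then show "tnorm g p (gradient A g \<phi> p) \<le> k" by (simp add: norm)
  qed
qed

lemma C1_fun_on_has_derivative:
  assumes "C1_fun_on A U \<phi>" "open U" "p \<in> U" "c \<in> charts_at A p"
  obtains l where "((\<phi> \<circ> inv_chart c) has_derivative l) (at (app_chart c p))"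
proof -
  have c: "c \<in> A" "p \<in> dom_chart c" using assms by (auto dest: charts_atD)
  have "C_k_on 1 (\<phi> \<circ> inv_chart c) (app_chart c ` (U \<inter> dom_chart c))"
    using assms c unfolding C1_fun_on_def by blast
  moreover have "open (app_chart c ` (U \<inter> dom_chart c))"
    using assms c by (intro open_app_image open_Int open_dom) auto
  ultimately show ?thesis
    using C1_on_has_derivative assms(3) c that by (metis IntI imageI)
qed

text \<open>On a subset of the domain of \<open>c\<close> it suffices to look at the single chart \<open>c\<close>, because the transition
  maps are \<open>C\<^sup>1\<close>.\<close>

lemma C1_fun_on_chart:
  assumes c: "c \<in> A" and U: "open U" "U \<subseteq> dom_chart c"
    and der: "\<And>y. y \<in> V \<Longrightarrow> (\<psi> has_derivative \<psi>' y) (at y)"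
    and cont: "\<And>v. continuous_on V (\<lambda>y. \<psi>' y v)"
    and V: "app_chart c ` U \<subseteq> V"
  shows "C1_fun_on A U (\<psi> \<circ> app_chart c)"
  unfolding C1_fun_on_def
proof
  fix c' assume c': "c' \<in> A"
  define W where "W = app_chart c' ` (U \<inter> dom_chart c')"
  define T where "T = transition c' c"
  define T' where "T' y = frechet_derivative T (at y)" for y
  have W: "open W" unfolding W_def using c' U by (intro open_app_image open_Int open_dom) auto
  have WW: "W \<subseteq> app_chart c' ` (dom_chart c' \<inter> dom_chart c)" using U by (auto simp: W_def)
  have T1: "C_k_on 1 T (app_chart c' ` (dom_chart c' \<inter> dom_chart c))"
    unfolding T_def by (rule transition_C1[OF c' c])
  have T': "(T has_derivative T' y) (at y)" if "y \<in> W" for y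
    unfolding T'_def
    by (rule C1_on_has_derivative[OF T1 open_overlap[OF c' c]]) (use that WW in auto)
  have TV: "T y \<in> V" if yW: "y \<in> W" for y
  proof -
    obtain q where q: "q \<in> U" "q \<in> dom_chart c'" "y = app_chart c' q" using yW unfolding W_def by blast
    then have "T y = app_chart c q" using c' by (simp add: T_def transition_def)
    then show ?thesis using q V by auto
  qed
  have contT': "continuous_on W (\<lambda>y. T' y v)" for v
  proof -
    have "continuous_on (app_chart c' ` (dom_chart c' \<inter> dom_chart c)) (\<lambda>y. T' y v)"
      using T1 by (simp add: T'_def)
    then show ?thesis by (rule continuous_on_subset[OF _ WW])
  qed
  have contT: "continuous_on W T"
    by (intro continuous_at_imp_continuous_on ballI) (use has_derivative_continuous[OF T'] in blast)
  have "C_k_on 1 (\<psi> \<circ> T) W"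
  proof (rule C1_onI[where f' = "\<lambda>y. \<psi>' (T y) \<circ> T' y"])
    fix y assume "y \<in> W"
    then show "(\<psi> \<circ> T has_derivative \<psi>' (T y) \<circ> T' y) (at y)"
      by (intro diff_chain_at T' der TV)
  next
    fix v
    show "continuous_on W (\<lambda>y. (\<psi>' (T y) \<circ> T' y) v)"
      unfolding o_apply
    proof (rule continuous_on_linear_family[where l = "\<lambda>y. \<psi>' (T y)"])
      show "linear (\<psi>' (T y))" if "y \<in> W" for y
        using der[OF TV[OF that]] has_derivative_linear by blast
      show "continuous_on W (\<lambda>x. \<psi>' (T x) u)" for u
        by (rule continuous_on_compose2[OF cont contT]) (use TV in auto)
    qed (rule contT')
  qed
  then show "C_k_on 1 ((\<psi> \<circ> app_chart c) \<circ> inv_chart c') (app_chart c' ` (U \<inter> dom_chart c'))"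
    by (simp only: T_def transition_def W_def comp_assoc)
qed

section \<open>Small coordinate balls\<close>

definition nball :: "('a, 'e) chart \<Rightarrow> 'a \<Rightarrow> real \<Rightarrow> 'a set" where
  "nball c p \<rho> = {q \<in> dom_chart c. cnorm c p (app_chart c q - app_chart c p) < \<rho>}"

definition ncball :: "('a, 'e) chart \<Rightarrow> 'a \<Rightarrow> real \<Rightarrow> 'a set" where
  "ncball c p \<rho> = {q \<in> dom_chart c. cnorm c p (app_chart c q - app_chart c p) \<le> \<rho>}"

lemma continuous_radius:
  assumes "c \<in> charts_at A p"
  shows "continuous_on (dom_chart c) (\<lambda>q. cnorm c p (app_chart c q - app_chart c p))"
  using charts_atD[OF assms]
  by (intro inner_form.continuous_on_fnorm[OF inner_form_cinner[OF assms]] continuous_intros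
      continuous_app)

lemma open_nball:
  assumes "c \<in> charts_at A p"
  shows "open (nball c p \<rho>)"
proof -
  have "open ((\<lambda>q. cnorm c p (app_chart c q - app_chart c p)) -` {..<\<rho>} \<inter> dom_chart c)"
    using continuous_radius[OF assms] open_dom[OF charts_atD(1)[OF assms]]
    by (auto simp: continuous_on_open_vimage)
  then show ?thesis by (auto simp: nball_def vimage_def Int_def conj_commute)
qed

lemma center_nball:
  assumes "c \<in> charts_at A p" "\<rho> > 0"
  shows "p \<in> nball c p \<rho>"
  using assms inner_form.fnorm_zero[OF inner_form_cinner[OF assms(1)]]
  by (auto simp: nball_def dest: charts_atD)

lemma nball_eventually:
  assumes "c \<in> charts_at A p" "\<rho> > 0" "\<And>q. q \<in> nball c p \<rho> \<Longrightarrow> P q"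
  shows "\<forall>\<^sub>F q in nhds p. P q"
  unfolding eventually_nhds
  using open_nball[OF assms(1)] center_nball[OF assms(1,2)] assms(3) by blast

lemma nball_ncball: "nball c p \<rho> \<subseteq> ncball c p \<rho>"
  by (auto simp: nball_def ncball_def)

text \<open>All norms on the model space are equivalent, so the ball in the image of the chart is compact when it
  is small, and so is its preimage, a homeomorphic copy.\<close>

lemma small_ncball:
  assumes c: "c \<in> charts_at A p" and U: "open U" "p \<in> U"
  obtains \<rho>0 where "\<rho>0 > 0" "\<And>\<rho>. 0 < \<rho> \<Longrightarrow> \<rho> \<le> \<rho>0 \<Longrightarrow> compact (ncball c p \<rho>) \<and> ncball c p \<rho> \<subseteq> U"
    "{y. cnorm c p (y - app_chart c p) \<le> \<rho>0} \<subseteq> app_chart c ` (U \<inter> dom_chart c)"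
proof -
  interpret F: inner_form "cinner c p" by (rule inner_form_cinner[OF c])
  have cA: "c \<in> A" "p \<in> dom_chart c" using c by (auto dest: charts_atD)
  let ?x = "app_chart c p"
  have "open (app_chart c ` (U \<inter> dom_chart c))" using cA U by (intro open_app_image open_Int open_dom) auto
  then obtain r where r: "r > 0" "cball ?x r \<subseteq> app_chart c ` (U \<inter> dom_chart c)"
    using open_contains_cball[of "app_chart c ` (U \<inter> dom_chart c)"] cA U by blast
  obtain m where m: "m > 0" "\<And>x. m * norm x \<le> cnorm c p x" using F.norm_le_fnorm by blast
  have sub: "{y. cnorm c p (y - ?x) \<le> \<rho>} \<subseteq> cball ?x r" if "\<rho> \<le> m * r" for \<rho>
  proof
    fix y assume "y \<in> {y. cnorm c p (y - ?x) \<le> \<rho>}"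
    then have "m * norm (y - ?x) \<le> m * r" using m(2)[of "y - ?x"] that by simp
    then show "y \<in> cball ?x r" using m by (simp add: dist_norm norm_minus_commute)
  qed
  have "compact (ncball c p \<rho>) \<and> ncball c p \<rho> \<subseteq> U" if "0 < \<rho>" "\<rho> \<le> m * r" for \<rho>
  proof -
    let ?B = "{y. cnorm c p (y - ?x) \<le> \<rho>}"
    have B: "?B \<subseteq> app_chart c ` (U \<inter> dom_chart c)" using sub[OF that(2)] r by blast
    have "closed ?B"
      by (intro closed_Collect_le F.continuous_on_fnorm continuous_intros)
    then have "compact ?B"
      using sub[OF that(2)] bounded_cball bounded_subset compact_eq_bounded_closed by blast
    moreover have eq: "ncball c p \<rho> = inv_chart c ` ?B"
    proof
      show "ncball c p \<rho> \<subseteq> inv_chart c ` ?B"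
      proof
        fix q assume q: "q \<in> ncball c p \<rho>"
        then have "q = inv_chart c (app_chart c q)" using cA by (simp add: ncball_def)
        then show "q \<in> inv_chart c ` ?B" using q by (auto simp: ncball_def)
      qed
      show "inv_chart c ` ?B \<subseteq> ncball c p \<rho>" using B cA by (auto simp: ncball_def)
    qed
    moreover have "continuous_on ?B (inv_chart c)"
      using B by (intro continuous_on_subset[OF continuous_inv[OF cA(1)]]) auto
    ultimately have "compact (ncball c p \<rho>)" by (simp add: compact_continuous_image)
    moreover have "ncball c p \<rho> \<subseteq> U" unfolding eq using B cA by auto
    ultimately show ?thesis by blast
  qed
  moreover have "m * r > 0" using m r by simp
  ultimately show ?thesis using sub[of "m * r"] r by (intro that[of "m * r"]) auto
qed

section \<open>Test functions depending on the distance in a chart\<close>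

text \<open>The squared distance \<open>Q\<close> from the centre in the norm at \<open>p\<close> is a quadratic polynomial in the chart. Hence
  \<open>\<theta> \<circ> Q\<close> is \<open>C\<^sup>1\<close> wherever \<open>\<theta>\<close> is, and its differential is explicit. The set \<open>T\<close> allows \<open>\<theta>\<close> to be singular
  at 0, that is, at the centre.\<close>

lemma radial_test_function:
  assumes c: "c \<in> charts_at A p" and T: "open T"
    and der: "\<forall>r\<in>T. (\<theta> has_real_derivative \<theta>' r) (at r)"
    and cont: "continuous_on T \<theta>'"
  defines "Q \<equiv> \<lambda>q. cinner c p (app_chart c q - app_chart c p) (app_chart c q - app_chart c p)"
  defines "U \<equiv> {q \<in> dom_chart c. Q q \<in> T}"
  shows "open U"
    and "C1_fun_on A U (\<lambda>q. \<theta> (Q q))"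
    and "\<And>q k. q \<in> U \<Longrightarrow> k \<ge> 0 \<Longrightarrow> tnorm g q (gradient A g (\<lambda>q. \<theta> (Q q)) q) \<le> k \<longleftrightarrow>
      (\<forall>e. \<bar>\<theta>' (Q q) * (2 * cinner c p (app_chart c q - app_chart c p) e)\<bar> \<le> k * cnorm c q e)"
proof -
  interpret F: inner_form "cinner c p" by (rule inner_form_cinner[OF c])
  have cA: "c \<in> A" using c by (auto dest: charts_atD)
  let ?x = "app_chart c p"
  define R where "R y = cinner c p (y - ?x) (y - ?x)" for y
  define V where "V = {y. R y \<in> T}"
  define \<psi>' where "\<psi>' y e = \<theta>' (R y) * (2 * cinner c p (y - ?x) e)" for y e
  have contR: "continuous_on S R" for S unfolding R_def by (intro F.continuous_on_form continuous_intros)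
  have "continuous_on (dom_chart c) Q"
    unfolding Q_def by (intro F.continuous_on_form continuous_intros continuous_app cA)
  then have "open (Q -` T \<inter> dom_chart c)"
    using T open_dom[OF cA] by (auto simp: continuous_on_open_vimage)
  then show oU: "open U" by (auto simp: U_def vimage_def Int_def conj_commute)
  have d: "((\<lambda>y. \<theta> (R y)) has_derivative \<psi>' y) (at y)" if "y \<in> V" for y
  proof -
    have "(R has_derivative (\<lambda>e. 2 * cinner c p (y - ?x) e)) (at y)"
      unfolding R_def by (rule F.has_derivative_quadratic)
    moreover have "(\<theta> has_derivative (*) (\<theta>' (R y))) (at (R y))"
      using der that by (simp add: V_def has_field_derivative_def)
    ultimately have "(\<theta> \<circ> R has_derivative (*) (\<theta>' (R y)) \<circ> (\<lambda>e. 2 * cinner c p (y - ?x) e)) (at y)"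
      by (rule diff_chain_at)
    then show ?thesis by (simp add: comp_def \<psi>'_def[abs_def])
  qed
  have cont\<psi>: "continuous_on V (\<lambda>y. \<psi>' y v)" for v
    unfolding \<psi>'_def
    by (intro continuous_intros F.continuous_on_form continuous_on_compose2[OF cont contR])
       (auto simp: V_def)
  have UV: "app_chart c ` U \<subseteq> V" by (auto simp: U_def V_def Q_def R_def)
  have eq: "(\<lambda>q. \<theta> (Q q)) = (\<lambda>y. \<theta> (R y)) \<circ> app_chart c" by (auto simp: Q_def R_def)
  show "C1_fun_on A U (\<lambda>q. \<theta> (Q q))"
    unfolding eq by (rule C1_fun_on_chart[OF cA oU _ d cont\<psi> UV]) (auto simp: U_def)
  fix q and k :: real assume q: "q \<in> U" and k: "k \<ge> 0"
  have cq: "c \<in> charts_at A q" using q cA by (auto simp: U_def charts_at_def)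
  have V: "app_chart c q \<in> V" using q UV by auto
  have oUV: "open (app_chart c ` U)" using cA oU by (intro open_app_image) (auto simp: U_def)
  have "((\<lambda>q. \<theta> (Q q)) \<circ> inv_chart c has_derivative \<psi>' (app_chart c q)) (at (app_chart c q))"
    by (rule has_derivative_transform_within_open[OF d[OF V] oUV])
       (use q cA in \<open>auto simp: eq U_def\<close>)
  from tnorm_gradient_le_iff[OF cq this k]
  show "tnorm g q (gradient A g (\<lambda>q. \<theta> (Q q)) q) \<le> k \<longleftrightarrow>
      (\<forall>e. \<bar>\<theta>' (Q q) * (2 * cinner c p (app_chart c q - app_chart c p) e)\<bar> \<le> k * cnorm c q e)"
    by (simp only: \<psi>'_def Q_def R_def)
qed

section \<open>Speed and length of C1 curves\<close>

text \<open>The derivatives are taken within the interval, as in the definition of a \<open>C\<^sup>1\<close> curve: unlike the norm of the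
  velocity, the speed is then continuous up to the end points.\<close>

definition speed :: "real \<Rightarrow> real \<Rightarrow> (real \<Rightarrow> 'a) \<Rightarrow> real \<Rightarrow> real" where
  "speed a b \<gamma> t = tnorm g (\<gamma> t) (\<lambda>c. if c \<in> charts_at A (\<gamma> t)
     then vector_derivative (app_chart c \<circ> \<gamma>) (at t within {a..b}) else 0)"

abbreviation arc_length :: "real \<Rightarrow> real \<Rightarrow> (real \<Rightarrow> 'a) \<Rightarrow> real" where
  "arc_length a b \<gamma> \<equiv> integral {a..b} (speed a b \<gamma>)"

lemma C1_curve_continuous: "C1_curve_on A a b \<gamma> \<Longrightarrow> continuous_on {a..b} \<gamma>"
  by (simp add: C1_curve_on_def)

lemma C1_curve_chart:
  assumes \<gamma>: "C1_curve_on A a b \<gamma>" and ab: "a < b" and c: "c \<in> A"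
  defines "V \<equiv> \<lambda>t. vector_derivative (app_chart c \<circ> \<gamma>) (at t within {a..b})"
  shows "continuous_on {t\<in>{a..b}. \<gamma> t \<in> dom_chart c} V"
    and "\<And>t. t \<in> {a..b} \<Longrightarrow> \<gamma> t \<in> dom_chart c \<Longrightarrow>
      ((app_chart c \<circ> \<gamma>) has_vector_derivative V t) (at t within {a..b})"
proof -
  obtain D where D: "continuous_on {t\<in>{a..b}. \<gamma> t \<in> dom_chart c} D"
    "\<And>t. t \<in> {a..b} \<Longrightarrow> \<gamma> t \<in> dom_chart c \<Longrightarrow>
      ((app_chart c \<circ> \<gamma>) has_vector_derivative D t) (at t within {a..b})"
    using \<gamma> c unfolding C1_curve_on_def by blast
  have V: "V t = D t" if "t \<in> {a..b}" "\<gamma> t \<in> dom_chart c" for t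
    unfolding V_def by (rule vector_derivative_within_closed_interval[OF ab that(1) D(2)[OF that]])
  then show "continuous_on {t\<in>{a..b}. \<gamma> t \<in> dom_chart c} V"
    by (intro continuous_on_eq[OF D(1)]) simp
  show "((app_chart c \<circ> \<gamma>) has_vector_derivative V t) (at t within {a..b})"
    if "t \<in> {a..b}" "\<gamma> t \<in> dom_chart c" for t
    using D(2)[OF that] V[OF that] by simp
qed

lemma openin_curve_in_chart:
  assumes "continuous_on {a..b} \<gamma>" "c \<in> A"
  shows "openin (top_of_set {a..b}) {t\<in>{a..b}. \<gamma> t \<in> dom_chart c}"
proof -
  have "openin (top_of_set {a..b}) ({a..b} \<inter> \<gamma> -` dom_chart c)"
    using assms open_dom by (intro continuous_openin_preimage_gen)
  then show ?thesis by (simp add: Int_def vimage_def)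
qed

text \<open>Differentiating the transition map along the curve shows that the one-sided derivatives in the various
  charts form a tangent vector.\<close>

lemma speed_chart:
  assumes cont: "continuous_on {a..b} \<gamma>" and ab: "a < b" and t: "t \<in> {a..b}"
    and c: "c \<in> charts_at A (\<gamma> t)"
    and w: "((app_chart c \<circ> \<gamma>) has_vector_derivative w) (at t within {a..b})"
  shows "speed a b \<gamma> t = cnorm c (\<gamma> t) w"
proof -
  have cA: "c \<in> A" "\<gamma> t \<in> dom_chart c" using c by (auto dest: charts_atD)
  obtain e where e: "e > 0" "\<And>s. s \<in> {a..b} \<Longrightarrow> dist s t < e \<Longrightarrow> \<gamma> s \<in> dom_chart c"
    using openin_curve_in_chart[OF cont cA(1)] t cA(2)
    unfolding openin_euclidean_subtopology_iff by blast
  have "vector_derivative (app_chart c' \<circ> \<gamma>) (at t within {a..b}) = dtrans c c' (\<gamma> t) w"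
    if c': "c' \<in> charts_at A (\<gamma> t)" for c'
  proof -
    have "(transition c c' has_derivative dtrans c c' (\<gamma> t)) (at ((app_chart c \<circ> \<gamma>) t))"
      using transition_has_derivative[OF c c'] by simp
    then have "(transition c c' \<circ> (app_chart c \<circ> \<gamma>) has_vector_derivative dtrans c c' (\<gamma> t) w)
        (at t within {a..b})"
      by (rule vector_derivative_diff_chain_within
          [OF w has_derivative_at_withinI])
    moreover have "(transition c c' \<circ> (app_chart c \<circ> \<gamma>)) s = (app_chart c' \<circ> \<gamma>) s"
      if "s \<in> {a..b}" "dist s t < e" for s
      using e(2)[OF that] cA by (simp add: transition_def)
    ultimately have "(app_chart c' \<circ> \<gamma> has_vector_derivative dtrans c c' (\<gamma> t) w) (at t within {a..b})"
      using has_vector_derivative_transform_within[OF _ e(1) t] by blast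
    then show ?thesis by (rule vector_derivative_within_closed_interval[OF ab t])
  qed
  then have "(\<lambda>c'. if c' \<in> charts_at A (\<gamma> t)
     then vector_derivative (app_chart c' \<circ> \<gamma>) (at t within {a..b}) else 0) = coord_tvec A c (\<gamma> t) w"
    by (auto simp: coord_tvec_apply fun_eq_iff) (simp add: coord_tvec_def)
  then show ?thesis by (simp add: speed_def tnorm_coord)
qed

lemma continuous_speed:
  assumes \<gamma>: "C1_curve_on A a b \<gamma>" and ab: "a < b"
  shows "continuous_on {a..b} (speed a b \<gamma>)"
  unfolding continuous_on_eq_continuous_within
proof
  fix t assume t: "t \<in> {a..b}"
  obtain c where c: "c \<in> charts_at A (\<gamma> t)" using chart_at_exists by blast
  have cA: "c \<in> A" "\<gamma> t \<in> dom_chart c" using c by (auto dest: charts_atD)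
  note cont = C1_curve_continuous[OF \<gamma>]
  define S where "S = {t\<in>{a..b}. \<gamma> t \<in> dom_chart c}"
  define V where "V t = vector_derivative (app_chart c \<circ> \<gamma>) (at t within {a..b})" for t
  have V: "continuous_on S V" "\<And>t. t \<in> S \<Longrightarrow> ((app_chart c \<circ> \<gamma>) has_vector_derivative V t) (at t within {a..b})"
    using C1_curve_chart[OF \<gamma> ab cA(1)] by (auto simp: S_def V_def)
  have "speed a b \<gamma> s = cnorm c (\<gamma> s) (V s)" if "s \<in> S" for s
    by (rule speed_chart[OF cont ab]) (use that V cA in \<open>auto simp: S_def charts_at_def\<close>)
  moreover have "continuous_on S (\<lambda>s. cnorm c (\<gamma> s) (V s))"
    by (rule continuous_on_cnorm[OF cA(1) continuous_on_subset[OF cont] _ V(1)]) (auto simp: S_def)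
  ultimately have "continuous_on S (speed a b \<gamma>)" by (simp cong: continuous_on_cong)
  moreover have "t \<in> S" using t cA by (simp add: S_def)
  ultimately have "continuous (at t within S) (speed a b \<gamma>)"
    by (simp add: continuous_on_eq_continuous_within)
  moreover obtain T where T: "open T" "S = {a..b} \<inter> T"
    using openin_curve_in_chart[OF cont cA(1)] by (auto simp: S_def openin_open)
  then have "at t within S = at t within {a..b}"
    by (intro at_within_nhd[of t T]) (use \<open>t \<in> S\<close> in auto)
  ultimately show "continuous (at t within {a..b}) (speed a b \<gamma>)" by simp
qed

lemma speed_nonneg:
  assumes \<gamma>: "C1_curve_on A a b \<gamma>" and ab: "a < b" and t: "t \<in> {a..b}"
  shows "speed a b \<gamma> t \<ge> 0"
proof -
  obtain c where c: "c \<in> charts_at A (\<gamma> t)" using chart_at_exists by blast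
  then have cA: "c \<in> A" "\<gamma> t \<in> dom_chart c" by (auto dest: charts_atD)
  show ?thesis
    using speed_chart[OF C1_curve_continuous[OF \<gamma>] ab t c C1_curve_chart(2)[OF \<gamma> ab cA(1) t cA(2)]]
      inner_form.fnorm_nonneg[OF inner_form_cinner[OF c]] by simp
qed

lemma arc_length_nonneg:
  assumes "C1_curve_on A a b \<gamma>" "a < b"
  shows "arc_length a b \<gamma> \<ge> 0"
  by (rule integral_nonneg[OF integrable_continuous_real[OF continuous_speed[OF assms]]])
     (rule speed_nonneg[OF assms])

lemma arc_length_velocity:
  assumes \<gamma>: "C1_curve_on A a b \<gamma>" and ab: "a < b"
  shows "((\<lambda>t. tnorm g (\<gamma> t) (velocity A \<gamma> t)) has_integral arc_length a b \<gamma>) {a..b}"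
proof (rule has_integral_spike_finite[where S = "{a, b}"])
  show "(speed a b \<gamma> has_integral arc_length a b \<gamma>) {a..b}"
    using integrable_continuous_real[OF continuous_speed[OF assms]] by (rule integrable_integral)
  fix t assume "t \<in> {a..b} - {a, b}"
  then have "t \<in> interior {a..b}" by simp
  then have "at t within {a..b} = at t" by (rule at_within_interior)
  then show "tnorm g (\<gamma> t) (velocity A \<gamma> t) = speed a b \<gamma> t"
    by (simp only: speed_def velocity_def)
qed simp

lemma C1_curve_subinterval:
  assumes \<gamma>: "C1_curve_on A a b \<gamma>" and sub: "a \<le> a'" "a' < b'" "b' \<le> b"
  shows "C1_curve_on A a' b' \<gamma>"
    and "\<And>t. t \<in> {a'..b'} \<Longrightarrow> speed a' b' \<gamma> t = speed a b \<gamma> t"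
proof -
  have S: "{a'..b'} \<subseteq> {a..b}" and ab: "a < b" using sub by auto
  show 1: "C1_curve_on A a' b' \<gamma>"
    unfolding C1_curve_on_def
  proof (intro conjI ballI)
    show "continuous_on {a'..b'} \<gamma>" using C1_curve_continuous[OF \<gamma>] S by (rule continuous_on_subset)
    fix c assume c: "c \<in> A"
    define V where "V t = vector_derivative (app_chart c \<circ> \<gamma>) (at t within {a..b})" for t
    note V = C1_curve_chart[OF \<gamma> ab c, folded V_def]
    have "continuous_on {t\<in>{a'..b'}. \<gamma> t \<in> dom_chart c} V"
      by (rule continuous_on_subset[OF V(1)]) (use S in auto)
    moreover have "((app_chart c \<circ> \<gamma>) has_vector_derivative V t) (at t within {a'..b'})"
      if "t \<in> {a'..b'}" "\<gamma> t \<in> dom_chart c" for t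
      using V(2)[of t] that S by (meson has_vector_derivative_within_subset subsetD)
    ultimately show "\<exists>D. continuous_on {t\<in>{a'..b'}. \<gamma> t \<in> dom_chart c} D \<and>
        (\<forall>t\<in>{a'..b'}. \<gamma> t \<in> dom_chart c \<longrightarrow>
           ((app_chart c \<circ> \<gamma>) has_vector_derivative D t) (at t within {a'..b'}))" by blast
  qed
  fix t assume t: "t \<in> {a'..b'}"
  then have t': "t \<in> {a..b}" using S by auto
  obtain c where c: "c \<in> charts_at A (\<gamma> t)" using chart_at_exists by blast
  have cA: "c \<in> A" "\<gamma> t \<in> dom_chart c" using c by (auto dest: charts_atD)
  note V = C1_curve_chart(2)[OF \<gamma> ab cA(1) t' cA(2)]
  show "speed a' b' \<gamma> t = speed a b \<gamma> t"
    unfolding speed_chart[OF C1_curve_continuous[OF \<gamma>] ab t' c V]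
    by (rule speed_chart[OF C1_curve_continuous[OF 1] sub(2) t c
          has_vector_derivative_within_subset[OF V S]])
qed

lemma C1_curve_cong:
  assumes \<gamma>: "C1_curve_on A a b \<gamma>" and ab: "a < b" and eq: "\<And>t. t \<in> {a..b} \<Longrightarrow> \<gamma> t = \<gamma>' t"
  shows "C1_curve_on A a b \<gamma>'" and "arc_length a b \<gamma> = arc_length a b \<gamma>'"
proof -
  have set: "{t\<in>{a..b}. \<gamma> t \<in> dom_chart c} = {t\<in>{a..b}. \<gamma>' t \<in> dom_chart c}" for c
    using eq by auto
  have der: "((app_chart c \<circ> \<gamma>') has_vector_derivative D) (at t within {a..b})"
    if "((app_chart c \<circ> \<gamma>) has_vector_derivative D) (at t within {a..b})" "t \<in> {a..b}" for c D t
    by (rule has_vector_derivative_transform[OF that(2) _ that(1)]) (simp add: eq)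
  show 1: "C1_curve_on A a b \<gamma>'"
    unfolding C1_curve_on_def
  proof (intro conjI ballI)
    show "continuous_on {a..b} \<gamma>'"
      by (rule continuous_on_eq[OF C1_curve_continuous[OF \<gamma>] eq])
    fix c assume c: "c \<in> A"
    then obtain D where D: "continuous_on {t\<in>{a..b}. \<gamma> t \<in> dom_chart c} D"
      "\<forall>t\<in>{a..b}. \<gamma> t \<in> dom_chart c \<longrightarrow>
        ((app_chart c \<circ> \<gamma>) has_vector_derivative D t) (at t within {a..b})"
      using \<gamma> unfolding C1_curve_on_def by blast
    then show "\<exists>D. continuous_on {t\<in>{a..b}. \<gamma>' t \<in> dom_chart c} D \<and>
        (\<forall>t\<in>{a..b}. \<gamma>' t \<in> dom_chart c \<longrightarrow>
           ((app_chart c \<circ> \<gamma>') has_vector_derivative D t) (at t within {a..b}))"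
      using der eq unfolding set by metis
  qed
  have "speed a b \<gamma> t = speed a b \<gamma>' t" if t: "t \<in> {a..b}" for t
  proof -
    obtain c where c: "c \<in> charts_at A (\<gamma> t)" using chart_at_exists by blast
    have cA: "c \<in> A" "\<gamma> t \<in> dom_chart c" using c by (auto dest: charts_atD)
    note V = C1_curve_chart(2)[OF \<gamma> ab cA(1) t cA(2)]
    show ?thesis
      unfolding speed_chart[OF C1_curve_continuous[OF \<gamma>] ab t c V] eq[OF t]
      by (rule speed_chart[OF C1_curve_continuous[OF 1] ab t _ der[OF V t], symmetric])
         (use c eq[OF t] in simp)
  qed
  then show "arc_length a b \<gamma> = arc_length a b \<gamma>'" by (rule integral_cong)
qed

lemma C1_curve_affine:
  assumes \<gamma>: "C1_curve_on A a b \<gamma>" and ab: "a < b" and m: "m \<noteq> 0"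
    and ab': "a' < b'" and img: "(\<lambda>t. m * t + k) ` {a'..b'} = {a..b}"
  shows "C1_curve_on A a' b' (\<lambda>t. \<gamma> (m * t + k))"
    and "arc_length a' b' (\<lambda>t. \<gamma> (m * t + k)) = arc_length a b \<gamma>"
proof -
  define h where "h t = m * t + k" for t
  have img: "h ` {a'..b'} = {a..b}" using img by (simp add: h_def[abs_def])
  have hd: "(h has_vector_derivative m) (at t within S)" for t S
    unfolding h_def by (auto intro!: derivative_eq_intros)
  have hc: "continuous_on S h" for S unfolding h_def by (intro continuous_intros)
  have der: "(app_chart c \<circ> (\<lambda>t. \<gamma> (h t)) has_vector_derivative m *\<^sub>R D) (at t within {a'..b'})"
    if "(app_chart c \<circ> \<gamma> has_vector_derivative D) (at (h t) within {a..b})" for c D t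
  proof -
    have "((app_chart c \<circ> \<gamma>) \<circ> h has_vector_derivative m *\<^sub>R D) (at t within {a'..b'})"
      by (rule vector_diff_chain_within[OF hd]) (use that img in simp)
    then show ?thesis by (simp add: comp_def)
  qed
  have in_ab: "h t \<in> {a..b}" if "t \<in> {a'..b'}" for t using that img by blast
  have 1: "C1_curve_on A a' b' (\<lambda>t. \<gamma> (h t))"
    unfolding C1_curve_on_def
  proof (intro conjI ballI)
    show "continuous_on {a'..b'} (\<lambda>t. \<gamma> (h t))"
      by (rule continuous_on_compose2[OF C1_curve_continuous[OF \<gamma>] hc]) (use img in simp)
    fix c assume c: "c \<in> A"
    then obtain D where D: "continuous_on {t\<in>{a..b}. \<gamma> t \<in> dom_chart c} D"
      "\<And>t. t\<in>{a..b} \<Longrightarrow> \<gamma> t \<in> dom_chart c \<Longrightarrow>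
        ((app_chart c \<circ> \<gamma>) has_vector_derivative D t) (at t within {a..b})"
      using \<gamma> unfolding C1_curve_on_def by blast
    have "continuous_on {t\<in>{a'..b'}. \<gamma> (h t) \<in> dom_chart c} (\<lambda>t. m *\<^sub>R D (h t))"
      by (intro continuous_on_scaleR continuous_on_const continuous_on_compose2[OF D(1) hc])
         (use in_ab in auto)
    then show "\<exists>D. continuous_on {t\<in>{a'..b'}. \<gamma> (h t) \<in> dom_chart c} D \<and>
        (\<forall>t\<in>{a'..b'}. \<gamma> (h t) \<in> dom_chart c \<longrightarrow>
           ((app_chart c \<circ> (\<lambda>t. \<gamma> (h t))) has_vector_derivative D t) (at t within {a'..b'}))"
      using der D(2) in_ab by blast
  qed
  then show "C1_curve_on A a' b' (\<lambda>t. \<gamma> (m * t + k))" by (simp add: h_def)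
  have sp: "speed a' b' (\<lambda>t. \<gamma> (h t)) t = \<bar>m\<bar> * speed a b \<gamma> (h t)" if t: "t \<in> {a'..b'}" for t
  proof -
    obtain c where c: "c \<in> charts_at A (\<gamma> (h t))" using chart_at_exists by blast
    have cA: "c \<in> A" "\<gamma> (h t) \<in> dom_chart c" using c by (auto dest: charts_atD)
    note V = C1_curve_chart(2)[OF \<gamma> ab cA(1) in_ab[OF t] cA(2)]
    have "speed a' b' (\<lambda>t. \<gamma> (h t)) t
        = cnorm c (\<gamma> (h t)) (m *\<^sub>R vector_derivative (app_chart c \<circ> \<gamma>) (at (h t) within {a..b}))"
      by (rule speed_chart[OF C1_curve_continuous[OF 1] ab' t c der[OF V]])
    also have "\<dots> = \<bar>m\<bar> * speed a b \<gamma> (h t)"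
      by (simp add: inner_form.fnorm_scale[OF inner_form_cinner[OF c]]
          speed_chart[OF C1_curve_continuous[OF \<gamma>] ab in_ab[OF t] c V])
    finally show ?thesis .
  qed
  have "(speed a b \<gamma> has_integral arc_length a b \<gamma>) (cbox a b)"
    using integrable_continuous_real[OF continuous_speed[OF \<gamma> ab]]
    by (simp add: integrable_integral)
  from has_integral_affinity[OF this m, of k]
  have "((\<lambda>t. speed a b \<gamma> (h t)) has_integral (1 / \<bar>m\<bar>) * arc_length a b \<gamma>)
      ((\<lambda>x. (1 / m) * x + - ((1 / m) * k)) ` {a..b})"
    by (simp add: h_def)
  also have "(\<lambda>x. (1 / m) * x + - ((1 / m) * k)) ` {a..b} = {a'..b'}"
    unfolding img[symmetric] image_image h_def using m by (simp add: field_simps)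
  finally have "((\<lambda>t. \<bar>m\<bar> * speed a b \<gamma> (h t)) has_integral \<bar>m\<bar> * ((1 / \<bar>m\<bar>) * arc_length a b \<gamma>)) {a'..b'}"
    by (rule has_integral_mult_right)
  then have "(speed a' b' (\<lambda>t. \<gamma> (h t)) has_integral arc_length a b \<gamma>) {a'..b'}"
    using m by (subst has_integral_cong[OF sp]) simp_all
  then show "arc_length a' b' (\<lambda>t. \<gamma> (m * t + k)) = arc_length a b \<gamma>"
    unfolding h_def by (rule integral_unique)
qed

section \<open>Chains of C1 curves and the Riemannian distance\<close>

text \<open>Instead of piecewise C1 curves on \<open>[0, 1]\<close>, finite chains of C1 curves on arbitrary intervals
  are used: concatenating or cutting them requires no reparametrization.\<close>

inductive joined :: "'a \<Rightarrow> 'a \<Rightarrow> real \<Rightarrow> bool" where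
  refl: "joined p p 0"
| step: "joined p (\<gamma> a) L \<Longrightarrow> a < b \<Longrightarrow> C1_curve_on A a b \<gamma> \<Longrightarrow>
    joined p (\<gamma> b) (L + arc_length a b \<gamma>)"

lemma joined_curve:
  assumes "a < b" "C1_curve_on A a b \<gamma>"
  shows "joined (\<gamma> a) (\<gamma> b) (arc_length a b \<gamma>)"
  using joined.step[OF joined.refl assms] by simp

lemma joined_nonneg: "joined p q L \<Longrightarrow> L \<ge> 0"
  by (induction rule: joined.induct) (auto intro: add_nonneg_nonneg arc_length_nonneg)

lemma joined_trans:
  assumes "joined p q L" "joined q r L'"
  shows "joined p r (L + L')"
  using assms(2,1)
proof (induction rule: joined.induct)
  case (step p \<gamma> a L b)
  then show ?case using joined.step by (metis add.assoc)
qed simp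

lemma joined_sym: "joined p q L \<Longrightarrow> joined q p L"
proof (induction rule: joined.induct)
  case (refl p)
  show ?case by (rule joined.refl)
next
  case (step p \<gamma> a L b)
  have img: "(\<lambda>t. -1 * t + 0) ` {-b..-a} = {a..b}" by simp
  from joined_curve[OF _ C1_curve_affine(1)[OF step(3,2) _ _ img]]
    C1_curve_affine(2)[OF step(3,2) _ _ img] step(2)
  have "joined (\<gamma> b) (\<gamma> a) (arc_length a b \<gamma>)" by simp
  then show ?case using joined_trans step.IH by (metis add.commute)
qed

text \<open>A curve of the chain on which \<open>h\<close> passes the value \<open>r\<close> is cut by the intermediate value theorem.\<close>

lemma joined_cut:
  assumes "joined p q L" and h: "continuous_on UNIV h" and "h p \<le> r" "r \<le> h q"
  shows "\<exists>z L1 L2. h z = (r::real) \<and> joined p z L1 \<and> joined z q L2 \<and> L1 + L2 = L"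
  using assms(1,3,4)
proof (induction rule: joined.induct)
  case (refl p)
  then show ?case using joined.refl by (metis add_0 order_antisym)
next
  case (step p \<gamma> a L b)
  show ?case
  proof (cases "r \<le> h (\<gamma> a)")
    case True
    then obtain z L1 L2 where z: "h z = r" "joined p z L1" "joined z (\<gamma> a) L2" "L1 + L2 = L"
      using step by blast
    have "joined z (\<gamma> b) (L2 + arc_length a b \<gamma>)" using joined.step z step by blast
    then show ?thesis using z by (metis add.assoc)
  next
    case False
    have "continuous_on {a..b} (\<lambda>t. h (\<gamma> t))"
      by (rule continuous_on_compose2[OF h C1_curve_continuous[OF step(3)]]) auto
    then obtain t where t: "a \<le> t" "t \<le> b" "h (\<gamma> t) = r"
      using IVT'[of "\<lambda>t. h (\<gamma> t)" a r b] False step by fastforce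
    have "a < t" using t False by (cases "a = t") auto
    note C = C1_curve_subinterval[OF step(3) _ this t(2)]
    have p: "joined p (\<gamma> t) (L + arc_length a t \<gamma>)" using joined.step step(1) C(1) \<open>a < t\<close> by simp
    show ?thesis
    proof (cases "t = b")
      case True
      then show ?thesis using t p joined.refl by (metis add.right_neutral)
    next
      case False
      then have "t < b" using t by simp
      note C' = C1_curve_subinterval[OF step(3) t(1) this]
      have "joined (\<gamma> t) (\<gamma> b) (arc_length t b \<gamma>)" using joined_curve[OF \<open>t < b\<close> C'(1)] by simp
      moreover have "arc_length a t \<gamma> + arc_length t b \<gamma> = arc_length a b \<gamma>"
      proof -
        have "arc_length a t \<gamma> = integral {a..t} (speed a b \<gamma>)" by (rule integral_cong) (use C(2) in simp)
        moreover have "arc_length t b \<gamma> = integral {t..b} (speed a b \<gamma>)"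
          by (rule integral_cong) (use C'(2) in simp)
        moreover have "integral {a..t} (speed a b \<gamma>) + integral {t..b} (speed a b \<gamma>)
            = integral {a..b} (speed a b \<gamma>)"
          using t by (intro Henstock_Kurzweil_Integration.integral_combine
              integrable_continuous_real continuous_speed step)
        ultimately show ?thesis by simp
      qed
      ultimately show ?thesis using t p by (metis add.assoc)
    qed
  qed
qed

lemma partition_le:
  assumes "\<forall>i<n. s i < (s (Suc i) :: real)" "i \<le> n"
  shows "s i \<le> s n"
  using assms(2,1) by (induction rule: inc_induct) (auto intro: order.trans less_imp_le)

lemma joined_of_partition:
  assumes "\<forall>i<n. s i < (s (Suc i) :: real) \<and> C1_curve_on A (s i) (s (Suc i)) \<gamma>"
  defines "L \<equiv> \<Sum>i<n. arc_length (s i) (s (Suc i)) \<gamma>"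
  shows "joined (\<gamma> (s 0)) (\<gamma> (s n)) L"
    and "((\<lambda>t. tnorm g (\<gamma> t) (velocity A \<gamma> t)) has_integral L) {s 0..s n}"
proof -
  have "joined (\<gamma> (s 0)) (\<gamma> (s n)) (\<Sum>i<n. arc_length (s i) (s (Suc i)) \<gamma>) \<and>
     ((\<lambda>t. tnorm g (\<gamma> t) (velocity A \<gamma> t)) has_integral (\<Sum>i<n. arc_length (s i) (s (Suc i)) \<gamma>)) {s 0..s n}"
    using assms(1)
  proof (induction n)
    case 0
    show ?case using joined.refl by (simp add: has_integral_refl)
  next
    case (Suc n)
    then have n: "s n < s (Suc n)" "C1_curve_on A (s n) (s (Suc n)) \<gamma>" by auto
    have "s 0 \<le> s n" by (rule partition_le) (use Suc.prems in auto)
    then have "((\<lambda>t. tnorm g (\<gamma> t) (velocity A \<gamma> t)) has_integral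
        (\<Sum>i<n. arc_length (s i) (s (Suc i)) \<gamma>) + arc_length (s n) (s (Suc n)) \<gamma>) {s 0..s (Suc n)}"
      by (rule has_integral_combine) (use Suc n arc_length_velocity in auto)
    moreover have "joined (\<gamma> (s 0)) (\<gamma> (s (Suc n)))
        ((\<Sum>i<n. arc_length (s i) (s (Suc i)) \<gamma>) + arc_length (s n) (s (Suc n)) \<gamma>)"
      using Suc n by (intro joined.step) auto
    ultimately show ?case by simp
  qed
  then show "joined (\<gamma> (s 0)) (\<gamma> (s n)) L"
    and "((\<lambda>t. tnorm g (\<gamma> t) (velocity A \<gamma> t)) has_integral L) {s 0..s n}"
    by (simp_all add: L_def)
qed

lemma C1_curve_const:
  assumes "a < b"
  shows "C1_curve_on A a b (\<lambda>_. p)" and "arc_length a b (\<lambda>_. p) = 0"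
proof -
  have d: "((app_chart c \<circ> (\<lambda>_. p)) has_vector_derivative 0) (at t within {a..b})" for c :: "('a, 'e) chart" and t
    by (simp add: comp_def)
  show "C1_curve_on A a b (\<lambda>_. p)"
    unfolding C1_curve_on_def using d by (auto intro!: exI[of _ "\<lambda>_. 0"])
  have "speed a b (\<lambda>_. p) t = 0" if t: "t \<in> {a..b}" for t
  proof -
    obtain c where c: "c \<in> charts_at A p" using chart_at_exists by blast
    show ?thesis
      using speed_chart[OF _ assms t c d] inner_form.fnorm_zero[OF inner_form_cinner[OF c]] by simp
  qed
  then show "arc_length a b (\<lambda>_. p) = 0" by (subst integral_cong[of _ _ "\<lambda>_. 0"]) auto
qed

text \<open>By induction the chain without its last curve is realized on the first half of the interval; the last
  curve is moved affinely onto the second half.\<close>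

lemma partition_of_joined:
  assumes "joined p q L" "a < (b::real)"
  shows "\<exists>n s \<gamma>. s 0 = a \<and> s n = b \<and>
    (\<forall>i<n. s i < s (Suc i) \<and> C1_curve_on A (s i) (s (Suc i)) \<gamma>) \<and> \<gamma> a = p \<and> \<gamma> b = q \<and>
    L = (\<Sum>i<n. arc_length (s i) (s (Suc i)) \<gamma>)"
  using assms
proof (induction arbitrary: b rule: joined.induct)
  case (refl p)
  then show ?case
    by (intro exI[of _ "Suc 0"] exI[of _ "\<lambda>i. if i = 0 then a else b"] exI[of _ "\<lambda>_. p"])
       (simp add: C1_curve_const)
next
  case (step p \<gamma>0 a0 L b0)
  define m where "m = (a + b) / 2"
  have m: "a < m" "m < b" using step.prems by (auto simp: m_def)
  obtain n s \<gamma>1 where s: "s 0 = a" "s n = m" "\<And>i. i < n \<Longrightarrow> s i < s (Suc i)"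
    "\<And>i. i < n \<Longrightarrow> C1_curve_on A (s i) (s (Suc i)) \<gamma>1" "\<gamma>1 a = p" "\<gamma>1 m = \<gamma>0 a0"
    "L = (\<Sum>i<n. arc_length (s i) (s (Suc i)) \<gamma>1)"
    using step.IH[OF m(1)] by blast
  \<comment> \<open>\<open>t \<mapsto> r * t + k\<close> is the increasing affine map from \<open>{m..b}\<close> onto \<open>{a0..b0}\<close>.\<close>
  define r where "r = (b0 - a0) / (b - m)"
  define k where "k = a0 - r * m"
  have r: "r > 0" using m step by (simp add: r_def)
  have rb: "r * b + k = b0" and rm: "r * m + k = a0"
  proof -
    show "r * m + k = a0" by (simp add: k_def)
    have "r * (b - m) = b0 - a0" using m by (simp add: r_def)
    then show "r * b + k = b0" by (simp add: k_def algebra_simps)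
  qed
  have "(\<lambda>t. r * t + k) ` {m..b} = {a0..b0}"
    using r m rb rm by (subst image_affinity_atLeastAtMost) (auto simp: algebra_simps)
  note C = C1_curve_affine[OF step(3,2) _ m(2) this]
  define \<gamma> where "\<gamma> t = (if t \<le> m then \<gamma>1 t else \<gamma>0 (r * t + k))" for t
  define s' where "s' = s(Suc n := b)"
  have le: "s (Suc i) \<le> m" if "i < n" for i
    using partition_le[of n s "Suc i"] that s by auto
  have 1: "C1_curve_on A (s i) (s (Suc i)) \<gamma>"
    "arc_length (s i) (s (Suc i)) \<gamma>1 = arc_length (s i) (s (Suc i)) \<gamma>" if "i < n" for i
    using C1_curve_cong[OF s(4)[OF that] s(3)[OF that], of \<gamma>] le[OF that] by (auto simp: \<gamma>_def)
  have 2: "C1_curve_on A m b \<gamma>" "arc_length m b \<gamma> = arc_length a0 b0 \<gamma>0"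
  proof -
    have "\<gamma>0 (r * t + k) = \<gamma> t" if "t \<in> {m..b}" for t
      using that s(6) rm by (cases "t = m") (auto simp: \<gamma>_def)
    from C1_curve_cong[OF C(1) m(2) this]
    show "C1_curve_on A m b \<gamma>" "arc_length m b \<gamma> = arc_length a0 b0 \<gamma>0"
      using r C(2) by auto
  qed
  show ?case
  proof (intro exI conjI allI impI)
    show "s' 0 = a" "s' (Suc n) = b" using s by (auto simp: s'_def)
    show "s' i < s' (Suc i)" "C1_curve_on A (s' i) (s' (Suc i)) \<gamma>" if "i < Suc n" for i
      using that s 1 2 m by (auto simp: s'_def less_Suc_eq)
    show "\<gamma> a = p" using m s by (simp add: \<gamma>_def)
    show "\<gamma> b = \<gamma>0 b0" using m rb by (simp add: \<gamma>_def)
    have "(\<Sum>i<n. arc_length (s' i) (s' (Suc i)) \<gamma>) = L"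
      unfolding s(7) by (rule sum.cong) (use 1 in \<open>auto simp: s'_def\<close>)
    then show "L + arc_length a0 b0 \<gamma>0 = (\<Sum>i<Suc n. arc_length (s' i) (s' (Suc i)) \<gamma>)"
      using 2 s by (simp add: s'_def)
  qed
qed

lemma rdist_joined: "rdist A g p q = Inf {L. joined p q L}"
proof -
  have "{curve_length A g \<gamma> |\<gamma>. piecewise_C1_curve A \<gamma> \<and> \<gamma> 0 = p \<and> \<gamma> 1 = q} = {L. joined p q L}"
    (is "?C = ?J")
  proof
    show "?C \<subseteq> ?J"
    proof
      fix L assume "L \<in> ?C"
      then obtain \<gamma> n s where \<gamma>: "L = curve_length A g \<gamma>" "\<gamma> 0 = p" "\<gamma> 1 = q" "s 0 = 0" "s n = 1"
        and s: "\<forall>i<n. s i < (s (Suc i) :: real) \<and> C1_curve_on A (s i) (s (Suc i)) \<gamma>"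
        unfolding piecewise_C1_curve_def by blast
      show "L \<in> ?J"
        using joined_of_partition[OF s] \<gamma> by (simp add: curve_length_def integral_unique)
    qed
    show "?J \<subseteq> ?C"
    proof
      fix L assume "L \<in> ?J"
      then obtain n s \<gamma> where \<gamma>: "s 0 = 0" "s n = (1::real)" "\<gamma> 0 = p" "\<gamma> 1 = q"
          "L = (\<Sum>i<n. arc_length (s i) (s (Suc i)) \<gamma>)"
        and s: "\<forall>i<n. s i < s (Suc i) \<and> C1_curve_on A (s i) (s (Suc i)) \<gamma>"
        using partition_of_joined[of p q L 0 1] by auto
      have "curve_length A g \<gamma> = L"
        using joined_of_partition(2)[OF s] \<gamma> by (simp add: curve_length_def integral_unique)
      then show "L \<in> ?C" using \<gamma> s unfolding piecewise_C1_curve_def by blast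
    qed
  qed
  then show ?thesis by (simp add: rdist_def)
qed

section \<open>Growth along curves is controlled by pointwise Lipschitz bounds\<close>

text \<open>Only increments that start at \<open>p\<close> matter, and only to first order. The existential quantifier leaves
  the choice of a convenient chart, which may depend on \<open>p\<close>.\<close>

definition slope_at_most :: "real \<Rightarrow> ('a \<Rightarrow> real) \<Rightarrow> 'a \<Rightarrow> bool" where
  "slope_at_most k F p \<longleftrightarrow> (\<exists>c\<in>charts_at A p. \<forall>\<epsilon>>0. \<forall>\<^sub>F q in nhds p.
     F q - F p \<le> (k + \<epsilon>) * cnorm c p (app_chart c q - app_chart c p))"

text \<open>To first order to the right of \<open>t\<close>, the chart moves by the speed times the increment of \<open>t\<close>. So the
  pointwise bound on \<open>F\<close> and the fundamental theorem of calculus for the arc length bound the right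
  derivative of \<open>F \<circ> \<gamma>\<close> minus \<open>k\<close> times the arc length by an arbitrarily small \<open>\<epsilon>\<close>.\<close>

lemma increment_along_curve:
  assumes F: "continuous_on UNIV F" and k: "k \<ge> 0" and slope: "\<And>p. slope_at_most k F p"
    and ab: "a < b" and \<gamma>: "C1_curve_on A a b \<gamma>"
  shows "F (\<gamma> b) - F (\<gamma> a) \<le> k * arc_length a b \<gamma>"
proof -
  note cont = C1_curve_continuous[OF \<gamma>]
  define \<sigma> where "\<sigma> = speed a b \<gamma>"
  define S where "S s = integral {a..s} \<sigma>" for s
  define H where "H s = F (\<gamma> s) - k * S s" for s
  have \<sigma>: "continuous_on {a..b} \<sigma>" unfolding \<sigma>_def by (rule continuous_speed[OF \<gamma> ab])
  have dS: "(S has_vector_derivative \<sigma> t) (at t within {a..b})" if "t \<in> {a..b}" for t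
    unfolding S_def by (rule integral_has_vector_derivative[OF \<sigma> that])
  have contS: "continuous_on {a..b} S"
    unfolding continuous_on_eq_continuous_within using dS has_vector_derivative_continuous by blast
  have contH: "continuous_on {a..b} H"
    unfolding H_def by (intro continuous_intros contS continuous_on_compose2[OF F cont]) auto
  have "H b - H a \<le> \<epsilon> * (b - a)" if \<epsilon>: "\<epsilon> > 0" for \<epsilon>
  proof (rule right_Dini_bound[OF less_imp_le[OF ab] contH])
    fix t assume t: "a \<le> t" "t < b"
    then have tab: "t \<in> {a..b}" by simp
    obtain c where c: "c \<in> charts_at A (\<gamma> t)"
      and sl: "\<And>\<epsilon>. \<epsilon> > 0 \<Longrightarrow> \<forall>\<^sub>F q in nhds (\<gamma> t).
         F q - F (\<gamma> t) \<le> (k + \<epsilon>) * cnorm c (\<gamma> t) (app_chart c q - app_chart c (\<gamma> t))"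
      using slope[of "\<gamma> t"] unfolding slope_at_most_def by blast
    interpret P: inner_form "cinner c (\<gamma> t)" by (rule inner_form_cinner[OF c])
    have cA: "c \<in> A" "\<gamma> t \<in> dom_chart c" using c by (auto dest: charts_atD)
    note V = C1_curve_chart(2)[OF \<gamma> ab cA(1) tab cA(2)]
    have \<sigma>t: "\<sigma> t = cnorm c (\<gamma> t) (vector_derivative (app_chart c \<circ> \<gamma>) (at t within {a..b}))"
      unfolding \<sigma>_def by (rule speed_chart[OF cont ab tab c V])
    then have \<sigma>0: "\<sigma> t \<ge> 0" by simp
    \<comment> \<open>The errors of the three estimates below add up to \<open>\<delta> * (2 * k + \<sigma> t + \<delta>)\<close>.\<close>
    define \<delta> where "\<delta> = min 1 (\<epsilon> / (2 * k + \<sigma> t + 1))"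
    have \<delta>: "\<delta> > 0" "\<delta> \<le> 1" using \<epsilon> k \<sigma>0 by (auto simp: \<delta>_def)
    have "\<delta> * (2 * k + \<sigma> t + \<delta>) \<le> \<delta> * (2 * k + \<sigma> t + 1)"
      using \<delta> by (intro mult_left_mono) auto
    also have "\<dots> \<le> \<epsilon> / (2 * k + \<sigma> t + 1) * (2 * k + \<sigma> t + 1)"
      using k \<sigma>0 by (intro mult_right_mono) (auto simp: \<delta>_def)
    also have "\<dots> = \<epsilon>" using k \<sigma>0 by simp
    finally have \<delta>\<epsilon>: "\<delta> * (2 * k + \<sigma> t + \<delta>) \<le> \<epsilon>" .
    have "(\<gamma> \<longlongrightarrow> \<gamma> t) (at t within {a..b})"
      using cont tab by (simp add: continuous_on_def)
    then have 1: "\<forall>\<^sub>F s in at t within {a..b}. F (\<gamma> s) - F (\<gamma> t)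
        \<le> (k + \<delta>) * cnorm c (\<gamma> t) (app_chart c (\<gamma> s) - app_chart c (\<gamma> t))"
      using sl[OF \<delta>(1)] by (rule eventually_compose_filterlim[rotated])
    have 2: "\<forall>\<^sub>F s in at t within {a..b}.
        cnorm c (\<gamma> t) (app_chart c (\<gamma> s) - app_chart c (\<gamma> t)) \<le> (\<sigma> t + \<delta>) * \<bar>s - t\<bar>"
      using P.fnorm_increment_le[OF V \<delta>(1)] by (simp add: \<sigma>t)
    obtain d where d: "d > 0" "\<And>s. s \<in> {a..b} \<Longrightarrow> norm (s - t) < d \<Longrightarrow>
        norm (S s - S t - (s - t) *\<^sub>R \<sigma> t) \<le> \<delta> * norm (s - t)"
      using dS[OF tab] \<delta>(1) unfolding has_vector_derivative_def has_derivative_within_alt by blast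
    have 3: "\<forall>\<^sub>F s in at t within {a..b}. norm (S s - S t - (s - t) *\<^sub>R \<sigma> t) \<le> \<delta> * norm (s - t)"
      unfolding eventually_at using d by (auto simp: dist_norm)
    from 1 2 3 show "\<forall>\<^sub>F s in at t within {a..b}. t < s \<longrightarrow> H s - H t \<le> \<epsilon> * (s - t)"
    proof eventually_elim
      case (elim s)
      show ?case
      proof
        assume ts: "t < s"
        note elim(1)
        also have "(k + \<delta>) * cnorm c (\<gamma> t) (app_chart c (\<gamma> s) - app_chart c (\<gamma> t))
            \<le> (k + \<delta>) * ((\<sigma> t + \<delta>) * (s - t))"
          using elim(2) ts k \<delta> by (intro mult_left_mono) auto
        finally have "F (\<gamma> s) - F (\<gamma> t) \<le> (k + \<delta>) * ((\<sigma> t + \<delta>) * (s - t))" .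
        moreover have "k * ((\<sigma> t - \<delta>) * (s - t)) \<le> k * (S s - S t)"
          using elim(3) ts k by (intro mult_left_mono) (auto simp: algebra_simps abs_le_iff)
        ultimately have "H s - H t \<le> \<delta> * (2 * k + \<sigma> t + \<delta>) * (s - t)"
          by (simp add: H_def algebra_simps)
        also have "\<dots> \<le> \<epsilon> * (s - t)" using \<delta>\<epsilon> ts by (intro mult_right_mono) auto
        finally show "H s - H t \<le> \<epsilon> * (s - t)" .
      qed
    qed
  qed
  then have "H b - H a \<le> 0 + e" if "e > 0" for e
    using ab that by (metis add_0 diff_gt_0_iff_gt divide_pos_pos less_numeral_extra(3)
        nonzero_eq_divide_eq)
  then have "H b - H a \<le> 0" by (rule field_le_epsilon)
  then show ?thesis by (simp add: H_def S_def \<sigma>_def)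
qed

lemma increment_joined:
  assumes "joined p q L" and F: "continuous_on UNIV F" "k \<ge> 0" "\<And>p. slope_at_most k F p"
  shows "F q - F p \<le> k * L"
  using assms(1)
proof (induction rule: joined.induct)
  case (step p \<gamma> a L b)
  then show ?case using increment_along_curve[OF F step(2,3)] by (simp add: algebra_simps)
qed simp

section \<open>Comparison with the norm of a chart\<close>

lemma segment_joined:
  assumes c: "c \<in> charts_at A p" and q: "q \<in> ncball c p \<rho>"
    and ball: "{y. cnorm c p (y - app_chart c p) \<le> \<rho>} \<subseteq> app_chart c ` dom_chart c"
    and K: "\<And>q e. q \<in> ncball c p \<rho> \<Longrightarrow> cnorm c q e \<le> K * cnorm c p e"
  shows "\<exists>L. joined p q L \<and> L \<le> K * cnorm c p (app_chart c q - app_chart c p)"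
proof -
  interpret P: inner_form "cinner c p" by (rule inner_form_cinner[OF c])
  have cA: "c \<in> A" "p \<in> dom_chart c" "q \<in> dom_chart c"
    using c q by (auto dest: charts_atD simp: ncball_def)
  define x where "x = app_chart c p"
  define v where "v = app_chart c q - x"
  define l where "l t = x + t *\<^sub>R v" for t :: real
  define \<gamma> where "\<gamma> t = inv_chart c (l t)" for t
  have cl: "continuous_on S l" for S unfolding l_def by (intro continuous_intros)
  have dl: "(l has_vector_derivative v) (at t within S)" for t S
    unfolding l_def by (auto intro!: derivative_eq_intros)
  have lball: "cnorm c p (l t - app_chart c p) \<le> \<rho>" if "t \<in> {0..1}" for t
  proof -
    have "\<bar>t\<bar> * cnorm c p v \<le> 1 * cnorm c p v" using that by (intro mult_right_mono) auto
    also have "\<dots> \<le> \<rho>" using q by (simp add: ncball_def v_def x_def)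
    finally show ?thesis by (simp add: l_def x_def P.fnorm_scale)
  qed
  then have l: "l t \<in> app_chart c ` dom_chart c" if "t \<in> {0..1}" for t using ball that by blast
  have \<gamma>: "\<gamma> t \<in> dom_chart c" "app_chart c (\<gamma> t) = l t" "\<gamma> t \<in> ncball c p \<rho>" if "t \<in> {0..1}" for t
    using l[OF that] lball[OF that] cA by (auto simp: \<gamma>_def ncball_def)
  have cont: "continuous_on {0..1} \<gamma>"
    unfolding \<gamma>_def by (rule continuous_on_compose2[OF continuous_inv[OF cA(1)] cl]) (use l in auto)
  have C1: "C1_curve_on A 0 1 \<gamma>"
    unfolding C1_curve_on_def
  proof (intro conjI ballI)
    fix c' assume c': "c' \<in> A"
    define D where "D t = frechet_derivative (transition c c') (at (l t)) v" for t
    have ov: "l t \<in> app_chart c ` (dom_chart c \<inter> dom_chart c')" if "t \<in> {0..1}" "\<gamma> t \<in> dom_chart c'" for t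
      using \<gamma>[OF that(1)] that(2) by (metis IntI imageI)
    have "continuous_on (app_chart c ` (dom_chart c \<inter> dom_chart c'))
        (\<lambda>y. frechet_derivative (transition c c') (at y) v)"
      using transition_C1[OF cA(1) c'] by simp
    then have "continuous_on {t\<in>{0..1}. \<gamma> t \<in> dom_chart c'} D"
      unfolding D_def by (rule continuous_on_compose2[OF _ cl]) (use ov in auto)
    moreover have "((app_chart c' \<circ> \<gamma>) has_vector_derivative D t) (at t within {0..1})"
      if t: "t \<in> {0..1}" "\<gamma> t \<in> dom_chart c'" for t
    proof -
      have "(transition c c' has_derivative frechet_derivative (transition c c') (at (l t))) (at (l t))"
        by (rule C1_on_has_derivative[OF transition_C1[OF cA(1) c'] open_overlap[OF cA(1) c'] ov[OF t]])
      then have "(transition c c' \<circ> l has_vector_derivative D t) (at t within {0..1})"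
        unfolding D_def by (rule vector_derivative_diff_chain_within[OF dl has_derivative_at_withinI])
      then show ?thesis by (simp add: transition_def comp_def \<gamma>_def)
    qed
    ultimately show "\<exists>D. continuous_on {t\<in>{0..1}. \<gamma> t \<in> dom_chart c'} D \<and>
        (\<forall>t\<in>{0..1}. \<gamma> t \<in> dom_chart c' \<longrightarrow>
           ((app_chart c' \<circ> \<gamma>) has_vector_derivative D t) (at t within {0..1}))" by blast
  qed (rule cont)
  have "speed 0 1 \<gamma> t \<le> K * cnorm c p v" if t: "t \<in> {0..1}" for t
  proof -
    have "((app_chart c \<circ> \<gamma>) has_vector_derivative v) (at t within {0..1})"
      by (rule has_vector_derivative_transform[OF t _ dl]) (use \<gamma> in simp)
    then have "speed 0 1 \<gamma> t = cnorm c (\<gamma> t) v"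
      using \<gamma>[OF t] cA by (intro speed_chart[OF cont _ t]) (auto simp: charts_at_def)
    then show ?thesis using K[OF \<gamma>(3)[OF t]] by simp
  qed
  then have "arc_length 0 1 \<gamma> \<le> integral {0..1::real} (\<lambda>_. K * cnorm c p v)"
    by (intro integral_le integrable_continuous_real continuous_speed C1) auto
  then have "arc_length 0 1 \<gamma> \<le> K * cnorm c p v" by simp
  moreover have "\<gamma> 0 = p" "\<gamma> 1 = q" using cA by (auto simp: \<gamma>_def l_def x_def v_def)
  ultimately show ?thesis using joined_curve[OF _ C1] by (auto simp: v_def x_def)
qed

lemma joined_nearby:
  assumes c: "c \<in> charts_at A p" and \<eta>: "\<eta> > 0"
  shows "\<forall>\<^sub>F q in nhds p. \<exists>L. joined p q L \<and> L \<le> (1 + \<eta>) * cnorm c p (app_chart c q - app_chart c p)"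
proof -
  obtain U where U: "open U" "p \<in> U" "\<And>q e. q \<in> U \<Longrightarrow> cnorm c q e \<le> (1 + \<eta>) * cnorm c p e"
    using cnorm_nearby[OF c \<eta>] unfolding eventually_nhds by blast
  obtain \<rho> where \<rho>: "\<rho> > 0" "ncball c p \<rho> \<subseteq> U"
    "{y. cnorm c p (y - app_chart c p) \<le> \<rho>} \<subseteq> app_chart c ` (U \<inter> dom_chart c)"
    using small_ncball[OF c U(1,2)] by (metis order_refl)
  have "\<exists>L. joined p q L \<and> L \<le> (1 + \<eta>) * cnorm c p (app_chart c q - app_chart c p)"
    if q: "q \<in> nball c p \<rho>" for q
  proof (rule segment_joined[OF c])
    show "q \<in> ncball c p \<rho>" using q nball_ncball by blast
    show "{y. cnorm c p (y - app_chart c p) \<le> \<rho>} \<subseteq> app_chart c ` dom_chart c" using \<rho>(3) by blast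
    show "cnorm c q e \<le> (1 + \<eta>) * cnorm c p e" if "q \<in> ncball c p \<rho>" for q e
      using U(3) subsetD[OF \<rho>(2) that] .
  qed
  then show ?thesis by (rule nball_eventually[OF c \<rho>(1)])
qed

text \<open>A curve leaving \<open>p\<close> is at least as long as the chart distance that it travels, up to a factor
  close to 1.  The truncated chart distance to \<open>p\<close> is a function on all of \<open>M\<close>
  whose slope is under control, so this is an instance of the growth bound.\<close>

lemma joined_lower_bound:
  assumes c: "c \<in> charts_at A p" and \<eta>: "\<eta> > 0" and U: "open U" "p \<in> U"
  obtains \<rho> where "\<rho> > 0" "nball c p \<rho> \<subseteq> U"
    "\<And>q L. joined p q L \<Longrightarrow> q \<in> nball c p \<rho> \<Longrightarrow>
       cnorm c p (app_chart c q - app_chart c p) \<le> (1 + \<eta>) * L"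
    "\<And>q L. joined p q L \<Longrightarrow> q \<notin> nball c p \<rho> \<Longrightarrow> \<rho> \<le> (1 + \<eta>) * L"
proof -
  interpret P: inner_form "cinner c p" by (rule inner_form_cinner[OF c])
  have cA: "c \<in> A" "p \<in> dom_chart c" using c by (auto dest: charts_atD)
  obtain W where W: "open W" "p \<in> W" "\<And>q e. q \<in> W \<Longrightarrow> cnorm c p e \<le> (1 + \<eta>) * cnorm c q e"
    using cnorm_nearby[OF c \<eta>] unfolding eventually_nhds by blast
  obtain \<rho>0 where \<rho>0: "\<rho>0 > 0"
    "\<And>\<rho>. 0 < \<rho> \<Longrightarrow> \<rho> \<le> \<rho>0 \<Longrightarrow> compact (ncball c p \<rho>) \<and> ncball c p \<rho> \<subseteq> U \<inter> W"
    using small_ncball[OF c, of "U \<inter> W"] U W open_Int by (metis IntI)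
  define \<rho> where "\<rho> = \<rho>0 / 2"
  have \<rho>: "0 < \<rho>" "\<rho> < \<rho>0" using \<rho>0 by (auto simp: \<rho>_def)
  define N where "N q = cnorm c p (app_chart c q - app_chart c p)" for q
  define F where "F q = (if q \<in> nball c p \<rho> then N q else \<rho>)" for q
  have Fin: "F q = min (N q) \<rho>" if "q \<in> nball c p \<rho>0" for q
    using that by (auto simp: F_def nball_def N_def min_def)
  have Fout: "F q = \<rho>" if "q \<in> - ncball c p \<rho>" for q
    using that nball_ncball[of c p \<rho>] unfolding F_def by (auto dest: subsetD)
  have op1: "open (nball c p \<rho>0)" by (rule open_nball[OF c])
  have op2: "open (- ncball c p \<rho>)"
    using \<rho>0(2)[of \<rho>] \<rho> compact_imp_closed by (auto simp: open_Compl)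
  \<comment> \<open>On the first of these two open sets \<open>F\<close> is a truncated norm, on the second it is constant.\<close>
  have cover: "nball c p \<rho>0 \<union> - ncball c p \<rho> = UNIV" using \<rho> by (auto simp: nball_def ncball_def)
  have "continuous_on (nball c p \<rho>0) (\<lambda>q. min (N q) \<rho>)"
    unfolding N_def
    by (intro continuous_intros continuous_on_subset[OF continuous_radius[OF c]]) (auto simp: nball_def)
  then have "continuous_on (nball c p \<rho>0) F"
    by (rule continuous_on_eq) (simp add: Fin)
  moreover have "continuous_on (- ncball c p \<rho>) F"
    by (rule continuous_on_eq[OF continuous_on_const]) (simp add: Fout)
  ultimately have contF: "continuous_on UNIV F"
    using continuous_on_open_Un[OF op1 op2] cover by metis
  have slope: "slope_at_most (1 + \<eta>) F q" for q
  proof (cases "q \<in> nball c p \<rho>0")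
    case True
    then have cq: "c \<in> charts_at A q" using cA by (auto simp: nball_def charts_at_def)
    have "q \<in> W" using True nball_ncball[of c p \<rho>0] \<rho>0(2)[OF \<rho>0(1)] by blast
    interpret Q: inner_form "cinner c q" by (rule inner_form_cinner[OF cq])
    have "F q' - F q \<le> (1 + \<eta> + \<epsilon>) * cnorm c q (app_chart c q' - app_chart c q)"
      if "q' \<in> nball c p \<rho>0" "\<epsilon> > 0" for q' \<epsilon>
    proof -
      have "F q' - F q \<le> \<bar>N q' - N q\<bar>" using Fin[OF True] Fin[OF that(1)] by auto
      also have "\<dots> \<le> cnorm c p (app_chart c q' - app_chart c q)"
        using P.fnorm_diff_le[of "app_chart c q' - app_chart c p" "app_chart c q - app_chart c p"]
        by (simp add: N_def)
      also have "\<dots> \<le> (1 + \<eta>) * cnorm c q (app_chart c q' - app_chart c q)" by (rule W(3)[OF \<open>q \<in> W\<close>])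
      also have "\<dots> \<le> (1 + \<eta> + \<epsilon>) * cnorm c q (app_chart c q' - app_chart c q)"
        using that by (intro mult_right_mono) auto
      finally show ?thesis .
    qed
    then show ?thesis
      unfolding slope_at_most_def eventually_nhds using cq op1 True by blast
  next
    case False
    then have q: "q \<in> - ncball c p \<rho>" using cover by blast
    obtain c' where c': "c' \<in> charts_at A q" using chart_at_exists by blast
    have "F q' - F q \<le> (1 + \<eta> + \<epsilon>) * cnorm c' q (app_chart c' q' - app_chart c' q)"
      if "q' \<in> - ncball c p \<rho>" "\<epsilon> > 0" for q' \<epsilon>
      using Fout[OF q] Fout[OF that(1)] that(2) \<eta> inner_form.fnorm_nonneg[OF inner_form_cinner[OF c']]
      by simp
    then show ?thesis
      unfolding slope_at_most_def eventually_nhds using c' op2 q by blast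
  qed
  have F0: "F p = 0" using center_nball[OF c \<rho>(1)] by (simp add: F_def N_def)
  have bound: "F q \<le> (1 + \<eta>) * L" if "joined p q L" for q L
    using increment_joined[OF that contF _ slope] \<eta> F0 by simp
  show ?thesis
  proof (rule that[of \<rho>])
    show "nball c p \<rho> \<subseteq> U" using \<rho> \<rho>0(2)[of \<rho>] nball_ncball[of c p \<rho>] by auto
    show "cnorm c p (app_chart c q - app_chart c p) \<le> (1 + \<eta>) * L"
      if "joined p q L" "q \<in> nball c p \<rho>" for q L
      using bound[OF that(1)] that(2) by (simp add: F_def N_def)
    show "\<rho> \<le> (1 + \<eta>) * L" if "joined p q L" "q \<notin> nball c p \<rho>" for q L
      using bound[OF that(1)] that(2) by (simp add: F_def)
  qed (rule \<rho>(1))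
qed

end

section \<open>The Riemannian distance is a metric for the manifold topology\<close>

locale connected_riemannian_manifold = riemannian_manifold A g
  for A :: "('a::{t2_space, second_countable_topology}, 'e::euclidean_space) chart set" and g +
  assumes connected: "connected (UNIV :: 'a set)"
begin

abbreviation d :: "'a \<Rightarrow> 'a \<Rightarrow> real" where
  "d \<equiv> rdist A g"

text \<open>The set of points that are joined to \<open>p\<close> and its complement are both open, since nearby points are joined
  by a segment in a chart.\<close>

lemma joined_exists: "\<exists>L. joined p q L"
proof -
  let ?R = "{q. \<exists>L. joined p q L}"
  have nb: "\<exists>V. open V \<and> q \<in> V \<and> (\<forall>q'\<in>V. \<exists>L. joined q q' L)" for q
  proof -
    obtain c where c: "c \<in> charts_at A q" using chart_at_exists by blast
    have "\<forall>\<^sub>F q' in nhds q. \<exists>L. joined q q' L"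
      using joined_nearby[OF c zero_less_one] by (rule eventually_mono) blast
    then show ?thesis by (simp only: eventually_nhds)
  qed
  have "open ?R"
    unfolding open_subopen[of ?R]
  proof
    fix q assume "q \<in> ?R"
    then obtain L where L: "joined p q L" by blast
    obtain V where V: "open V" "q \<in> V" "\<forall>q'\<in>V. \<exists>L. joined q q' L" using nb by blast
    then have "V \<subseteq> ?R" using joined_trans[OF L] by blast
    then show "\<exists>T. open T \<and> q \<in> T \<and> T \<subseteq> ?R" using V by blast
  qed
  moreover have "open (- ?R)"
    unfolding open_subopen[of "- ?R"]
  proof
    fix q assume q: "q \<in> - ?R"
    obtain V where V: "open V" "q \<in> V" "\<forall>q'\<in>V. \<exists>L. joined q q' L" using nb by blast
    have "q' \<notin> ?R" if q': "q' \<in> V" for q'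
    proof
      assume "q' \<in> ?R"
      then obtain L L' where "joined p q' L" "joined q q' L'" using V(3) q' by blast
      from joined_trans[OF this(1) joined_sym[OF this(2)]] show False using q by blast
    qed
    then show "\<exists>T. open T \<and> q \<in> T \<and> T \<subseteq> - ?R" using V by blast
  qed
  ultimately have "?R \<inter> UNIV = {} \<or> (- ?R) \<inter> UNIV = {}"
    by (intro connectedD[OF connected]) auto
  moreover have "p \<in> ?R" using joined.refl by blast
  ultimately show ?thesis by blast
qed

lemma d_le: "joined p q L \<Longrightarrow> d p q \<le> L"
  unfolding rdist_joined using joined_nonneg by (intro cInf_lower bdd_belowI[of _ 0]) auto

lemma d_lessD: "d p q < r \<Longrightarrow> \<exists>L<r. joined p q L"
  unfolding rdist_joined using joined_exists[of p q] by (metis (no_types, lifting) cInf_lessD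
      empty_Collect_eq mem_Collect_eq)

lemma le_d: "(\<And>L. joined p q L \<Longrightarrow> r \<le> L) \<Longrightarrow> r \<le> d p q"
  using d_lessD not_le by metis

lemma d_nonneg [simp]: "d p q \<ge> 0"
  by (rule le_d) (rule joined_nonneg)

lemma d_self [simp]: "d p p = 0"
  using d_le[OF joined.refl] d_nonneg order_antisym by metis

lemma d_commute: "d p q = d q p"
proof -
  have "joined p q = joined q p" using joined_sym by blast
  then show ?thesis by (simp add: rdist_joined)
qed

lemma d_triangle: "d p r \<le> d p q + d q r"
proof (rule field_le_epsilon)
  fix e :: real assume "e > 0"
  then obtain L L' where "joined p q L" "L < d p q + e / 2" "joined q r L'" "L' < d q r + e / 2"
    using d_lessD[of p q "d p q + e / 2"] d_lessD[of q r "d q r + e / 2"] by auto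
  then show "d p r \<le> d p q + d q r + e" using d_le[OF joined_trans] by fastforce
qed

lemma increment_le_d:
  assumes "continuous_on UNIV F" "k \<ge> 0" "\<And>p. slope_at_most k F p"
  shows "F q - F p \<le> k * d p q"
proof (cases "k = 0")
  case True
  then show ?thesis using increment_joined[OF _ assms] joined_exists[of p q] by auto
next
  case False
  have "(F q - F p) / k \<le> d p q"
    by (rule le_d) (use increment_joined[OF _ assms] assms(2) False in \<open>auto simp: field_simps\<close>)
  then show ?thesis using assms(2) False by (simp add: field_simps)
qed

lemma d_le_nearby:
  assumes "c \<in> charts_at A p" "\<eta> > 0"
  shows "\<forall>\<^sub>F q in nhds p. d p q \<le> (1 + \<eta>) * cnorm c p (app_chart c q - app_chart c p)"
  using joined_nearby[OF assms] by eventually_elim (use d_le order_trans in blast)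

text \<open>Together with \<open>tendsto_d\<close>, this says that \<open>d\<close> induces the topology of the manifold.\<close>

lemma small_d_in_open:
  assumes "open U" "p \<in> U"
  obtains r where "r > 0" "\<And>q. d p q < r \<Longrightarrow> q \<in> U"
proof -
  obtain c where c: "c \<in> charts_at A p" using chart_at_exists by blast
  obtain \<rho> where \<rho>: "\<rho> > 0" "nball c p \<rho> \<subseteq> U"
    "\<And>q L. joined p q L \<Longrightarrow> q \<notin> nball c p \<rho> \<Longrightarrow> \<rho> \<le> (1 + 1) * L"
    by (rule joined_lower_bound[OF c zero_less_one assms]) (rule that; blast)
  have "q \<in> U" if "d p q < \<rho> / 2" for q
    using d_lessD[OF that] \<rho> by fastforce
  then show ?thesis using that[of "\<rho> / 2"] \<rho>(1) by simp
qed

lemma le_d_nearby: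
  assumes c: "c \<in> charts_at A p" and \<eta>: "\<eta> > 0"
  shows "\<forall>\<^sub>F q in nhds p. cnorm c p (app_chart c q - app_chart c p) \<le> (1 + \<eta>) * d p q"
proof -
  obtain \<rho> where \<rho>: "\<rho> > 0" "\<And>q L. joined p q L \<Longrightarrow> q \<in> nball c p \<rho> \<Longrightarrow>
       cnorm c p (app_chart c q - app_chart c p) \<le> (1 + \<eta>) * L"
    by (rule joined_lower_bound[OF c \<eta> open_UNIV UNIV_I]) (rule that; blast)
  have "cnorm c p (app_chart c q - app_chart c p) \<le> (1 + \<eta>) * d p q" if "q \<in> nball c p \<rho>" for q
  proof -
    have "cnorm c p (app_chart c q - app_chart c p) / (1 + \<eta>) \<le> d p q"
      by (rule le_d) (use \<rho>(2)[OF _ that] \<eta> in \<open>auto simp: field_simps\<close>)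
    then show ?thesis using \<eta> by (simp add: field_simps)
  qed
  then show ?thesis by (rule nball_eventually[OF c \<rho>(1)])
qed

lemma d_pos: "p \<noteq> q \<Longrightarrow> d p q > 0"
proof -
  assume "p \<noteq> q"
  then obtain U where "open U" "p \<in> U" "q \<notin> U" using t1_space by blast
  then obtain r where "r > 0" "\<not> d p q < r" using small_d_in_open by metis
  then show ?thesis by linarith
qed

lemma Metric_space_d: "Metric_space UNIV d"
proof (rule Metric_space.intro)
  show "0 \<le> d x y" for x y by simp
  show "d x y = d y x" for x y by (rule d_commute)
  show "d x y = 0 \<longleftrightarrow> x = y" for x y by (metis d_pos d_self less_irrefl)
  show "d x z \<le> d x y + d y z" for x y z by (rule d_triangle)
qed

lemma tendsto_d: "(d p \<longlongrightarrow> 0) (nhds p)"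
proof -
  obtain c where c: "c \<in> charts_at A p" using chart_at_exists by blast
  have "isCont (\<lambda>q. cnorm c p (app_chart c q - app_chart c p)) p"
    using continuous_radius[OF c] charts_atD[OF c] open_dom continuous_on_eq_continuous_at by blast
  then have "((\<lambda>q. cnorm c p (app_chart c q - app_chart c p)) \<longlongrightarrow> 0) (nhds p)"
    using inner_form.fnorm_zero[OF inner_form_cinner[OF c]]
    by (auto dest: isCont_tendsto_nhds)
  then have "((\<lambda>q. (1 + 1) * cnorm c p (app_chart c q - app_chart c p)) \<longlongrightarrow> 0) (nhds p)"
    by (rule tendsto_mult_right_zero)
  moreover have "\<forall>\<^sub>F q in nhds p. norm (d p q) \<le> (1 + 1) * cnorm c p (app_chart c q - app_chart c p)"
    using d_le_nearby[OF c zero_less_one] by (rule eventually_mono) simp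
  ultimately show ?thesis by (rule Lim_null_comparison[rotated])
qed

lemma Lipschitz_continuous:
  assumes "\<And>x y. u x - u y \<le> k * d x y"
  shows "continuous_on UNIV u"
proof (rule continuous_at_imp_continuous_on, rule ballI)
  fix x
  have "((\<lambda>y. k * d x y) \<longlongrightarrow> 0) (nhds x)" by (rule tendsto_mult_right_zero[OF tendsto_d])
  moreover have "norm (u y - u x) \<le> k * d x y" for y
    using assms[of x y] assms[of y x] by (simp add: d_commute abs_le_iff)
  then have "\<forall>\<^sub>F y in nhds x. norm (u y - u x) \<le> k * d x y" by simp
  ultimately have "((\<lambda>y. u y - u x) \<longlongrightarrow> 0) (nhds x)" by (rule Lim_null_comparison[rotated])
  then have "(u \<longlongrightarrow> u x) (nhds x)" by (simp add: LIM_zero_iff)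
  then show "isCont u x" by (simp add: isCont_def tendsto_at_iff_tendsto_nhds)
qed

lemma continuous_d: "continuous_on UNIV (d p)"
proof (rule Lipschitz_continuous[where k = 1])
  show "d p x - d p y \<le> 1 * d x y" for x y using d_triangle[of p x y] d_commute[of x y] by simp
qed

text \<open>An almost shortest curve from \<open>x\<close> to \<open>z\<close> crosses the sphere of radius \<open>r\<close> around \<open>x\<close>.\<close>

lemma intermediate_point:
  assumes "0 \<le> r" "r \<le> d x z" "\<epsilon> > 0"
  obtains y where "d x y = r" "d y z \<le> d x z - r + \<epsilon>"
proof -
  obtain L where L: "L < d x z + \<epsilon>" "joined x z L" using d_lessD[of x z "d x z + \<epsilon>"] assms by auto
  obtain y L1 L2 where y: "d x y = r" "joined x y L1" "joined y z L2" "L1 + L2 = L"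
    using joined_cut[OF L(2) continuous_d, of x r] assms by auto
  then show ?thesis using that[of y] L d_le[OF y(2)] d_le[OF y(3)] by simp
qed

section \<open>Viscosity solutions are 1-Lipschitz and descend at unit rate\<close>

text \<open>The metric form of the inequality \<open>|\<nabla>f| \<ge> 1\<close>: the graph of \<open>f\<close> stays above no cone with apex on the graph
  and slope less than 1, not even locally.\<close>

definition descends_at_unit_rate :: "('a \<Rightarrow> real) \<Rightarrow> bool" where
  "descends_at_unit_rate f \<longleftrightarrow>
     (\<forall>x \<kappa>. 0 < \<kappa> \<and> \<kappa> < 1 \<longrightarrow> \<not> (\<forall>\<^sub>F q in nhds x. f x - \<kappa> * d x q \<le> f q))"

text \<open>Subtract the test function \<open>L * N + C * N\<^sup>2\<close> with \<open>L > 1\<close>, where \<open>N\<close> is the distance from \<open>p\<close> in the norm at \<open>p\<close>.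
  Away from \<open>p\<close> it is \<open>C\<^sup>1\<close> with radial derivative at least \<open>L\<close>, which exceeds 1 by enough to absorb the
  variation of the metric, so the difference has no local maximum there. If \<open>C\<close> is large, the maximum over
  a small ball is not on the boundary either, so it is at \<open>p\<close>.\<close>

lemma viscosity_slope:
  assumes f: "viscosity_solution A g f"
  shows "slope_at_most 1 f p"
proof -
  obtain c where c: "c \<in> charts_at A p" using chart_at_exists by blast
  interpret P: inner_form "cinner c p" by (rule inner_form_cinner[OF c])
  have cA: "c \<in> A" "p \<in> dom_chart c" using c by (auto dest: charts_atD)
  have contf: "continuous_on UNIV f" using f by (simp add: viscosity_solution_def)
  define v where "v q = app_chart c q - app_chart c p" for q
  define Q where "Q q = cinner c p (v q) (v q)" for q
  define N where "N q = cnorm c p (v q)" for q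
  have NQ: "(N q)\<^sup>2 = Q q" "sqrt (Q q) = N q" "N q \<ge> 0" for q
    by (simp_all add: N_def Q_def form_norm_def P.nonneg)
  have Np: "N p = 0" by (simp add: N_def v_def)
  have "\<forall>\<^sub>F q in nhds p. f q - f p \<le> (1 + \<epsilon>) * N q" if \<epsilon>: "\<epsilon> > 0" for \<epsilon>
  proof -
    define L where "L = 1 + \<epsilon> / 2"
    obtain W where W: "open W" "p \<in> W" "\<And>q e. q \<in> W \<Longrightarrow> cnorm c q e \<le> (1 + \<epsilon> / 4) * cnorm c p e"
      using cnorm_nearby[OF c, of "\<epsilon> / 4"] \<epsilon> unfolding eventually_nhds by (auto simp: zero_less_divide_iff)
    obtain \<rho> where \<rho>: "\<rho> > 0" "compact (ncball c p \<rho>)" "ncball c p \<rho> \<subseteq> W"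
      using small_ncball[OF c W(1,2)] by (metis order_refl)
    let ?K = "ncball c p \<rho>"
    have pK: "p \<in> ?K" using center_nball[OF c \<rho>(1)] nball_ncball by blast
    have contK: "continuous_on ?K f" using contf continuous_on_subset by blast
    obtain B where B: "\<And>q. q \<in> ?K \<Longrightarrow> f q \<le> B"
      using continuous_attains_sup[OF \<rho>(2) _ contK] pK by blast
    \<comment> \<open>On the sphere \<open>N = \<rho>\<close> the term \<open>C * N\<^sup>2\<close> compensates for the oscillation \<open>B - f p\<close> of \<open>f\<close>.\<close>
    define C where "C = (B - f p) / \<rho>\<^sup>2"
    have C: "C \<ge> 0" "C * \<rho>\<^sup>2 = B - f p" using B[OF pK] \<rho>(1) by (auto simp: C_def)
    define \<theta> where "\<theta> r = L * sqrt r + C * r" for r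
    define \<theta>' where "\<theta>' r = L * (inverse (sqrt r) / 2) + C" for r
    have d\<theta>: "\<forall>r\<in>{0<..}. (\<theta> has_real_derivative \<theta>' r) (at r)"
      unfolding \<theta>_def \<theta>'_def by (auto intro!: derivative_eq_intros)
    have c\<theta>: "continuous_on {0<..} \<theta>'"
      unfolding \<theta>'_def by (intro continuous_intros) auto
    note test = radial_test_function[OF c open_greaterThan d\<theta> c\<theta>, folded v_def, folded Q_def]
    define \<Phi> where "\<Phi> q = f q - \<theta> (Q q)" for q
    have sub: "?K \<subseteq> dom_chart c" by (auto simp: ncball_def)
    have "continuous_on ?K Q"
      unfolding Q_def v_def
      by (intro P.continuous_on_form continuous_intros continuous_on_subset[OF continuous_app[OF cA(1)] sub])
    then have "continuous_on ?K \<Phi>" unfolding \<Phi>_def \<theta>_def by (intro continuous_intros contK)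
    then obtain q0 where q0: "q0 \<in> ?K" "\<And>q. q \<in> ?K \<Longrightarrow> \<Phi> q \<le> \<Phi> q0"
      using continuous_attains_sup[OF \<rho>(2)] pK by blast
    have \<Phi>N: "\<Phi> q = f q - (L * N q + C * (N q)\<^sup>2)" for q by (simp add: \<Phi>_def \<theta>_def NQ)
    have "\<Phi> q0 \<le> f p"
    proof (rule ccontr)
      assume "\<not> \<Phi> q0 \<le> f p"
      moreover have "\<Phi> p = f p" by (simp add: \<Phi>N Np)
      ultimately have "q0 \<noteq> p" and gt: "\<Phi> q0 > f p" by auto
      then have v0: "v q0 \<noteq> 0"
        using q0(1) sub cA inv_app by (metis eq_iff_diff_eq_0 subsetD v_def)
      then have N0: "N q0 > 0" by (simp add: N_def P.fnorm_pos)
      then have Q0: "Q q0 > 0" by (simp flip: NQ(1))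
      have "N q0 \<noteq> \<rho>"
      proof
        assume N\<rho>: "N q0 = \<rho>"
        have "\<Phi> q0 = f q0 - (L * \<rho> + (B - f p))" by (simp add: \<Phi>N N\<rho> C)
        also have "\<dots> \<le> f p - L * \<rho>" using B[OF q0(1)] by simp
        also have "\<dots> \<le> f p" using \<rho>(1) \<epsilon> by (simp add: L_def)
        finally show False using gt by simp
      qed
      moreover have "N q0 \<le> \<rho>" using q0(1) by (simp add: ncball_def N_def v_def)
      ultimately have inner: "q0 \<in> nball c p \<rho>"
        using q0(1) by (simp add: nball_def ncball_def N_def v_def)
      have "local_max_at (\<lambda>q. f q - \<theta> (Q q)) q0"
        unfolding local_max_at_def
        using eventually_nhds_in_open[OF open_nball[OF c] inner]
        proof (rule eventually_mono)
          fix q assume "q \<in> nball c p \<rho>"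
          then have "q \<in> ?K" using nball_ncball by blast
          from q0(2)[OF this] show "f q - \<theta> (Q q) \<le> f q0 - \<theta> (Q q0)" by (simp add: \<Phi>_def)
        qed
      moreover have U: "q0 \<in> {q \<in> dom_chart c. Q q \<in> {0<..}}" using q0(1) sub Q0 by auto
      ultimately have "tnorm g q0 (gradient A g (\<lambda>q. \<theta> (Q q)) q0) \<le> 1"
        using f test(1,2) unfolding viscosity_solution_def by blast
      then have le: "\<bar>\<theta>' (Q q0) * (2 * cinner c p (v q0) (v q0))\<bar> \<le> cnorm c q0 (v q0)"
        using test(3)[OF U, of 1] by simp
      have "\<theta>' (Q q0) * (2 * Q q0) = L * N q0 + 2 * C * Q q0"
      proof -
        have "inverse (N q0) * Q q0 = N q0"
          using N0 by (simp add: power2_eq_square flip: NQ(1))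
        then show ?thesis by (simp add: \<theta>'_def NQ(2) algebra_simps)
      qed
      then have "L * N q0 \<le> \<theta>' (Q q0) * (2 * Q q0)" using C Q0 by simp
      also have "\<dots> \<le> cnorm c q0 (v q0)" using le by (simp add: Q_def)
      also have "\<dots> \<le> (1 + \<epsilon> / 4) * N q0" using W(3) \<rho>(3) q0(1) by (auto simp: N_def)
      finally have "L \<le> 1 + \<epsilon> / 4" using N0 by simp
      then show False using \<epsilon> by (simp add: L_def)
    qed
    then have bound: "f q - f p \<le> L * N q + C * (N q)\<^sup>2" if "q \<in> ?K" for q
      using q0(2)[OF that] by (simp add: \<Phi>N)
    \<comment> \<open>On this smaller ball \<open>C * N\<close> is at most \<open>\<epsilon> / 2\<close>, so the quadratic term turns into part of the slope.\<close>
    define \<rho>1 where "\<rho>1 = min \<rho> (\<epsilon> / 2 / (C + 1))"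
    have "\<rho>1 > 0" using \<rho>(1) \<epsilon> C(1) by (simp add: \<rho>1_def)
    then show ?thesis
    proof (rule nball_eventually[OF c])
      fix q assume q: "q \<in> nball c p \<rho>1"
      then have N1: "N q \<le> \<rho>1" "q \<in> ?K" by (auto simp: nball_def ncball_def N_def v_def \<rho>1_def)
      have "C * N q \<le> (C + 1) * (\<epsilon> / 2 / (C + 1))"
        using N1 NQ(3)[of q] C by (intro mult_mono) (auto simp: \<rho>1_def)
      moreover have "C + 1 \<noteq> 0" using C(1) by linarith
      then have "(C + 1) * (\<epsilon> / 2 / (C + 1)) = \<epsilon> / 2"
        by (metis nonzero_mult_div_cancel_left times_divide_eq_right)
      ultimately have "C * N q \<le> \<epsilon> / 2" by linarith
      then have "C * N q * N q \<le> \<epsilon> / 2 * N q" using NQ(3) by (rule mult_right_mono)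
      then show "f q - f p \<le> (1 + \<epsilon>) * N q"
        using bound[OF N1(2)] by (simp add: L_def power2_eq_square algebra_simps)
    qed
  qed
  then show ?thesis unfolding slope_at_most_def N_def v_def using c by blast
qed

lemma viscosity_Lipschitz:
  assumes "viscosity_solution A g f"
  shows "f x - f y \<le> d x y"
  using increment_le_d[of f 1 x y] viscosity_slope[OF assms] assms
  by (simp add: viscosity_solution_def d_commute)

text \<open>Suppose that \<open>f\<close> stays above a cone of slope \<open>\<kappa> < 1\<close> near \<open>p\<close>. Touch \<open>f\<close> from below by the rounded cone
  \<open>- k * sqrt (s\<^sup>2 + N\<^sup>2)\<close> with \<open>\<kappa> < k < 1\<close>. It is steeper than the given cone, so for small \<open>s\<close> the contact takes place in
  the interior of a small ball, but its gradient is everywhere shorter than 1.\<close>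

lemma viscosity_descends:
  assumes f: "viscosity_solution A g f"
  shows "descends_at_unit_rate f"
  unfolding descends_at_unit_rate_def
proof (intro allI impI notI)
  fix p \<kappa> assume "0 < \<kappa> \<and> \<kappa> < 1" and flat: "\<forall>\<^sub>F q in nhds p. f p - \<kappa> * d p q \<le> f q"
  then have \<kappa>: "0 < \<kappa>" "\<kappa> < 1" by auto
  obtain c where c: "c \<in> charts_at A p" using chart_at_exists by blast
  interpret P: inner_form "cinner c p" by (rule inner_form_cinner[OF c])
  have cA: "c \<in> A" "p \<in> dom_chart c" using c by (auto dest: charts_atD)
  have contf: "continuous_on UNIV f" using f by (simp add: viscosity_solution_def)
  define v where "v q = app_chart c q - app_chart c p" for q
  define Q where "Q q = cinner c p (v q) (v q)" for q
  define N where "N q = cnorm c p (v q)" for q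
  have NQ: "(N q)\<^sup>2 = Q q" "N q \<ge> 0" "Q q \<ge> 0" for q
    by (simp_all add: N_def Q_def P.fnorm_sq P.nonneg)
  have Qp: "Q p = 0" by (simp add: v_def P.fnorm_sq[symmetric] Q_def)
  \<comment> \<open>The slope \<open>k\<close> lies between \<open>\<kappa>\<close> and 1, and a relative error \<open>\<eta>\<close> of the norms preserves both inequalities.\<close>
  define k where "k = (1 + \<kappa>) / 2"
  define \<eta> where "\<eta> = (1 - \<kappa>) / 4"
  have \<eta>: "\<eta> > 0" using \<kappa> by (simp add: \<eta>_def)
  have k: "0 < k" "k < 1" using \<kappa> by (auto simp: k_def)
  have kap: "\<kappa> * (1 + \<eta>) < k"
  proof -
    have "\<kappa> * \<eta> \<le> 1 * \<eta>" using \<kappa> \<eta> by (intro mult_right_mono) auto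
    moreover have "\<kappa> + \<eta> < k" using \<kappa> by (simp add: k_def \<eta>_def field_simps)
    moreover have "\<kappa> * (1 + \<eta>) = \<kappa> + \<kappa> * \<eta>" by (simp add: distrib_left)
    ultimately show ?thesis by linarith
  qed
  have k1: "k * (1 + \<eta>) < 1"
  proof -
    have "k * \<eta> \<le> 1 * \<eta>" using k \<eta> by (intro mult_right_mono) auto
    moreover have "k + \<eta> < 1" using \<kappa> by (simp add: k_def \<eta>_def field_simps)
    moreover have "k * (1 + \<eta>) = k + k * \<eta>" by (simp add: distrib_left)
    ultimately show ?thesis by linarith
  qed
  have "\<forall>\<^sub>F q in nhds p. f p - \<kappa> * d p q \<le> f q \<and> d p q \<le> (1 + \<eta>) * N q \<and>
      (\<forall>e. cnorm c p e \<le> (1 + \<eta>) * cnorm c q e)"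
    using flat d_le_nearby[OF c \<eta>] cnorm_nearby[OF c \<eta>]
    by eventually_elim (simp add: N_def v_def)
  then obtain W where W: "open W" "p \<in> W" "\<And>q. q \<in> W \<Longrightarrow> f p - \<kappa> * d p q \<le> f q"
    "\<And>q. q \<in> W \<Longrightarrow> d p q \<le> (1 + \<eta>) * N q"
    "\<And>q e. q \<in> W \<Longrightarrow> cnorm c p e \<le> (1 + \<eta>) * cnorm c q e"
    unfolding eventually_nhds by blast
  obtain \<rho> where \<rho>: "\<rho> > 0" "compact (ncball c p \<rho>)" "ncball c p \<rho> \<subseteq> W"
    using small_ncball[OF c W(1,2)] by (metis order_refl)
  let ?K = "ncball c p \<rho>"
  have pK: "p \<in> ?K" using center_nball[OF c \<rho>(1)] nball_ncball by blast
  \<comment> \<open>On the sphere \<open>N = \<rho>\<close> the rounded cone wins \<open>b * \<rho>\<close> over the given one, and rounding costs \<open>k * s\<close> at the apex.\<close>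
  define b where "b = k - \<kappa> * (1 + \<eta>)"
  define s where "s = b * \<rho> / (2 * k)"
  have b: "b > 0" using kap by (simp add: b_def)
  have s: "s > 0" "k * s < b * \<rho>" using b \<rho>(1) k by (auto simp: s_def)
  define \<theta> where "\<theta> r = - k * sqrt (s\<^sup>2 + r)" for r
  define \<theta>' where "\<theta>' r = - k * (inverse (sqrt (s\<^sup>2 + r)) / 2)" for r
  have d\<theta>: "\<forall>r\<in>{- s\<^sup>2<..}. (\<theta> has_real_derivative \<theta>' r) (at r)"
    unfolding \<theta>_def \<theta>'_def by (auto intro!: derivative_eq_intros)
  have c\<theta>: "continuous_on {- s\<^sup>2<..} \<theta>'"
    unfolding \<theta>'_def by (intro continuous_intros) auto
  note test = radial_test_function[OF c open_greaterThan d\<theta> c\<theta>, folded v_def, folded Q_def]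
  define \<Phi> where "\<Phi> q = f q - \<theta> (Q q)" for q
  have sub: "?K \<subseteq> dom_chart c" by (auto simp: ncball_def)
  have contK: "continuous_on ?K f" using contf continuous_on_subset by blast
  have "continuous_on ?K Q"
    unfolding Q_def v_def
    by (intro P.continuous_on_form continuous_intros continuous_on_subset[OF continuous_app[OF cA(1)] sub])
  then have "continuous_on ?K \<Phi>" unfolding \<Phi>_def \<theta>_def by (intro continuous_intros contK)
  then obtain q0 where q0: "q0 \<in> ?K" "\<And>q. q \<in> ?K \<Longrightarrow> \<Phi> q0 \<le> \<Phi> q"
    using continuous_attains_inf[OF \<rho>(2)] pK by blast
  have "N q0 \<noteq> \<rho>"
  proof
    assume N\<rho>: "N q0 = \<rho>"
    have "\<rho> \<le> sqrt (s\<^sup>2 + Q q0)" using \<rho>(1) N\<rho> by (intro real_le_rsqrt) (simp flip: NQ(1))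
    then have "k * \<rho> \<le> k * sqrt (s\<^sup>2 + Q q0)" using k by simp
    moreover have "\<kappa> * d p q0 \<le> \<kappa> * ((1 + \<eta>) * \<rho>)"
      using W(4)[of q0] \<rho>(3) q0(1) \<kappa> N\<rho> by (intro mult_left_mono) auto
    moreover have "f p - \<kappa> * d p q0 \<le> f q0" using W(3) \<rho>(3) q0(1) by blast
    moreover have "b * \<rho> = k * \<rho> - \<kappa> * ((1 + \<eta>) * \<rho>)" by (simp add: b_def algebra_simps)
    ultimately have "f p + b * \<rho> \<le> \<Phi> q0" by (simp add: \<Phi>_def \<theta>_def)
    moreover have "\<Phi> q0 \<le> f p + k * s" using q0(2)[OF pK] s by (simp add: \<Phi>_def \<theta>_def Qp)
    ultimately show False using s by simp
  qed
  moreover have "N q0 \<le> \<rho>" using q0(1) by (simp add: ncball_def N_def v_def)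
  ultimately have inner: "q0 \<in> nball c p \<rho>"
    using q0(1) by (simp add: nball_def ncball_def N_def v_def)
  have "local_min_at (\<lambda>q. f q - \<theta> (Q q)) q0"
    unfolding local_min_at_def
    using eventually_nhds_in_open[OF open_nball[OF c] inner]
    proof (rule eventually_mono)
      fix q assume "q \<in> nball c p \<rho>"
      then have "q \<in> ?K" using nball_ncball by blast
      from q0(2)[OF this] show "f q0 - \<theta> (Q q0) \<le> f q - \<theta> (Q q)" by (simp add: \<Phi>_def)
    qed
  moreover have Qs: "- s\<^sup>2 < Q q0" using NQ(3)[of q0] s zero_less_power[of s 2] by linarith
  then have U: "q0 \<in> {q \<in> dom_chart c. Q q \<in> {- s\<^sup>2<..}}" using q0(1) sub by auto
  ultimately have ge: "tnorm g q0 (gradient A g (\<lambda>q. \<theta> (Q q)) q0) \<ge> 1"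
    using f test(1,2) unfolding viscosity_solution_def by blast
  have "tnorm g q0 (gradient A g (\<lambda>q. \<theta> (Q q)) q0) \<le> k * (1 + \<eta>)"
  proof (subst test(3)[OF U], safe)
    show "0 \<le> k * (1 + \<eta>)" using k \<eta> by simp
    fix e
    define R where "R = sqrt (s\<^sup>2 + Q q0)"
    have R: "R > 0" "N q0 \<le> R" using Qs by (auto simp: R_def intro!: real_le_rsqrt simp: NQ)
    have "\<bar>\<theta>' (Q q0) * (2 * cinner c p (v q0) e)\<bar> = k * (inverse R * \<bar>cinner c p (v q0) e\<bar>)"
      using k R(1) by (simp add: \<theta>'_def R_def abs_mult)
    also have "\<dots> \<le> k * (inverse R * (N q0 * cnorm c p e))"
      using P.cauchy_schwarz[of "v q0" e] k R by (intro mult_left_mono) (auto simp: N_def)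
    also have "\<dots> \<le> k * (1 * cnorm c p e)"
    proof -
      have "inverse R * N q0 \<le> 1" using R by (simp add: field_simps)
      then have "inverse R * N q0 * cnorm c p e \<le> 1 * cnorm c p e" by (rule mult_right_mono) simp
      then show ?thesis using k by (intro mult_left_mono) (simp_all add: mult.assoc)
    qed
    also have "\<dots> \<le> k * ((1 + \<eta>) * cnorm c q0 e)"
      using W(5)[of q0 e] \<rho>(3) q0(1) k by (intro mult_left_mono) auto
    finally show "\<bar>\<theta>' (Q q0) * (2 * cinner c p (v q0) e)\<bar> \<le> k * (1 + \<eta>) * cnorm c q0 e"
      by (simp only: mult.assoc)
  qed
  then show False using ge k1 by simp
qed

lemma tendsto_inv_chart:
  assumes "c \<in> charts_at A p"
  shows "(inv_chart c \<longlongrightarrow> p) (nhds (app_chart c p))"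
proof -
  have cA: "c \<in> A" "p \<in> dom_chart c" using assms by (auto dest: charts_atD)
  have "isCont (inv_chart c) (app_chart c p)"
    using continuous_inv[OF cA(1)] open_image[OF cA(1)] cA
    by (simp add: continuous_on_eq_continuous_at)
  from isCont_tendsto_nhds[OF this] show ?thesis using cA by simp
qed

text \<open>At a local maximum of \<open>f - \<phi>\<close>, the function \<open>\<phi>\<close> decreases at rate at most 1, like \<open>f\<close>; following straight lines
  in a chart, this bounds the differential of \<open>\<phi>\<close> in every direction. At a local minimum with gradient shorter
  than 1, the first-order expansion of \<open>\<phi>\<close> would keep \<open>f\<close> above a cone of slope less than 1.\<close>

lemma viscosity_if_Lipschitz_descends:
  assumes Lip: "\<And>x y. f x - f y \<le> d x y" and desc: "descends_at_unit_rate f"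
  shows "viscosity_solution A g f"
  unfolding viscosity_solution_def
proof (intro conjI allI impI)
  show "continuous_on UNIV f" by (rule Lipschitz_continuous[where k = 1]) (use Lip in simp)
next
  fix p U \<phi> assume U: "open U \<and> p \<in> U \<and> C1_fun_on A U \<phi>"
    and max: "local_max_at (\<lambda>y. f y - \<phi> y) p"
  obtain c where c: "c \<in> charts_at A p" using chart_at_exists by blast
  interpret P: inner_form "cinner c p" by (rule inner_form_cinner[OF c])
  have cA: "c \<in> A" "p \<in> dom_chart c" using c by (auto dest: charts_atD)
  obtain l where l: "((\<phi> \<circ> inv_chart c) has_derivative l) (at (app_chart c p))"
    using C1_fun_on_has_derivative U c by metis
  note linl = has_derivative_linear[OF l]
  have low: "- ((1 + \<eta>) * cnorm c p e) \<le> l e" if \<eta>: "\<eta> > 0" for \<eta> e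
  proof (rule ccontr)
    assume not: "\<not> ?thesis"
    define \<psi> where "\<psi> t = \<phi> (inv_chart c (app_chart c p + t *\<^sub>R e)) + (1 + \<eta>) * cnorm c p e * t" for t :: real
    have line: "((\<lambda>t. app_chart c p + t *\<^sub>R e) has_vector_derivative e) (at 0)"
      by (auto intro!: derivative_eq_intros)
    have "((\<phi> \<circ> inv_chart c) has_derivative l)
        (at (app_chart c p + 0 *\<^sub>R e) within range (\<lambda>t. app_chart c p + t *\<^sub>R e))"
      using has_derivative_at_withinI[OF l] by simp
    from vector_derivative_diff_chain_within[OF line this]
    have "((\<phi> \<circ> inv_chart c) \<circ> (\<lambda>t. app_chart c p + t *\<^sub>R e) has_vector_derivative l e) (at 0)" .
    then have "((\<lambda>t. \<phi> (inv_chart c (app_chart c p + t *\<^sub>R e))) has_real_derivative l e) (at 0)"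
      by (simp add: has_real_derivative_iff_has_vector_derivative comp_def)
    moreover have "((\<lambda>t. (1 + \<eta>) * cnorm c p e * t) has_real_derivative (1 + \<eta>) * cnorm c p e) (at 0)"
      by (rule DERIV_cmult_Id)
    ultimately have D: "(\<psi> has_real_derivative l e + (1 + \<eta>) * cnorm c p e) (at 0)"
      unfolding \<psi>_def by (rule DERIV_add)
    have "l e + (1 + \<eta>) * cnorm c p e < 0" using not by simp
    from DERIV_neg_dec_right[OF D this]
    obtain \<delta> where \<delta>: "\<delta> > 0" "\<And>t. 0 < t \<Longrightarrow> t < \<delta> \<Longrightarrow> \<psi> t < \<psi> 0" by auto
    have "\<forall>\<^sub>F q in nhds p. f q - \<phi> q \<le> f p - \<phi> p \<and>
        d p q \<le> (1 + \<eta>) * cnorm c p (app_chart c q - app_chart c p)"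
      using max d_le_nearby[OF c \<eta>] unfolding local_max_at_def by eventually_elim simp
    then have "\<forall>\<^sub>F y in nhds (app_chart c p). f (inv_chart c y) - \<phi> (inv_chart c y) \<le> f p - \<phi> p \<and>
        d p (inv_chart c y) \<le> (1 + \<eta>) * cnorm c p (app_chart c (inv_chart c y) - app_chart c p)"
      by (rule eventually_compose_filterlim[OF _ tendsto_inv_chart[OF c]])
    moreover have "\<forall>\<^sub>F y in nhds (app_chart c p). y \<in> app_chart c ` dom_chart c"
      using open_image[OF cA(1)] cA by (intro eventually_nhds_in_open) auto
    ultimately have "\<forall>\<^sub>F y in nhds (app_chart c p). \<phi> p - \<phi> (inv_chart c y) \<le> (1 + \<eta>) * cnorm c p (y - app_chart c p)"
    proof eventually_elim
      case (elim y)
      then show ?case using Lip[of p "inv_chart c y"] cA by auto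
    qed
    moreover have "((\<lambda>t::real. app_chart c p + t *\<^sub>R e) \<longlongrightarrow> app_chart c p) (at_right 0)"
      by (auto intro!: tendsto_eq_intros)
    ultimately have "\<forall>\<^sub>F t in at_right 0. \<phi> p - \<phi> (inv_chart c (app_chart c p + t *\<^sub>R e))
        \<le> (1 + \<eta>) * cnorm c p (app_chart c p + t *\<^sub>R e - app_chart c p)"
      by (rule eventually_compose_filterlim)
    moreover have "\<forall>\<^sub>F t in at_right (0::real). 0 < t \<and> t < \<delta>"
      using \<delta>(1) eventually_at_right_less[of 0] eventually_at_right_real[of 0 \<delta>]
      by (auto elim: eventually_mono)
    ultimately have "\<forall>\<^sub>F t in at_right (0::real). False"
    proof eventually_elim
      case (elim t)
      then have "\<psi> 0 \<le> \<psi> t" using cA by (simp add: \<psi>_def P.fnorm_scale algebra_simps)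
      then show ?case using \<delta>(2)[of t] elim by simp
    qed
    then show False by simp
  qed
  have low1: "- cnorm c p e \<le> l e" for e
  proof (rule field_le_epsilon)
    fix \<epsilon> :: real assume \<epsilon>: "\<epsilon> > 0"
    define \<eta> where "\<eta> = \<epsilon> / (cnorm c p e + 1)"
    have pos: "cnorm c p e + 1 > 0" by (simp add: add_nonneg_pos)
    have \<eta>: "\<eta> > 0" using \<epsilon> pos by (simp add: \<eta>_def)
    have "\<eta> * cnorm c p e \<le> \<eta> * (cnorm c p e + 1)" using \<eta> by simp
    also have "\<dots> = \<epsilon>" using pos by (simp add: \<eta>_def)
    finally show "- cnorm c p e \<le> l e + \<epsilon>" using low[OF \<eta>, of e] by (simp add: algebra_simps)
  qed
  have "\<bar>l e\<bar> \<le> 1 * cnorm c p e" for e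
    using low1[of e] low1[of "- e"] by (simp add: linear_neg[OF linl] P.fnorm_minus abs_le_iff)
  then show "tnorm g p (gradient A g \<phi> p) \<le> 1"
    using tnorm_gradient_le_iff[OF c l, of 1] by simp
next
  fix p U \<phi> assume U: "open U \<and> p \<in> U \<and> C1_fun_on A U \<phi>"
    and min: "local_min_at (\<lambda>y. f y - \<phi> y) p"
  obtain c where c: "c \<in> charts_at A p" using chart_at_exists by blast
  interpret P: inner_form "cinner c p" by (rule inner_form_cinner[OF c])
  have cA: "c \<in> A" "p \<in> dom_chart c" using c by (auto dest: charts_atD)
  obtain l where l: "((\<phi> \<circ> inv_chart c) has_derivative l) (at (app_chart c p))"
    using C1_fun_on_has_derivative U c by metis
  obtain m where m: "m > 0" "\<And>x. m * norm x \<le> cnorm c p x" using P.norm_le_fnorm by blast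
  show "1 \<le> tnorm g p (gradient A g \<phi> p)"
  proof (rule ccontr)
    assume not: "\<not> ?thesis"
    \<comment> \<open>The maximum with 0 makes the sign of \<open>k\<close> evident.\<close>
    define k where "k = max 0 (tnorm g p (gradient A g \<phi> p))"
    have k: "0 \<le> k" "k < 1" "tnorm g p (gradient A g \<phi> p) \<le> k" using not by (auto simp: k_def)
    then have lk: "\<bar>l e\<bar> \<le> k * cnorm c p e" for e using tnorm_gradient_le_iff[OF c l] by blast
    define \<eta> where "\<eta> = (1 - k) / 4"
    have \<eta>: "\<eta> > 0" using k by (simp add: \<eta>_def)
    define \<kappa> where "\<kappa> = (k + \<eta>) * (1 + \<eta>)"
    have \<kappa>: "0 < \<kappa>" "\<kappa> < 1"
    proof -
      show "0 < \<kappa>" using k \<eta> by (simp add: \<kappa>_def add_nonneg_pos)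
      have k\<eta>: "k + \<eta> + \<eta> < 1" using k by (simp add: \<eta>_def field_simps)
      then have "(k + \<eta>) * \<eta> \<le> 1 * \<eta>" using \<eta> by (intro mult_right_mono) auto
      moreover have "\<kappa> = k + \<eta> + (k + \<eta>) * \<eta>" by (simp add: \<kappa>_def algebra_simps)
      ultimately show "\<kappa> < 1" using k\<eta> by linarith
    qed
    obtain \<delta> where \<delta>: "\<delta> > 0" "\<And>y. norm (y - app_chart c p) < \<delta> \<Longrightarrow>
        norm ((\<phi> \<circ> inv_chart c) y - (\<phi> \<circ> inv_chart c) (app_chart c p) - l (y - app_chart c p))
        \<le> \<eta> * m * norm (y - app_chart c p)"
      using l \<eta> m(1) unfolding has_derivative_at_alt by (metis mult_pos_pos)
    have "(app_chart c \<longlongrightarrow> app_chart c p) (nhds p)"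
      using isCont_app[OF c] by (simp add: isCont_def tendsto_at_iff_tendsto_nhds)
    then have "\<forall>\<^sub>F q in nhds p. dist (app_chart c q) (app_chart c p) < \<delta>"
      using \<delta>(1) by (rule tendstoD)
    moreover have "\<forall>\<^sub>F q in nhds p. q \<in> dom_chart c"
      using open_dom[OF cA(1)] cA(2) by (rule eventually_nhds_in_open)
    moreover note min[unfolded local_min_at_def] le_d_nearby[OF c \<eta>]
    ultimately have "\<forall>\<^sub>F q in nhds p. f p - \<kappa> * d p q \<le> f q"
    proof eventually_elim
      case (elim q)
      define v where "v = app_chart c q - app_chart c p"
      have "\<bar>\<phi> q - \<phi> p - l v\<bar> \<le> \<eta> * m * norm v"
        using \<delta>(2)[of "app_chart c q"] elim cA by (simp add: dist_norm v_def)
      also have "\<dots> \<le> \<eta> * cnorm c p v" using m(2)[of v] \<eta> by (simp add: mult.assoc)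
      finally have "\<phi> p - \<phi> q \<le> (k + \<eta>) * cnorm c p v"
        using lk[of v] by (simp add: algebra_simps abs_le_iff)
      also have "\<dots> \<le> (k + \<eta>) * ((1 + \<eta>) * d p q)"
        using elim k \<eta> by (intro mult_left_mono) (auto simp: v_def)
      finally show ?case using elim by (simp add: \<kappa>_def algebra_simps)
    qed
    then show False using desc \<kappa> unfolding descends_at_unit_rate_def by blast
  qed
qed

lemma viscosity_iff_metric:
  "viscosity_solution A g f \<longleftrightarrow> (\<forall>x y. f x - f y \<le> d x y) \<and> descends_at_unit_rate f"
  using viscosity_Lipschitz viscosity_descends viscosity_if_Lipschitz_descends by blast

section \<open>Distance to a set\<close>

lemma rdist_set_le: "z \<in> K \<Longrightarrow> rdist_set A g x K \<le> d x z"
  unfolding rdist_set_def by (rule cINF_lower[OF bdd_belowI[of _ 0]]) auto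

lemma le_rdist_set: "K \<noteq> {} \<Longrightarrow> (\<And>z. z \<in> K \<Longrightarrow> r \<le> d x z) \<Longrightarrow> r \<le> rdist_set A g x K"
  unfolding rdist_set_def by (rule cINF_greatest)

lemma rdist_set_lessD: "K \<noteq> {} \<Longrightarrow> rdist_set A g x K < r \<Longrightarrow> \<exists>z\<in>K. d x z < r"
  using le_rdist_set[of K r x] by (meson not_le)

lemma rdist_set_Lipschitz:
  assumes "K \<noteq> {}"
  shows "rdist_set A g x K - rdist_set A g y K \<le> d x y"
proof -
  have "rdist_set A g x K - d x y \<le> rdist_set A g y K"
  proof (rule le_rdist_set[OF assms])
    fix z assume "z \<in> K"
    then show "rdist_set A g x K - d x y \<le> d y z"
      using rdist_set_le[of z K x] d_triangle[of x z y] by linarith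
  qed
  then show ?thesis by linarith
qed

section \<open>Functions of class dl are viscosity solutions\<close>

lemma dl_Lipschitz:
  assumes "dl_function A g h"
  shows "h x - h y \<le> d x y"
proof -
  obtain y0 K where K: "\<forall>n. closed (K n) \<and> K n \<noteq> {}"
    and lim: "\<forall>C. compact C \<longrightarrow>
      uniform_limit C (\<lambda>n x. rdist_set A g x (K n) - rdist_set A g y0 (K n)) h sequentially"
    using assms unfolding dl_function_def by (elim exE conjE) (rule that; assumption)
  have pt: "(\<lambda>n. rdist_set A g x (K n) - rdist_set A g y0 (K n)) \<longlonglongrightarrow> h x" for x
    using tendsto_uniform_limitI[OF lim[rule_format, of "{x}"]] by simp
  have "(\<lambda>n. rdist_set A g x (K n) - rdist_set A g y (K n)) \<longlonglongrightarrow> h x - h y"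
    using tendsto_diff[OF pt[of x] pt[of y]] by simp
  then show ?thesis
    by (rule LIMSEQ_le_const2) (intro exI[of _ 0] allI impI rdist_set_Lipschitz, use K in simp)
qed

text \<open>At a point \<open>x\<close> far from \<open>K n\<close>, the distance to \<open>K n\<close> drops by almost \<open>r\<close> at some point of the sphere of radius
  \<open>r\<close> around \<open>x\<close>. The point depends on \<open>n\<close>, but the sphere is compact for small \<open>r\<close>, so the convergence is
  uniform on it and a single large \<open>n\<close> yields such a point for \<open>h\<close>.\<close>

lemma dl_descends:
  assumes "dl_function A g h"
  shows "descends_at_unit_rate h"
  unfolding descends_at_unit_rate_def
proof (intro allI impI notI)
  fix x \<kappa> assume \<kappa>: "0 < \<kappa> \<and> \<kappa> < 1" and flat: "\<forall>\<^sub>F q in nhds x. h x - \<kappa> * d x q \<le> h q"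
  obtain y0 K where cK: "\<forall>n. closed (K n) \<and> K n \<noteq> {}"
    and far: "filterlim (\<lambda>n. rdist_set A g y0 (K n)) at_top sequentially"
    and lim: "\<forall>C. compact C \<longrightarrow>
      uniform_limit C (\<lambda>n x. rdist_set A g x (K n) - rdist_set A g y0 (K n)) h sequentially"
    using assms unfolding dl_function_def by (elim exE conjE) (rule that; assumption)
  have K: "K n \<noteq> {}" for n using cK by blast
  obtain W where W: "open W" "x \<in> W" "\<And>q. q \<in> W \<Longrightarrow> h x - \<kappa> * d x q \<le> h q"
    using flat unfolding eventually_nhds by blast
  obtain c where c: "c \<in> charts_at A x" using chart_at_exists by blast
  obtain \<rho> where \<rho>: "\<rho> > 0" "compact (ncball c x \<rho>)" "ncball c x \<rho> \<subseteq> W"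
    using small_ncball[OF c W(1,2)] by (metis order_refl)
  obtain r0 where r0: "r0 > 0" "\<And>q. d x q < r0 \<Longrightarrow> q \<in> nball c x \<rho>"
    using small_d_in_open[OF open_nball[OF c] center_nball[OF c \<rho>(1)]] by metis
  define r where "r = r0 / 2"
  have r: "0 < r" "r < r0" using r0 by (auto simp: r_def)
  define S where "S = {q. d x q = r}"
  have "closed S"
    unfolding S_def by (intro closed_Collect_eq continuous_d continuous_on_const)
  moreover have "S \<subseteq> ncball c x \<rho>" using r0(2) r nball_ncball[of c x \<rho>] by (auto simp: S_def)
  ultimately have S: "compact S" "S \<subseteq> W"
    using \<rho> compact_Int_closed[of "ncball c x \<rho>" S] by (auto simp: Int_absorb1)
  \<comment> \<open>Four errors of size \<open>e\<close> occur: two from the uniform convergence, two from almost shortest curves.\<close>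
  define e where "e = (1 - \<kappa>) * r / 4"
  have e: "e > 0" using \<kappa> r by (simp add: e_def)
  have "compact (insert x S)" using S by simp
  from uniform_limitD[OF lim[rule_format, OF this] e]
  have "\<forall>\<^sub>F n in sequentially. \<forall>q\<in>insert x S.
      dist (rdist_set A g q (K n) - rdist_set A g y0 (K n)) (h q) < e" .
  moreover have "\<forall>\<^sub>F n in sequentially. r + d y0 x \<le> rdist_set A g y0 (K n)"
    using far unfolding filterlim_at_top by blast
  ultimately have "\<forall>\<^sub>F n in sequentially. (\<forall>q\<in>insert x S.
      dist (rdist_set A g q (K n) - rdist_set A g y0 (K n)) (h q) < e) \<and>
      r + d y0 x \<le> rdist_set A g y0 (K n)" by (rule eventually_conj)
  then obtain n where n: "\<And>q. q \<in> insert x S \<Longrightarrow>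
      \<bar>rdist_set A g q (K n) - rdist_set A g y0 (K n) - h q\<bar> < e"
    "r + d y0 x \<le> rdist_set A g y0 (K n)"
    unfolding eventually_sequentially dist_real_def by blast
  obtain z where z: "z \<in> K n" "d x z < rdist_set A g x (K n) + e"
    using rdist_set_lessD[OF K, of x n "rdist_set A g x (K n) + e"] e by auto
  have "r \<le> rdist_set A g x (K n)"
    using rdist_set_Lipschitz[OF K, of y0 n x] n(2) by linarith
  then have "r \<le> d x z" using rdist_set_le[OF z(1), of x] by linarith
  then obtain q where q: "d x q = r" "d q z \<le> d x z - r + e"
    using intermediate_point[of r x z e] r e by auto
  have "q \<in> S" using q by (simp add: S_def)
  have "rdist_set A g q (K n) \<le> rdist_set A g x (K n) - r + 2 * e"
    using rdist_set_le[OF z(1), of q] q z by linarith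
  moreover have "h q < rdist_set A g q (K n) - rdist_set A g y0 (K n) + e"
    using n(1)[of q] \<open>q \<in> S\<close> by (auto simp: abs_less_iff)
  moreover have "rdist_set A g x (K n) - rdist_set A g y0 (K n) < h x + e"
    using n(1)[of x] by (auto simp: abs_less_iff)
  moreover have "4 * e = r - \<kappa> * r" by (simp add: e_def field_simps)
  ultimately have "h q < h x - \<kappa> * r" by linarith
  then show False using W(3)[of q] S \<open>q \<in> S\<close> q(1) by auto
qed

lemma dl_imp_viscosity:
  "dl_function A g h \<Longrightarrow> viscosity_solution A g h"
  using viscosity_iff_metric dl_Lipschitz dl_descends by blast

lemma viscosity_add_const:
  "viscosity_solution A g (\<lambda>x. f x + c) \<longleftrightarrow> viscosity_solution A g f"
  by (simp add: viscosity_iff_metric descends_at_unit_rate_def algebra_simps)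

end

section \<open>Viscosity solutions are of class dl\<close>

locale complete_riemannian_manifold = connected_riemannian_manifold A g
  for A :: "('a::{t2_space, second_countable_topology}, 'e::euclidean_space) chart set" and g +
  assumes complete: "complete_riemannian A g"
begin

text \<open>Ekeland's principle for \<open>max f m\<close> with slope \<open>\<kappa>\<close> gives a point \<open>z\<close> from which the descent at rate \<open>\<kappa>\<close> cannot be
  continued. If \<open>f z > m\<close>, then \<open>max f m\<close> is \<open>f\<close> near \<open>z\<close>, and \<open>f\<close> does descend from \<open>z\<close> at this rate.\<close>

lemma sublevel_point:
  assumes f: "viscosity_solution A g f" and m: "m \<le> f x" and \<kappa>: "0 < \<kappa>" "\<kappa> < 1"
  shows "\<exists>z. f z \<le> m \<and> \<kappa> * d x z \<le> f x - m"
proof -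
  interpret D: Metric_space UNIV d by (rule Metric_space_d)
  have contf: "continuous_on UNIV f" using f by (simp add: viscosity_solution_def)
  define h where "h x = max (f x) m" for x
  have Lip: "h x - h y \<le> d x y" for x y
    using viscosity_Lipschitz[OF f, of x y] d_nonneg[of x y] unfolding h_def by linarith
  have lsc: "h z \<le> r" if lim: "limitin D.mtopology \<sigma> z sequentially" and le: "\<And>n. h (\<sigma> n) \<le> r" for \<sigma> z r
  proof (rule field_le_epsilon)
    fix e :: real assume "e > 0"
    then obtain n where "d (\<sigma> n) z < e" using lim unfolding D.limit_metric_sequentially by blast
    then show "h z \<le> r + e" using Lip[of z "\<sigma> n"] le[of n] d_commute[of z "\<sigma> n"] by linarith
  qed
  have "\<exists>z. h z + \<kappa> * d x z \<le> h x \<and> (\<forall>y. y \<noteq> z \<longrightarrow> h z < h y + \<kappa> * d z y)"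
  proof (rule D.Ekeland_variational_principle[where h = h and \<kappa> = \<kappa> and ?x0.0 = x and b = m])
    show "D.mcomplete" using complete by (simp add: complete_riemannian_def)
    show "m \<le> h y" for y by (simp add: h_def)
    show "h z \<le> r" if "limitin D.mtopology \<sigma> z sequentially" "\<And>n. h (\<sigma> n) \<le> r" for \<sigma> z r
      by (rule lsc[OF that])
  qed (use \<kappa> in blast)+
  then obtain z where z: "h z + \<kappa> * d x z \<le> h x" "\<And>y. y \<noteq> z \<Longrightarrow> h z < h y + \<kappa> * d z y"
    by blast
  have "f z \<le> m"
  proof (rule ccontr)
    assume "\<not> f z \<le> m"
    moreover have "isCont f z" using contf by (simp add: continuous_on_eq_continuous_at)
    ultimately have "\<forall>\<^sub>F q in nhds z. m < f q"
      by (intro order_tendstoD(1)[OF isCont_tendsto_nhds]) auto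
    then have "\<forall>\<^sub>F q in nhds z. f z - \<kappa> * d z q \<le> f q"
    proof (rule eventually_mono)
      fix q assume "m < f q"
      then show "f z - \<kappa> * d z q \<le> f q"
        using z(2)[of q] by (cases "q = z") (auto simp: h_def)
    qed
    then show False using viscosity_descends[OF f] \<kappa> unfolding descends_at_unit_rate_def by blast
  qed
  then show ?thesis using z(1) m by (auto simp: h_def)
qed

text \<open>The Lipschitz bound is one inequality; letting \<open>\<kappa>\<close> tend to 1 in \<open>sublevel_point\<close> gives the other.\<close>

lemma distance_to_sublevel_set:
  assumes f: "viscosity_solution A g f" and m: "m \<le> f x"
  shows "rdist_set A g x {z. f z \<le> m} = f x - m"
proof (rule antisym)
  let ?K = "{z. f z \<le> m}"
  have "?K \<noteq> {}" using sublevel_point[OF f m, of "1 / 2"] by auto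
  then show "f x - m \<le> rdist_set A g x ?K"
  proof (rule le_rdist_set)
    fix z assume "z \<in> ?K"
    then show "f x - m \<le> d x z" using viscosity_Lipschitz[OF f, of x z] by simp
  qed
  show "rdist_set A g x ?K \<le> f x - m"
  proof (rule field_le_mult_one_interval)
    fix \<kappa> :: real assume \<kappa>: "0 < \<kappa>" "\<kappa> < 1"
    then obtain z where z: "f z \<le> m" "\<kappa> * d x z \<le> f x - m" using sublevel_point[OF f m] by blast
    have "\<kappa> * rdist_set A g x ?K \<le> \<kappa> * d x z"
      using \<kappa> z(1) by (intro mult_left_mono rdist_set_le) auto
    then show "\<kappa> * rdist_set A g x ?K \<le> f x - m" using z(2) by linarith
  qed
qed

text \<open>The sublevel sets of \<open>f\<close> for the levels \<open>-n\<close> serve as \<open>K n\<close>: once \<open>-n\<close> is below the minimum of \<open>f\<close> on the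
  compact set and \<open>y\<close>, the normalized distance to \<open>K n\<close> equals \<open>f - f y\<close> there.\<close>

lemma viscosity_imp_dl:
  assumes f: "viscosity_solution A g f"
  shows "dl_function A g (\<lambda>x. f x + (- f y))"
proof -
  have contf: "continuous_on UNIV f" using f by (simp add: viscosity_solution_def)
  define K where "K n = {z. f z \<le> - real n}" for n
  have dist: "rdist_set A g x (K n) = f x + real n" if "- real n \<le> f x" for x n
    using distance_to_sublevel_set[OF f that] by (simp add: K_def)
  have "closed (K n)" for n
    unfolding K_def by (intro closed_Collect_le contf continuous_on_const)
  moreover have "K n \<noteq> {}" for n
  proof (cases "- real n \<le> f y")
    case True
    then show ?thesis using sublevel_point[OF f True, of "1 / 2"] by (auto simp: K_def)
  next
    case False
    then show ?thesis by (auto simp: K_def intro: exI[of _ y])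
  qed
  moreover have "filterlim (\<lambda>n. rdist_set A g y (K n)) at_top sequentially"
  proof -
    have "filterlim (\<lambda>n. f y + real n) at_top sequentially"
      by (intro filterlim_tendsto_add_at_top[OF tendsto_const] filterlim_real_sequentially)
    moreover have "\<forall>\<^sub>F n in sequentially. rdist_set A g y (K n) = f y + real n"
      using eventually_ge_at_top[of "nat \<lceil>- f y\<rceil>"]
    proof eventually_elim
      case (elim n)
      then have "- real n \<le> f y" by linarith
      then show ?case by (rule dist)
    qed
    ultimately show ?thesis by (simp cong: filterlim_cong)
  qed
  moreover have "uniform_limit C (\<lambda>n x. rdist_set A g x (K n) - rdist_set A g y (K n))
      (\<lambda>x. f x + (- f y)) sequentially" if C: "compact C" for C
  proof (rule uniform_limitI)
    fix e :: real assume e: "e > 0"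
    have "compact (f ` insert y C)"
      using C contf by (intro compact_continuous_image continuous_on_subset[OF contf]) auto
    then have "bdd_below (f ` insert y C)" by (intro bounded_imp_bdd_below compact_imp_bounded)
    then obtain b where b: "\<And>x. x \<in> insert y C \<Longrightarrow> b \<le> f x" unfolding bdd_below_def by blast
    show "\<forall>\<^sub>F n in sequentially. \<forall>x\<in>C.
        dist (rdist_set A g x (K n) - rdist_set A g y (K n)) (f x + (- f y)) < e"
      using eventually_ge_at_top[of "nat \<lceil>- b\<rceil>"]
    proof eventually_elim
      case (elim n)
      then have nb: "- real n \<le> b" by linarith
      show ?case
      proof
        fix x assume "x \<in> C"
        then have "rdist_set A g x (K n) = f x + real n" "rdist_set A g y (K n) = f y + real n"
          using b[of x] b[of y] nb by (auto intro!: dist)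
        then show "dist (rdist_set A g x (K n) - rdist_set A g y (K n)) (f x + (- f y)) < e"
          using e by simp
      qed
    qed
  qed
  ultimately show ?thesis unfolding dl_function_def by blast
qed

lemma viscosity_iff_dl: "viscosity_solution A g f \<longleftrightarrow> (\<exists>c. dl_function A g (\<lambda>x. f x + c))"
  using viscosity_imp_dl dl_imp_viscosity viscosity_add_const by blast

text \<open>Dl-functions are normalized to vanish at some point, so they are fewer than the viscosity solutions;
  the classes modulo constants nevertheless coincide.\<close>

lemma dl_boundary_eq: "dl_boundary A g = {u. viscosity_solution A g u} // eq_mod_const"
proof -
  \<comment> \<open>Only continuous functions lie in the field of the relation.\<close>
  have cls: "eq_mod_const `` {\<lambda>x. f x + c} = eq_mod_const `` {f}"
    if "continuous_on UNIV f" for f :: "'a \<Rightarrow> real" and c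
  proof -
    have "continuous_on UNIV (\<lambda>x. f x + c)" using that by (intro continuous_intros)
    moreover have "(\<exists>k. \<forall>x. h x = f x + c + k) \<longleftrightarrow> (\<exists>k. \<forall>x. h x = f x + k)" for h :: "'a \<Rightarrow> real"
      by (metis add.assoc diff_add_cancel add.commute)
    ultimately show ?thesis using that by (auto simp: eq_mod_const_def)
  qed
  show ?thesis
    unfolding dl_boundary_def
  proof
    show "{h. dl_function A g h} // eq_mod_const \<subseteq> {u. viscosity_solution A g u} // eq_mod_const"
      using dl_imp_viscosity unfolding quotient_def by blast
    show "{u. viscosity_solution A g u} // eq_mod_const \<subseteq> {h. dl_function A g h} // eq_mod_const"
    proof
      fix X assume "X \<in> {u. viscosity_solution A g u} // eq_mod_const"
      then obtain f where f: "viscosity_solution A g f" "X = eq_mod_const `` {f}"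
        unfolding quotient_def by blast
      then obtain c where "dl_function A g (\<lambda>x. f x + c)" using viscosity_iff_dl by blast
      moreover have "X = eq_mod_const `` {\<lambda>x. f x + c}"
        using f cls[of f c] by (simp add: viscosity_solution_def)
      ultimately show "X \<in> {h. dl_function A g h} // eq_mod_const" unfolding quotient_def by blast
    qed
  qed
qed

end

theorem theorem1:
  fixes A :: "('a::{t2_space, second_countable_topology}, 'e::euclidean_space) chart set"
    and g :: "'a \<Rightarrow> ('a, 'e) tvec \<Rightarrow> ('a, 'e) tvec \<Rightarrow> real"
  assumes "smooth_atlas A"
    and "riemannian_metric A g"
    and "connected (UNIV :: 'a set)"
    and "\<not> compact (UNIV :: 'a set)"
    and "complete_riemannian A g"
  shows "(\<forall>f :: 'a \<Rightarrow> real.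
            viscosity_solution A g f \<longleftrightarrow> (\<exists>c::real. dl_function A g (\<lambda>x. f x + c))) \<and>
         dl_boundary A g = {u. viscosity_solution A g u} // eq_mod_const"
proof -
  interpret complete_riemannian_manifold A g
    by unfold_locales (use assms in auto)
  show ?thesis using viscosity_iff_dl dl_boundary_eq by blast
qed

end
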